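(* Let $r,s,t\in\mathbb{C}\setminus\{0,1\}$ be pairwise distinct, let $(R,S,T)\in\mathbb{C}^3$, and let $(\underline E,\underline p)$ be the associated quasi-parabolic bundle on $\mathbb{P}^1$ described in the context. For $(i,Z)\in\{(r,R),(s,S),(t,T)\}$ define, in the frame $(\sigma_{-1},\sigma_1)$, $$\underline\theta_i=\begin{pmatrix}0&0\\1-Z&0\end{pmatrix}\frac{\mathrm{d}x}{x}+\begin{pmatrix}Z&-Z\\Z&-Z\end{pmatrix}\frac{\mathrm{d}x}{x-1}+\begin{pmatrix}-Z&Z^2\\-1&Z\end{pmatrix}\frac{\mathrm{d}x}{x-i}.$$ Then $(\underline\theta_r,\underline\theta_s,\underline\theta_t)$ is the basis of $\mathrm{H}^0(\mathbb{P}^1,\mathfrak{sl}(\underline E,\underline p)\otimes\Omega^1_{\mathbb{P}^1}(\underline W))^{\mathrm{apparent}}$ dual, with respect to the perfect Serre duality pairing $$\langle\cdot,\cdot\rangle:\ \mathrm{H}^1(\mathbb{P}^1,\mathfrak{sl}(\underline E,\underline p))\times\mathrm{H}^0(\mathbb{P}^1,\mathfrak{sl}(\underline E,\underline p)\otimes\Omega^1_{\mathbb{P}^1}(\underline W))^{\mathrm{apparent}}\to\mathbb{C},\qquad(\phi,\underline\theta)\mapsto\sum\mathrm{Res}(\mathrm{trace}(\phi\cdot\underline\theta)),$$ to the basis $\left(\frac{\partial}{\partial R},\frac{\partial}{\partial S},\frac{\partial}{\partial T}\right)$ of the tangent space at $(R,S,T)$, identified with $\mathrm{H}^1(\mathbb{P}^1,\mathfrak{sl}(\underline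 E,\underline p))$.
   Context: $\underline W=\{0,1,r,s,t,\infty\}\subset\mathbb{P}^1$ and $\underline E=\mathcal{O}_{\mathbb{P}^1}(-1)\oplus\mathcal{O}_{\mathbb{P}^1}(-2)$. Let $\sigma_{-1}$ be a meromorphic section of the subbundle $\mathcal{O}(-1)$ whose only pole is a simple one over $\infty$, and $\sigma_1$ a meromorphic section of the summand $\mathcal{O}(-2)$ whose only pole is a double one over $\infty$ (both without zeros); over $\mathbb{P}^1\setminus\{\infty\}$ write $\binom{z_1}{z_2}=z_1\sigma_{-1}+z_2\sigma_1$. The quasi-parabolic structure $\underline p$ associated with $(R,S,T)$ consists of the lines generated by $\binom01,\binom11,\binom R1,\binom S1,\binom T1$ in the fibres over $x=0,1,r,s,t$, and, over $\infty$, of the fibre of the summand $\mathcal{O}(-2)$ containing $\sigma_1$. As $(R,S,T)$ varies this gives an affine chart of a moduli space of quasi-parabolic bundles. $\mathfrak{sl}(\underline E,\underline p)$ is the sheaf of trace free endomorphisms of $\underline E$ preserving the lines of $\underline p$. The superscript "apparent" denotes the space of trace free logarithmic Higgs fields $\underline\theta:\underline E\to\underline E\otimes\Omega^1_{\mathbb{P}^1}(\underline W)$ whose residue at each $\underline w\in\underline W$ is either zero or conjugate to $\begin{pmatrix}0&0\\1&0\end{pmatrix}$ with $0$-eigendirection equal to the line $\underline p_{\underline w}$. The tangent vector $\frac{\partial}{\partial R}$ is given in $\mathrm{H}^1(\mathbb{P}^1,\mathfrak{sl}(\underline E,\underline p))$ by the cocycle $\phi_{01}=\begin{pmatrix}0&1\\0&0\end{pmatrix}$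 with respect to $U_0=\mathbb{P}^1\setminus\{r\}$ and a small disc $U_1$ around $r$: applying $\exp(\zeta\phi_{01})$ from the left, over $U_0\cap U_1\subset U_1$ to $U_0\cap U_1\subset U_0$, yields the quasi-parabolic structure corresponding to $(R+\zeta,S,T)$. Similarly for $\frac{\partial}{\partial S}$, $\frac{\partial}{\partial T}$ with $r$ replaced by $s$, $t$. *)

theory Defs
  imports "HOL-Complex_Analysis.Complex_Analysis"
begin

section \<open>Complex vector spaces on carrier sets\<close>

text \<open>Cohomology classes are sets of cocycles, so the spaces are given by carriers with operations.\<close>

record 'v cspace =
  cs_carrier :: "'v set"
  cs_add :: "'v \<Rightarrow> 'v \<Rightarrow> 'v"
  cs_scale :: "complex \<Rightarrow> 'v \<Rightarrow> 'v"

definition lin_comb3 :: "'v cspace \<Rightarrow> 'v \<Rightarrow> 'v \<Rightarrow> 'v \<Rightarrow> complex^3 \<Rightarrow> 'v" where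
  "lin_comb3 V a b c k =
     cs_add V (cs_add V (cs_scale V (k$1) a) (cs_scale V (k$2) b)) (cs_scale V (k$3) c)"

text \<open>The coordinate map \<open>\<complex>\<^sup>3 \<rightarrow> V\<close> is a linear isomorphism. In particular the operations
  of \<open>V\<close> do define a complex vector space.\<close>

definition is_basis3 :: "'v cspace \<Rightarrow> 'v \<Rightarrow> 'v \<Rightarrow> 'v \<Rightarrow> bool" where
  "is_basis3 V a b c \<longleftrightarrow>
     a \<in> cs_carrier V \<and> b \<in> cs_carrier V \<and> c \<in> cs_carrier V \<and>
     bij_betw (lin_comb3 V a b c) UNIV (cs_carrier V) \<and>
     (\<forall>k l. lin_comb3 V a b c (k + l) = cs_add V (lin_comb3 V a b c k) (lin_comb3 V a b c l)) \<and>
     (\<forall>z k. lin_comb3 V a b c (z *s k) = cs_scale V z (lin_comb3 V a b c k))"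

definition linear_form :: "'v cspace \<Rightarrow> ('v \<Rightarrow> complex) \<Rightarrow> bool" where
  "linear_form V l \<longleftrightarrow>
     (\<forall>v\<in>cs_carrier V. \<forall>w\<in>cs_carrier V. l (cs_add V v w) = l v + l w) \<and>
     (\<forall>z. \<forall>v\<in>cs_carrier V. l (cs_scale V z v) = z * l v)"

definition perfect_pairing :: "'v cspace \<Rightarrow> 'w cspace \<Rightarrow> ('v \<Rightarrow> 'w \<Rightarrow> complex) \<Rightarrow> bool" where
  "perfect_pairing V W P \<longleftrightarrow>
     (\<forall>v\<in>cs_carrier V. linear_form W (P v)) \<and>
     (\<forall>w\<in>cs_carrier W. linear_form V (\<lambda>v. P v w)) \<and>
     (\<forall>l. linear_form W l \<longrightarrow> (\<exists>!v. v \<in> cs_carrier V \<and> (\<forall>w\<in>cs_carrier W. P v w = l w))) \<and>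
     (\<forall>l. linear_form V l \<longrightarrow> (\<exists>!w. w \<in> cs_carrier W \<and> (\<forall>v\<in>cs_carrier V. P v w = l v)))"


section \<open>First Cech cohomology\<close>

text \<open>
  A sheaf of functions on \<open>X\<close> is given by its sets of sections \<open>F U\<close>; only the values on \<open>U\<close> of
  a section over \<open>U\<close> matter. The group \<open>H\<^sup>1(X, F)\<close> is the direct limit over all open coverings.
  As in Godement's treatment, coverings are indexed by the points of \<open>X\<close>, with \<open>p \<in> U p\<close>: every
  open covering is refined by one of these, and two of them have the common refinement
  \<open>p \<mapsto> U p \<inter> V p\<close>.
\<close>

type_synonym ('a, 'b) cech = "('a \<Rightarrow> 'a set) \<times> ('a \<Rightarrow> 'a \<Rightarrow> 'a \<Rightarrow> 'b)"

definition point_cover :: "'a topology \<Rightarrow> ('a \<Rightarrow> 'a set) \<Rightarrow> bool" where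
  "point_cover X U \<longleftrightarrow> (\<forall>p\<in>topspace X. openin X (U p) \<and> p \<in> U p)"

definition cech_cocycles ::
  "'a topology \<Rightarrow> ('a set \<Rightarrow> ('a \<Rightarrow> 'b::ab_group_add) set) \<Rightarrow> ('a, 'b) cech set" where
  "cech_cocycles X F = {(U, \<phi>). point_cover X U \<and>
     (\<forall>p\<in>topspace X. \<forall>q\<in>topspace X. \<phi> p q \<in> F (U p \<inter> U q)) \<and>
     (\<forall>p\<in>topspace X. \<forall>q\<in>topspace X. \<forall>m\<in>topspace X. \<forall>x\<in>U p \<inter> U q \<inter> U m.
        \<phi> p q x + \<phi> q m x = \<phi> p m x)}"

definition cech_rel ::
  "'a topology \<Rightarrow> ('a set \<Rightarrow> ('a \<Rightarrow> 'b::ab_group_add) set) \<Rightarrow> (('a, 'b) cech \<times> ('a, 'b) cech) set" where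
  "cech_rel X F = {((U, \<phi>), (V, \<psi>)). (U, \<phi>) \<in> cech_cocycles X F \<and> (V, \<psi>) \<in> cech_cocycles X F \<and>
     (\<exists>W g. point_cover X W \<and>
        (\<forall>p\<in>topspace X. W p \<subseteq> U p \<inter> V p \<and> g p \<in> F (W p)) \<and>
        (\<forall>p\<in>topspace X. \<forall>q\<in>topspace X. \<forall>x\<in>W p \<inter> W q. \<phi> p q x - \<psi> p q x = g p x - g q x))}"

definition cech_add :: "('a, 'b::ab_group_add) cech \<Rightarrow> ('a, 'b) cech \<Rightarrow> ('a, 'b) cech" where
  "cech_add \<xi> \<eta> = (\<lambda>p. fst \<xi> p \<inter> fst \<eta> p, \<lambda>p q x. snd \<xi> p q x + snd \<eta> p q x)"

definition cech_scale ::
  "(complex \<Rightarrow> 'b \<Rightarrow> 'b) \<Rightarrow> complex \<Rightarrow> ('a, 'b) cech \<Rightarrow> ('a, 'b) cech" where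
  "cech_scale sc z \<xi> = (fst \<xi>, \<lambda>p q x. sc z (snd \<xi> p q x))"

definition cech_H1 ::
  "'a topology \<Rightarrow> ('a set \<Rightarrow> ('a \<Rightarrow> 'b::ab_group_add) set) \<Rightarrow> (complex \<Rightarrow> 'b \<Rightarrow> 'b)
     \<Rightarrow> ('a, 'b) cech set cspace" where
  "cech_H1 X F sc =
     \<lparr> cs_carrier = cech_cocycles X F // cech_rel X F,
       cs_add = (\<lambda>a b. cech_rel X F `` {cech_add \<xi> \<eta> |\<xi> \<eta>. \<xi> \<in> a \<and> \<eta> \<in> b}),
       cs_scale = (\<lambda>z a. cech_rel X F `` (cech_scale sc z ` a)) \<rparr>"


section \<open>The projective line and the bundle \<open>\<O>(-1) \<oplus> \<O>(-2)\<close>\<close>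

abbreviation P1 :: "complex option topology" where
  "P1 \<equiv> Alexandroff_compactification euclidean"

text \<open>The chart \<open>u = 1/x\<close> at infinity.\<close>

definition chart_inf :: "complex \<Rightarrow> complex option" where
  "chart_inf u = (if u = 0 then None else Some (inverse u))"

definition mat2 :: "complex \<Rightarrow> complex \<Rightarrow> complex \<Rightarrow> complex \<Rightarrow> complex^2^2" where
  "mat2 a b c d = vector [vector [a, b], vector [c, d]]"

definition mscale :: "complex \<Rightarrow> complex^2^2 \<Rightarrow> complex^2^2" where
  "mscale z A = mat z ** A"

text \<open>
  Over \<open>\<complex>\<close> the bundle has the frame \<open>(\<sigma>\<^sub>-\<^sub>1, \<sigma>\<^sub>1)\<close>. Since \<open>\<sigma>\<^sub>-\<^sub>1\<close> has a simple and \<open>\<sigma>\<^sub>1\<close> a double pole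
  at infinity, \<open>(u \<sigma>\<^sub>-\<^sub>1, u\<^sup>2 \<sigma>\<^sub>1)\<close> is a holomorphic frame there. The following matrix turns
  coordinates with respect to the first frame into coordinates with respect to the second.
\<close>

definition to_inf :: "complex \<Rightarrow> complex^2^2" where
  "to_inf u = mat2 (1 / u) 0 0 (1 / u\<^sup>2)"

definition holomorphic_matrix_on :: "(complex \<Rightarrow> complex^2^2) \<Rightarrow> complex set \<Rightarrow> bool" where
  "holomorphic_matrix_on A S \<longleftrightarrow> (\<forall>i j. (\<lambda>x. A x $ i $ j) holomorphic_on S)"

text \<open>
  An endomorphism of the bundle is recorded by its matrix at each point: at \<open>Some x\<close> in the frame
  \<open>(\<sigma>\<^sub>-\<^sub>1, \<sigma>\<^sub>1)\<close>, at \<open>None\<close> in the frame at infinity. Its matrix in the frame at infinity, as a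
  function of \<open>u\<close>, is:
\<close>

definition endo_inf :: "(complex option \<Rightarrow> complex^2^2) \<Rightarrow> complex \<Rightarrow> complex^2^2" where
  "endo_inf A u =
     (if u = 0 then A None else to_inf u ** A (Some (inverse u)) ** matrix_inv (to_inf u))"

definition holomorphic_endo_on :: "(complex option \<Rightarrow> complex^2^2) \<Rightarrow> complex option set \<Rightarrow> bool" where
  "holomorphic_endo_on A U \<longleftrightarrow>
     holomorphic_matrix_on (\<lambda>x. A (Some x)) {x. Some x \<in> U} \<and>
     holomorphic_matrix_on (endo_inf A) {u. chart_inf u \<in> U}"

definition preserves_line :: "complex^2^2 \<Rightarrow> (complex^2) set \<Rightarrow> bool" where
  "preserves_line A l \<longleftrightarrow> (\<forall>v\<in>l. A *v v \<in> l)"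

definition sl_sheaf ::
  "complex option set \<Rightarrow> (complex option \<Rightarrow> (complex^2) set)
     \<Rightarrow> complex option set \<Rightarrow> (complex option \<Rightarrow> complex^2^2) set" where
  "sl_sheaf W l U = {A. holomorphic_endo_on A U \<and> (\<forall>p\<in>U. trace (A p) = 0) \<and>
     (\<forall>w\<in>W \<inter> U. preserves_line (A w) (l w))}"


section \<open>Logarithmic Higgs fields\<close>

text \<open>
  A Higgs field \<open>\<Theta> dx\<close> is recorded by \<open>\<Theta>\<close>, in the frame \<open>(\<sigma>\<^sub>-\<^sub>1, \<sigma>\<^sub>1)\<close>. Its coefficient of \<open>du\<close>
  in the frame at infinity uses \<open>dx = - du / u\<^sup>2\<close>.
\<close>

definition higgs_inf :: "(complex \<Rightarrow> complex^2^2) \<Rightarrow> complex \<Rightarrow> complex^2^2" where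
  "higgs_inf \<Theta> u =
     mscale (- 1 / u\<^sup>2) (to_inf u ** \<Theta> (inverse u) ** matrix_inv (to_inf u))"

definition log_pole_at :: "(complex \<Rightarrow> complex^2^2) \<Rightarrow> complex \<Rightarrow> bool" where
  "log_pole_at A z \<longleftrightarrow> (\<forall>i j. \<exists>g. g analytic_on {z} \<and>
     (\<forall>\<^sub>F x in at z. (x - z) * A x $ i $ j = g x))"

definition residue_matrix :: "(complex \<Rightarrow> complex^2^2) \<Rightarrow> complex \<Rightarrow> complex^2^2" where
  "residue_matrix A z = (\<chi> i j. residue (\<lambda>x. A x $ i $ j) z)"

definition higgs_residue :: "(complex \<Rightarrow> complex^2^2) \<Rightarrow> complex option \<Rightarrow> complex^2^2" where
  "higgs_residue \<Theta> w = (case w of Some x \<Rightarrow> residue_matrix \<Theta> x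
                                | None \<Rightarrow> residue_matrix (higgs_inf \<Theta>) 0)"

text \<open>
  \<open>H\<^sup>0(\<P>\<^sup>1, sl(E, p) \<otimes> \<Omega>\<^sup>1(W))\<close>, for \<open>W\<close> containing infinity. Values at the points of \<open>W\<close> are
  meaningless and set to \<open>0\<close>, so that equal Higgs fields are equal as functions.
\<close>

definition log_higgs_fields ::
  "complex option set \<Rightarrow> (complex option \<Rightarrow> (complex^2) set) \<Rightarrow> (complex \<Rightarrow> complex^2^2) set" where
  "log_higgs_fields W l = {\<Theta>.
     holomorphic_matrix_on \<Theta> {x. Some x \<notin> W} \<and> (\<forall>x. Some x \<in> W \<longrightarrow> \<Theta> x = 0) \<and>
     (\<forall>x. trace (\<Theta> x) = 0) \<and>
     (\<forall>x. Some x \<in> W \<longrightarrow> log_pole_at \<Theta> x) \<and> log_pole_at (higgs_inf \<Theta>) 0 \<and>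
     (\<forall>w\<in>W. preserves_line (higgs_residue \<Theta> w) (l w))}"

definition apparent_residue :: "complex^2^2 \<Rightarrow> (complex^2) set \<Rightarrow> bool" where
  "apparent_residue N l \<longleftrightarrow> N = 0 \<or>
     ((\<exists>P. invertible P \<and> N = P ** mat2 0 0 1 0 ** matrix_inv P) \<and> {v. N *v v = 0} = l)"

definition apparent_higgs ::
  "complex option set \<Rightarrow> (complex option \<Rightarrow> (complex^2) set) \<Rightarrow> (complex \<Rightarrow> complex^2^2) cspace" where
  "apparent_higgs W l =
     \<lparr> cs_carrier = {\<Theta> \<in> log_higgs_fields W l. \<forall>w\<in>W. apparent_residue (higgs_residue \<Theta> w) (l w)},
       cs_add = (\<lambda>\<Theta> \<Psi> x. \<Theta> x + \<Psi> x),
       cs_scale = (\<lambda>z \<Theta> x. mscale z (\<Theta> x)) \<rparr>"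


section \<open>Serre duality\<close>

text \<open>A meromorphic 1-form \<open>f dx\<close> is recorded by \<open>f\<close>.\<close>

definition form_inf :: "(complex \<Rightarrow> complex) \<Rightarrow> complex \<Rightarrow> complex" where
  "form_inf f u = - f (inverse u) / u\<^sup>2"

definition meromorphic_form_on :: "(complex \<Rightarrow> complex) \<Rightarrow> complex option set \<Rightarrow> bool" where
  "meromorphic_form_on f U \<longleftrightarrow>
     f meromorphic_on {x. Some x \<in> U} \<and> form_inf f meromorphic_on {u. chart_inf u \<in> U}"

definition form_residue :: "(complex \<Rightarrow> complex) \<Rightarrow> complex option \<Rightarrow> complex" where
  "form_residue f p = (case p of Some x \<Rightarrow> residue f x | None \<Rightarrow> residue (form_inf f) 0)"

text \<open>
  The pairing sends \<open>(\<phi>, \<theta>)\<close> to the sum of residues of the class of the cocycle \<open>trace (\<phi> \<theta>)\<close> in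
  \<open>H\<^sup>1(\<P>\<^sup>1, \<Omega>\<^sup>1)\<close>: one writes this cocycle as the coboundary of meromorphic 1-forms \<open>\<mu> p\<close> on
  \<open>U p\<close> (a Mittag-Leffler distribution) and adds up the residues of \<open>\<mu> p\<close> at \<open>p\<close>.
  The sign convention for the coboundary is \<open>\<phi>\<^sub>0\<^sub>1 = \<mu>\<^sub>0 - \<mu>\<^sub>1\<close>; the opposite one would change the
  sign of the pairing.
\<close>

definition mittag_leffler ::
  "(complex option, complex^2^2) cech \<Rightarrow> (complex \<Rightarrow> complex^2^2)
     \<Rightarrow> (complex option \<Rightarrow> complex \<Rightarrow> complex) \<Rightarrow> bool" where
  "mittag_leffler \<xi> \<Theta> \<mu> \<longleftrightarrow>
     (\<forall>p. meromorphic_form_on (\<mu> p) (fst \<xi> p)) \<and>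
     (\<forall>p q x. Some x \<in> fst \<xi> p \<inter> fst \<xi> q \<longrightarrow>
        (\<forall>\<^sub>F y in at x. \<mu> p y - \<mu> q y = trace (snd \<xi> p q (Some y) ** \<Theta> y)))"

definition serre_pairing ::
  "(complex option, complex^2^2) cech set \<Rightarrow> (complex \<Rightarrow> complex^2^2) \<Rightarrow> complex" where
  "serre_pairing a \<Theta> = (THE z. \<exists>\<xi>\<in>a. \<exists>\<mu>. mittag_leffler \<xi> \<Theta> \<mu> \<and>
     finite {p. form_residue (\<mu> p) p \<noteq> 0} \<and>
     z = (\<Sum>p | form_residue (\<mu> p) p \<noteq> 0. form_residue (\<mu> p) p))"


section \<open>The quasi-parabolic structure and its deformations\<close>

definition marked :: "complex \<Rightarrow> complex \<Rightarrow> complex \<Rightarrow> complex option set" where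
  "marked r s t = {Some 0, Some 1, Some r, Some s, Some t, None}"

definition par_line ::
  "complex \<Rightarrow> complex \<Rightarrow> complex \<Rightarrow> complex \<Rightarrow> complex \<Rightarrow> complex \<Rightarrow> complex option \<Rightarrow> (complex^2) set" where
  "par_line r s t R S T w = vec.span {
     if w = Some 1 then vector [1, 1]
     else if w = Some r then vector [R, 1]
     else if w = Some s then vector [S, 1]
     else if w = Some t then vector [T, 1]
     else vector [0, 1]}"

definition H1_sl ::
  "complex \<Rightarrow> complex \<Rightarrow> complex \<Rightarrow> complex \<Rightarrow> complex \<Rightarrow> complex
     \<Rightarrow> (complex option, complex^2^2) cech set cspace" where
  "H1_sl r s t R S T = cech_H1 P1 (sl_sheaf (marked r s t) (par_line r s t R S T)) mscale"

definition H0_apparent ::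
  "complex \<Rightarrow> complex \<Rightarrow> complex \<Rightarrow> complex \<Rightarrow> complex \<Rightarrow> complex \<Rightarrow> (complex \<Rightarrow> complex^2^2) cspace" where
  "H0_apparent r s t R S T = apparent_higgs (marked r s t) (par_line r s t R S T)"

text \<open>
  The cocycle \<open>\<phi>\<^sub>0\<^sub>1\<close> for \<open>U\<^sub>0 = \<P>\<^sup>1 \<setminus> {i}\<close> and the disc \<open>U\<^sub>1\<close> of radius \<open>\<rho>\<close> around \<open>i\<close>, written on the
  covering that assigns \<open>U\<^sub>1\<close> to the point \<open>i\<close> and \<open>U\<^sub>0\<close> to all other points.
\<close>

definition deformation_cocycle :: "complex \<Rightarrow> real \<Rightarrow> (complex option, complex^2^2) cech" where
  "deformation_cocycle i \<rho> =
     (\<lambda>p. if p = Some i then Some ` ball i \<rho> else - {Some i},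
      \<lambda>p q x. if p \<noteq> Some i \<and> q = Some i then mat2 0 1 0 0
              else if p = Some i \<and> q \<noteq> Some i then - mat2 0 1 0 0
              else 0)"

text \<open>Since \<open>\<phi>\<^sub>0\<^sub>1\<close> has square zero, \<open>exp(\<zeta> \<phi>\<^sub>0\<^sub>1) = 1 + \<zeta> \<phi>\<^sub>0\<^sub>1\<close>.\<close>

lemma deformation_moves_line:
  "(mat 1 + mscale \<zeta> (mat2 0 1 0 0)) *v vector [Z, 1] = vector [Z + \<zeta>, 1]"
  by (simp add: mscale_def mat2_def vec_eq_iff forall_2 matrix_vector_mult_def
      matrix_matrix_mult_def sum_2 mat_def)

definition tangent_vector ::
  "complex \<Rightarrow> complex \<Rightarrow> complex \<Rightarrow> complex \<Rightarrow> complex \<Rightarrow> complex \<Rightarrow> complex \<Rightarrow> real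
     \<Rightarrow> (complex option, complex^2^2) cech set" where
  "tangent_vector r s t R S T i \<rho> =
     cech_rel P1 (sl_sheaf (marked r s t) (par_line r s t R S T)) `` {deformation_cocycle i \<rho>}"

definition small_radius :: "complex \<Rightarrow> complex \<Rightarrow> complex \<Rightarrow> complex \<Rightarrow> real \<Rightarrow> bool" where
  "small_radius r s t i \<rho> \<longleftrightarrow> 0 < \<rho> \<and> (\<forall>w\<in>{0, 1, r, s, t} - {i}. w \<notin> ball i \<rho>)"

definition theta ::
  "complex \<Rightarrow> complex \<Rightarrow> complex \<Rightarrow> complex \<Rightarrow> complex \<Rightarrow> complex \<Rightarrow> complex^2^2" where
  "theta r s t i Z x =
     (if Some x \<in> marked r s t then 0
      else mscale (1 / x) (mat2 0 0 (1 - Z) 0)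
         + mscale (1 / (x - 1)) (mat2 Z (- Z) Z (- Z))
         + mscale (1 / (x - i)) (mat2 (- Z) (Z\<^sup>2) (- 1) Z))"

end

theory Submission
  imports Defs
begin

text \<open>
  A section of \<open>sl(E, p)\<close> has three scalar entries, which near infinity are holomorphic, holomorphic
  and holomorphic with a zero. So a cocycle splits entrywise once \<open>H\<^sup>1(\<P>\<^sup>1, \<O>) = 0\<close> is known, and
  up to two free constants the only obstruction to preserving the lines is one number at each of
  \<open>r\<close>, \<open>s\<close>, \<open>t\<close>: hence the three deformation cocycles generate \<open>H\<^sup>1\<close>. That \<open>H\<^sup>1(\<P>\<^sup>1, \<O>) = 0\<close> holds
  for an arbitrary covering follows by Cousin's method: holomorphic functions near a segment or a
  circle split by the Cauchy integral, so splittings of a cocycle near adjacent rectangles can be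
  glued, and bisection reaches every rectangle. The pairing is well defined by the residue theorem,
  since a section preserving a line pairs without residue with a nilpotent residue along that line.
  An apparent Higgs field is the sum of its principal parts by Liouville's theorem. Finally the
  two families are dual, which also shows that the deformation cocycles are independent.
\<close>

section \<open>Vanishing of the first cohomology of the structure sheaf\<close>

text \<open>Because classes live in a limit over all coverings, no convenient covering can be fixed
  in advance: each cocycle has to be split on the covering on which it happens to be given. The
  matrix entries are sections of O, O(1) and O(-1). The line over infinity forces the O(1) entry to
  vanish there, which makes it a function with a finite limit; the O(-1) entry is split in O and a
  constant is then subtracted to restore its zero. So vanishing for O alone serves all entries. That
  the slopes over the points 0 and 1 differ is what lets two constants remove both defects there.
  Perfectness is not drawn from general Serre duality and no dimension is computed: generation of
  one space, an explicit parametrisation of the other and a diagonal pairing matrix give it at once.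
  Since the deformation cocycles generate, Mittag-Leffler distributions have to be produced only for
  their combinations, where they can be written down.\<close>

lemma topspace_P1 [simp]: "topspace P1 = UNIV"
  by (auto simp: UNIV_option_conv)

declare topspace_Alexandroff_compactification [simp del]

text \<open>Neighbourhoods of infinity are complements of compact sets, that is, of closed bounded
  ones. Phrased with \<open>at_infinity\<close>, openness at \<open>None\<close> becomes directly
  usable in limit arguments.\<close>

lemma openin_P1_iff:
  "openin P1 U \<longleftrightarrow>
     open {x. Some x \<in> U} \<and> (None \<in> U \<longrightarrow> (\<forall>\<^sub>F x in at_infinity. Some x \<in> U))"
proof
  assume "openin P1 U"
  then consider V where "open V" "U = Some ` V"
    | C where "compact C" "U = insert None (Some ` (- C))"
    by (auto simp: openin_Alexandroff_compactification Compl_eq_Diff_UNIV)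
  then show "open {x. Some x \<in> U} \<and> (None \<in> U \<longrightarrow> (\<forall>\<^sub>F x in at_infinity. Some x \<in> U))"
  proof cases
    case 1
    then have "{x. Some x \<in> U} = V" by auto
    with 1 show ?thesis by auto
  next
    case 2
    then have "{x. Some x \<in> U} = - C" by auto
    moreover obtain b where "\<And>x. x \<in> C \<Longrightarrow> norm x \<le> b"
      using compact_imp_bounded[OF 2(1)] unfolding bounded_iff by blast
    then have "\<forall>x. b + 1 \<le> norm x \<longrightarrow> x \<notin> C" by force
    ultimately show ?thesis
      using 2 compact_imp_closed[OF 2(1)] by (force simp: eventually_at_infinity)
  qed
next
  assume *: "open {x. Some x \<in> U} \<and> (None \<in> U \<longrightarrow> (\<forall>\<^sub>F x in at_infinity. Some x \<in> U))"
  show "openin P1 U"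
  proof (cases "None \<in> U")
    case False
    have "U = Some ` {x. Some x \<in> U}"
    proof (intro set_eqI)
      fix p show "p \<in> U \<longleftrightarrow> p \<in> Some ` {x. Some x \<in> U}"
        using False by (cases p) auto
    qed
    with * show ?thesis
      by (metis open_openin openin_Alexandroff_compactification_image_Some)
  next
    case True
    define C where "C = {x. Some x \<notin> U}"
    have "closed C" using * by (simp add: C_def closed_def Collect_neg_eq[symmetric])
    moreover obtain b where "\<forall>x. b \<le> norm x \<longrightarrow> Some x \<in> U"
      using * True by (auto simp: eventually_at_infinity)
    then have "bounded C" unfolding bounded_iff C_def
      by (metis linorder_le_cases mem_Collect_eq)
    ultimately have "compact C" by (simp add: compact_eq_bounded_closed)
    moreover have "U = insert None (Some ` (UNIV - C))"
    proof (intro set_eqI)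
      fix p show "p \<in> U \<longleftrightarrow> p \<in> insert None (Some ` (UNIV - C))"
        using True by (cases p) (auto simp: C_def)
    qed
    ultimately show ?thesis
      unfolding openin_Alexandroff_compactification using \<open>closed C\<close> by auto
  qed
qed

text \<open>
  Sections of \<open>\<O>\<close> are functions on the finite part. The value at infinity is the limit, so that
  identities need to be checked at finite points only.
\<close>

definition hol_P1 :: "(complex \<Rightarrow> complex) \<Rightarrow> complex option set \<Rightarrow> bool" where
  "hol_P1 f U \<longleftrightarrow> f holomorphic_on {x. Some x \<in> U} \<and>
     (None \<in> U \<longrightarrow> (\<exists>l. (f \<longlongrightarrow> l) at_infinity))"

lemma hol_P1_subset: "hol_P1 f V \<Longrightarrow> U \<subseteq> V \<Longrightarrow> hol_P1 f U"
  by (auto simp: hol_P1_def intro: holomorphic_on_subset)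

lemma hol_P1_diff: "hol_P1 f U \<Longrightarrow> hol_P1 g U \<Longrightarrow> hol_P1 (\<lambda>x. f x - g x) U"
  by (auto simp: hol_P1_def intro!: holomorphic_intros intro: tendsto_diff)

lemma hol_P1_add: "hol_P1 f U \<Longrightarrow> hol_P1 g U \<Longrightarrow> hol_P1 (\<lambda>x. f x + g x) U"
  by (auto simp: hol_P1_def intro!: holomorphic_intros intro: tendsto_add)

lemma hol_P1_const: "hol_P1 (\<lambda>x. c) U"
  by (auto simp: hol_P1_def)

text \<open>Openness enters at infinity: it makes the equality on \<open>U\<close> hold eventually,
  so that the limit carries over.\<close>

lemma hol_P1_cong:
  assumes "openin P1 U" "\<And>x. Some x \<in> U \<Longrightarrow> f x = g x" "hol_P1 f U"
  shows "hol_P1 g U"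
  unfolding hol_P1_def
proof (intro conjI impI)
  show "g holomorphic_on {x. Some x \<in> U}"
    using assms holomorphic_cong[of "{x. Some x \<in> U}" "{x. Some x \<in> U}" f g] by (auto simp: hol_P1_def)
  assume "None \<in> U"
  then obtain l where "(f \<longlongrightarrow> l) at_infinity" using assms by (auto simp: hol_P1_def)
  moreover have "\<forall>\<^sub>F x in at_infinity. f x = g x"
    using assms(1) \<open>None \<in> U\<close> unfolding openin_P1_iff
    by (auto elim!: eventually_mono simp: assms(2))
  ultimately show "\<exists>l. (g \<longlongrightarrow> l) at_infinity"
    using tendsto_cong by blast
qed

lemma hol_P1_UN:
  assumes "\<And>p. p \<in> I \<Longrightarrow> openin P1 (A p) \<and> hol_P1 f (A p)"
  shows "hol_P1 f (\<Union>p\<in>I. A p)"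
proof -
  have "{x. Some x \<in> (\<Union>p\<in>I. A p)} = (\<Union>p\<in>I. {x. Some x \<in> A p})" by auto
  then show ?thesis using assms
    by (auto simp: hol_P1_def openin_P1_iff intro!: holomorphic_on_UN_open)
qed

lemma hol_P1_Un:
  assumes "openin P1 U" "openin P1 V" "hol_P1 f U" "hol_P1 f V"
  shows "hol_P1 f (U \<union> V)"
  using hol_P1_UN[of "{U, V}" id f] assms by auto

section \<open>Splittings of a cocycle and how they glue\<close>

locale O_cocycle =
  fixes U :: "complex option \<Rightarrow> complex option set"
    and f :: "complex option \<Rightarrow> complex option \<Rightarrow> complex \<Rightarrow> complex"
  assumes openU: "\<And>p. openin P1 (U p)" and memU: "\<And>p. p \<in> U p"
    and hol: "\<And>p q. hol_P1 (f p q) (U p \<inter> U q)"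
    and cocycle: "\<And>p q m x. Some x \<in> U p \<inter> U q \<inter> U m \<Longrightarrow> f p q x + f q m x = f p m x"
begin

text \<open>The splitting is demanded on an open neighbourhood of \<open>K\<close>: two closed
  pieces that share only an edge then still have overlapping domains, which gluing requires.\<close>

definition splits_near :: "complex option set \<Rightarrow> bool" where
  "splits_near K \<longleftrightarrow> (\<exists>N g. openin P1 N \<and> K \<subseteq> N \<and> (\<forall>p. hol_P1 (g p) (U p \<inter> N)) \<and>
     (\<forall>p q x. Some x \<in> U p \<inter> U q \<inter> N \<longrightarrow> f p q x = g p x - g q x))"

lemma splits_near_subset: "splits_near K \<Longrightarrow> L \<subseteq> K \<Longrightarrow> splits_near L"
  unfolding splits_near_def by (meson order_trans)

text \<open>Inside one member of the covering the cocycle identity is already a splitting, with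
  \<open>f p m\<close> as the cochain.\<close>

lemma splits_near_local: "K \<subseteq> U m \<Longrightarrow> splits_near K"
  unfolding splits_near_def
proof (intro exI conjI allI impI)
  show "openin P1 (U m)" by (rule openU)
  show "hol_P1 (f p m) (U p \<inter> U m)" for p by (rule hol)
  fix p q x assume *: "Some x \<in> U p \<inter> U q \<inter> U m"
  show "f p q x = f p m x - f q m x"
    using cocycle[of x p q m] * by (simp add: algebra_simps)
qed

text \<open>Two splittings of the same cocycle differ by something independent of the index
  \<open>p\<close>, hence by a single function \<open>h\<close> near \<open>A \<inter> B\<close>.
  Writing \<open>h = a - b\<close> and subtracting \<open>a\<close> and \<open>b\<close> from the
  two cochains makes them agree. The hypothesis \<open>split\<close> isolates this Cousin problem
  for one function, the place where the shape of the pieces matters.\<close>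

lemma splits_near_glue:
  assumes A: "splits_near A" and B: "splits_near B"
    and split: "\<And>M h. openin P1 M \<Longrightarrow> A \<inter> B \<subseteq> M \<Longrightarrow> hol_P1 h M \<Longrightarrow>
      \<exists>NA NB a b. openin P1 NA \<and> openin P1 NB \<and> A \<subseteq> NA \<and> B \<subseteq> NB \<and>
         hol_P1 a NA \<and> hol_P1 b NB \<and> (\<forall>x. Some x \<in> NA \<inter> NB \<longrightarrow> Some x \<in> M \<and> h x = a x - b x)"
  shows "splits_near (A \<union> B)"
proof -
  obtain NA gA where NA: "openin P1 NA" "A \<subseteq> NA" "\<And>p. hol_P1 (gA p) (U p \<inter> NA)"
    "\<And>p q x. Some x \<in> U p \<inter> U q \<inter> NA \<Longrightarrow> f p q x = gA p x - gA q x"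
    using A unfolding splits_near_def by blast
  obtain NB gB where NB: "openin P1 NB" "B \<subseteq> NB" "\<And>p. hol_P1 (gB p) (U p \<inter> NB)"
    "\<And>p q x. Some x \<in> U p \<inter> U q \<inter> NB \<Longrightarrow> f p q x = gB p x - gB q x"
    using B unfolding splits_near_def by blast
  \<comment> \<open>All indices give the same difference; \<open>Some x\<close> is one that is
    available at every \<open>x\<close>, because each point lies in its own member.\<close>
  define h where "h = (\<lambda>x. gA (Some x) x - gB (Some x) x)"
  have h: "h x = gA p x - gB p x" if "Some x \<in> U p \<inter> NA \<inter> NB" for p x
    using NA(4)[of x p "Some x"] NB(4)[of x p "Some x"] that memU[of "Some x"]
    unfolding h_def by (simp add: algebra_simps) (metis add.assoc add.commute)
  have "hol_P1 h (U p \<inter> NA \<inter> NB)" for p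
  proof (rule hol_P1_cong)
    show "openin P1 (U p \<inter> NA \<inter> NB)" using openU NA NB by auto
    show "hol_P1 (\<lambda>x. gA p x - gB p x) (U p \<inter> NA \<inter> NB)"
      by (intro hol_P1_diff hol_P1_subset[OF NA(3)] hol_P1_subset[OF NB(3)]) auto
  qed (use h in auto)
  then have "hol_P1 h (\<Union>p\<in>UNIV. U p \<inter> NA \<inter> NB)"
    using openU NA NB by (intro hol_P1_UN) auto
  then have "hol_P1 h (NA \<inter> NB)"
    by (rule hol_P1_subset) (use memU in auto)
  then obtain NA' NB' a b where N': "openin P1 NA'" "openin P1 NB'" "A \<subseteq> NA'" "B \<subseteq> NB'"
    "hol_P1 a NA'" "hol_P1 b NB'"
    "\<And>x. Some x \<in> NA' \<inter> NB' \<Longrightarrow> Some x \<in> NA \<inter> NB \<and> h x = a x - b x"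
    using split[of "NA \<inter> NB" h] NA NB by (metis Int_mono openin_Int)
  define LA LB where "LA = NA \<inter> NA'" and "LB = NB \<inter> NB'"
  define g where "g p x = (if Some x \<in> LA then gA p x - a x else gB p x - b x)" for p x
  have gB: "g p x = gB p x - b x" if x: "Some x \<in> LB" "Some x \<in> U p" for p x
  proof (cases "Some x \<in> LA")
    case True
    then have "h x = gA p x - gB p x" "h x = a x - b x"
      using x h[of x p] N'(7)[of x] by (auto simp: LA_def LB_def)
    then have "gA p x - a x = gB p x - b x" by algebra
    with True show ?thesis by (simp add: g_def)
  qed (simp add: g_def)
  have oL: "openin P1 LA" "openin P1 LB" using NA NB N' by (auto simp: LA_def LB_def)
  have 1: "hol_P1 (g p) (U p \<inter> LA)" for p
  proof (rule hol_P1_cong)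
    show "openin P1 (U p \<inter> LA)" using openU oL by auto
    show "hol_P1 (\<lambda>x. gA p x - a x) (U p \<inter> LA)"
      by (intro hol_P1_diff hol_P1_subset[OF NA(3)] hol_P1_subset[OF N'(5)]) (auto simp: LA_def)
  qed (simp add: g_def)
  have 2: "hol_P1 (g p) (U p \<inter> LB)" for p
  proof (rule hol_P1_cong)
    show "openin P1 (U p \<inter> LB)" using openU oL by auto
    show "hol_P1 (\<lambda>x. gB p x - b x) (U p \<inter> LB)"
      by (intro hol_P1_diff hol_P1_subset[OF NB(3)] hol_P1_subset[OF N'(6)]) (auto simp: LB_def)
  qed (simp add: gB)
  show ?thesis unfolding splits_near_def
  proof (intro exI conjI allI impI)
    show "openin P1 (LA \<union> LB)" "A \<union> B \<subseteq> LA \<union> LB" using oL NA NB N' by (auto simp: LA_def LB_def)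
    show "hol_P1 (g p) (U p \<inter> (LA \<union> LB))" for p
      unfolding Int_Un_distrib by (intro hol_P1_Un openin_Int openU oL 1 2)
    fix p q x assume x: "Some x \<in> U p \<inter> U q \<inter> (LA \<union> LB)"
    show "f p q x = g p x - g q x"
    proof (cases "Some x \<in> LA")
      case True then show ?thesis using NA(4)[of x p q] x by (auto simp: g_def LA_def)
    next
      case False then show ?thesis using NB(4)[of x p q] x gB by (auto simp: LB_def)
    qed
  qed
qed

end

section \<open>Cauchy integrals over segments and circles\<close>

text \<open>A Cauchy type integral may be differentiated under the integral sign wherever its kernel
  has no pole on the path, so continuity of \<open>h\<close> along the path is enough.\<close>

lemma Cauchy_type_integral_holomorphic:
  assumes cont: "continuous_on (path_image \<gamma>) h" and \<gamma>: "valid_path \<gamma>"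
    and bd: "\<And>t. t \<in> {0..1} \<Longrightarrow> norm (vector_derivative \<gamma> (at t)) \<le> B"
    and int: "\<And>g. continuous_on (path_image \<gamma>) g \<Longrightarrow> g contour_integrable_on \<gamma>"
  shows "(\<lambda>z. contour_integral \<gamma> (\<lambda>w. h w / (w - z))) holomorphic_on - path_image \<gamma>"
proof -
  have "open (- path_image \<gamma>)" using \<gamma> by (simp add: closed_valid_path_image open_Compl)
  then show ?thesis unfolding holomorphic_on_open[OF \<open>open (- path_image \<gamma>)\<close>]
  proof (intro ballI)
    fix z assume z: "z \<in> - path_image \<gamma>"
    have "((\<lambda>u. h u / (u - w) ^ 1) has_contour_integral contour_integral \<gamma> (\<lambda>u. h u / (u - w))) \<gamma>"
      if "w \<in> UNIV - path_image \<gamma>" for w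
    proof -
      have "(\<lambda>u. h u / (u - w)) contour_integrable_on \<gamma>"
        using that by (intro int continuous_intros cont) auto
      then show ?thesis by (simp add: has_contour_integral_integral)
    qed
    from Cauchy_next_derivative(2)[OF cont bd this, of UNIV z] z \<gamma>
    show "\<exists>f'. ((\<lambda>z. contour_integral \<gamma> (\<lambda>w. h w / (w - z))) has_field_derivative f') (at z)"
      by fastforce
  qed
qed

lemma linepath_Cauchy_type_integral_holomorphic:
  assumes "continuous_on (closed_segment a b) h"
  shows "(\<lambda>z. contour_integral (linepath a b) (\<lambda>w. h w / (w - z))) holomorphic_on - closed_segment a b"
  using Cauchy_type_integral_holomorphic[of "linepath a b" h "norm (b - a)"] assms
  by (simp add: contour_integrable_continuous_linepath)

lemma circlepath_Cauchy_type_integral_holomorphic: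
  assumes "continuous_on (sphere a r) h" "0 \<le> r"
  shows "(\<lambda>z. contour_integral (circlepath a r) (\<lambda>w. h w / (w - z))) holomorphic_on - sphere a r"
  using Cauchy_type_integral_holomorphic[of "circlepath a r" h "2 * pi * r"] assms
  by (simp add: contour_integrable_continuous_circlepath vector_derivative_circlepath norm_mult)

text \<open>Cauchy's formula over the boundary, one summand per side. The integral over a side is
  holomorphic off that side, hence on the whole open half plane that is bounded by the line through
  it and contains the interior of the rectangle. These unbounded domains allow a summand to be used
  far away from the rectangle.\<close>

lemma Cauchy_rectpath_split:
  assumes "open M" "h holomorphic_on M" "cbox (Complex a c) (Complex b d) \<subseteq> M" "a < b" "c < d"
  obtains J1 J2 J3 J4 where
    "J1 holomorphic_on {z. Im z > c}" "J2 holomorphic_on {z. Re z < b}"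
    "J3 holomorphic_on {z. Im z < d}" "J4 holomorphic_on {z. Re z > a}"
    "\<And>z. z \<in> box (Complex a c) (Complex b d) \<Longrightarrow> h z = J1 z + J2 z + J3 z + J4 z"
proof -
  define J where "J p q z = contour_integral (linepath p q) (\<lambda>w. h w / (w - z)) / (2 * pi * \<i>)" for p q z
  let ?p1 = "Complex a c" and ?p2 = "Complex b c" and ?p3 = "Complex b d" and ?p4 = "Complex a d"
  let ?K = "cbox ?p1 ?p3"
  have sub: "closed_segment p q \<subseteq> ?K" if "p \<in> ?K" "q \<in> ?K" for p q
    using that by (meson closed_segment_subset convex_box(1))
  have corners: "?p1 \<in> ?K" "?p2 \<in> ?K" "?p3 \<in> ?K" "?p4 \<in> ?K"
    using assms by (auto simp: in_cbox_complex_iff)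
  have conth: "continuous_on (closed_segment p q) h" if "p \<in> ?K" "q \<in> ?K" for p q
    using that assms(2,3) sub
    by (meson continuous_on_subset holomorphic_on_imp_continuous_on)
  have holJ: "J p q holomorphic_on S" if "p \<in> ?K" "q \<in> ?K" "S \<inter> closed_segment p q = {}" for p q S
  proof -
    have "(\<lambda>z. contour_integral (linepath p q) (\<lambda>w. h w / (w - z))) holomorphic_on S"
      by (rule holomorphic_on_subset[OF linepath_Cauchy_type_integral_holomorphic[OF conth]])
        (use that in auto)
    then show ?thesis unfolding J_def by (intro holomorphic_intros) auto
  qed
  have "h z = J ?p1 ?p2 z + J ?p2 ?p3 z + J ?p3 ?p4 z + J ?p4 ?p1 z"
    if z: "z \<in> box ?p1 ?p3" for z
  proof -
    have pim: "path_image (rectpath ?p1 ?p3) = ?K - box ?p1 ?p3"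
      using path_image_rectpath_cbox_minus_box[of ?p1 ?p3] assms by simp
    have "z \<in> interior ?K" using z by (simp add: interior_cbox)
    then have "((\<lambda>w. h w / (w - z)) has_contour_integral
         (2 * pi * \<i> * winding_number (rectpath ?p1 ?p3) z * h z)) (rectpath ?p1 ?p3)"
      using z pim assms by (intro Cauchy_integral_formula_convex_simple[of ?K])
        (auto intro: holomorphic_on_subset)
    then have *: "contour_integral (rectpath ?p1 ?p3) (\<lambda>w. h w / (w - z)) = 2 * pi * \<i> * h z"
      using z assms by (simp add: winding_number_rectpath contour_integral_unique)
    have notin: "z \<notin> closed_segment ?p1 ?p2" "z \<notin> closed_segment ?p2 ?p3"
      "z \<notin> closed_segment ?p3 ?p4" "z \<notin> closed_segment ?p4 ?p1"
      using z by (auto simp: in_box_complex_iff closed_segment_same_Re closed_segment_same_Im)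
    have int: "(\<lambda>w. h w / (w - z)) contour_integrable_on linepath p q"
      if "p \<in> ?K" "q \<in> ?K" "z \<notin> closed_segment p q" for p q
      using that by (intro contour_integrable_continuous_linepath continuous_intros conth) auto
    have "contour_integral (rectpath ?p1 ?p3) (\<lambda>w. h w / (w - z)) =
       2 * pi * \<i> * (J ?p1 ?p2 z + J ?p2 ?p3 z + J ?p3 ?p4 z + J ?p4 ?p1 z)"
      unfolding rectpath_def Let_def J_def using int corners notin
      by (simp add: contour_integral_join contour_integrable_joinI algebra_simps)
    with * show ?thesis by simp
  qed
  moreover have "J ?p1 ?p2 holomorphic_on {z. Im z > c}" "J ?p2 ?p3 holomorphic_on {z. Re z < b}"
    "J ?p3 ?p4 holomorphic_on {z. Im z < d}" "J ?p4 ?p1 holomorphic_on {z. Re z > a}"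
    using assms(4,5) corners
    by (auto intro!: holJ simp: closed_segment_same_Re closed_segment_same_Im)
  ultimately show thesis using that by blast
qed

text \<open>Compactness leaves a margin around the box. Degenerate boxes are included because the
  common edge of two adjacent rectangles has to be thickened.\<close>

lemma cbox_complex_enlarge:
  assumes "open M" "cbox (Complex a c) (Complex b d) \<subseteq> M" "a \<le> b" "c \<le> d"
  obtains e where "e > 0" "cbox (Complex (a - e) (c - e)) (Complex (b + e) (d + e)) \<subseteq> M"
proof -
  obtain e where e: "e > 0" "(\<Union>x\<in>cbox (Complex a c) (Complex b d). ball x e) \<subseteq> M"
    using compact_subset_open_imp_ball_epsilon_subset[OF compact_cbox assms(1,2)] by blast
  have "z \<in> M" if "z \<in> cbox (Complex (a - e/3) (c - e/3)) (Complex (b + e/3) (d + e/3))" for z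
  proof -
    \<comment> \<open>Clamping both coordinates gives the nearest point of the box. Each coordinate
      moves by at most \<open>e/3\<close>, so the distance stays below \<open>e\<close>.\<close>
    define w where "w = Complex (max a (min b (Re z))) (max c (min d (Im z)))"
    have "w \<in> cbox (Complex a c) (Complex b d)"
      using assms by (auto simp: w_def in_cbox_complex_iff)
    moreover have "\<bar>Re (w - z)\<bar> \<le> e/3" "\<bar>Im (w - z)\<bar> \<le> e/3"
      using that assms e(1) by (auto simp: w_def in_cbox_complex_iff max_def min_def abs_if)
    then have "dist w z < e"
      unfolding dist_norm using cmod_le[of "w - z"] e(1) by linarith
    ultimately have "z \<in> (\<Union>x\<in>cbox (Complex a c) (Complex b d). ball x e)" by (auto simp: mem_ball)
    then show "z \<in> M" using e(2) by blast
  qed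
  then show thesis using that[of "e/3"] e(1) by auto
qed

text \<open>The Laurent decomposition on a thin annulus: the Cauchy integral over the outer circle
  is holomorphic inside it, the one over the inner circle is holomorphic outside it and decays. The
  decay is what makes \<open>b\<close> holomorphic at \<open>None\<close>.\<close>

lemma annulus_split:
  assumes "open M" "h holomorphic_on M" "sphere 0 R \<subseteq> M" "R > 0"
  obtains e a b where "0 < e" "e < R" "a holomorphic_on ball 0 (R + e)" 
    "b holomorphic_on {z. norm z > R - e}" "(b \<longlongrightarrow> 0) at_infinity"
    "\<And>z. R - e < norm z \<Longrightarrow> norm z < R + e \<Longrightarrow> z \<in> M \<and> h z = a z - b z"
proof -
  obtain e0 where e0: "e0 > 0" "(\<Union>x\<in>sphere 0 R. ball x e0) \<subseteq> M"
    using compact_subset_open_imp_ball_epsilon_subset[OF compact_sphere assms(1,3)] by blast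
  \<comment> \<open>Halving keeps both circles of radius \<open>R - e\<close> and
    \<open>R + e\<close> inside the open annulus \<open>Ann\<close>; the minimum with
    \<open>R\<close> keeps the inner radius positive.\<close>
  define e where "e = min e0 R / 2"
  have e: "0 < e" "e < R" "e < e0" and e': "e < min e0 R"
    using e0 assms by (auto simp: e_def min_def)
  define Ann where "Ann = {z::complex. norm z > R - min e0 R} \<inter> {z. norm z < R + e0}"
  have AnnM: "Ann \<subseteq> M"
  proof
    fix z assume z: "z \<in> Ann"
    then have nz: "norm z > 0" by (auto simp: Ann_def min_def split: if_splits)
    define w where "w = complex_of_real (R / norm z) * z"
    have "norm w = R" using nz assms by (simp add: w_def norm_mult norm_divide)
    have "w - z = complex_of_real (R / norm z - 1) * z" by (simp add: w_def algebra_simps)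
    then have "norm (w - z) = \<bar>R / norm z - 1\<bar> * norm z" by (metis norm_mult norm_of_real)
    also have "\<dots> = \<bar>(R / norm z - 1) * norm z\<bar>" by (simp add: abs_mult)
    also have "\<dots> = \<bar>R - norm z\<bar>"
      using nz by (intro arg_cong[where f = abs]) (simp add: field_simps)
    also have "\<dots> < e0"
    proof -
      have "norm z > R - min e0 R" "norm z < R + e0" using z by (auto simp: Ann_def)
      then show ?thesis by linarith
    qed
    finally have "z \<in> ball w e0" by (simp add: dist_norm)
    moreover have "w \<in> sphere 0 R" using \<open>norm w = R\<close> by simp
    ultimately show "z \<in> M" using e0(2) by blast
  qed
  have openAnn: "open Ann" unfolding Ann_def
    by (intro open_Int open_Collect_less continuous_intros)
  have sph: "sphere 0 (R - e) \<subseteq> Ann" "sphere 0 (R + e) \<subseteq> Ann"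
    using e assms e0 by (auto simp: Ann_def e_def min_def split: if_splits)
  have contM: "continuous_on S h" if "S \<subseteq> Ann" for S
    using that AnnM assms(2) by (meson continuous_on_subset holomorphic_on_imp_continuous_on)
  define I where "I r z = contour_integral (circlepath 0 r) (\<lambda>w. h w / (w - z))" for r z
  define a b where "a z = I (R + e) z / (2 * pi * \<i>)" and "b z = I (R - e) z / (2 * pi * \<i>)" for z
  have "I r holomorphic_on - sphere 0 r" if "sphere 0 r \<subseteq> Ann" "0 \<le> r" for r
    unfolding I_def using that by (intro circlepath_Cauchy_type_integral_holomorphic contM) auto
  note holI = this
  have "I (R + e) holomorphic_on ball 0 (R + e)" "I (R - e) holomorphic_on {z. norm z > R - e}"
    by (rule holomorphic_on_subset[OF holI]; use e assms sph in auto)+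
  then have hol: "a holomorphic_on ball 0 (R + e)" "b holomorphic_on {z. norm z > R - e}"
    unfolding a_def b_def by (auto intro!: holomorphic_intros)
  have eq: "h z = a z - b z" if z: "R - e < norm z" "norm z < R + e" for z
  proof -
    \<comment> \<open>The difference quotient has a removable singularity at \<open>z\<close>, so
      homotopy invariance equates its integrals over the two circles. Expanding them gives Cauchy's
      formula for the annulus, the kernel contributing on the outer circle only.\<close>
    define F where "F = (\<lambda>w. if w = z then deriv h z else (h w - h z) / (w - z))"
    have "F holomorphic_on Ann" unfolding F_def
      using AnnM assms(2) openAnn by (intro pole_lemma_open) (auto intro: holomorphic_on_subset)
    moreover have "homotopic_loops Ann (circlepath 0 (R - e)) (circlepath 0 (R + e))"
    proof (rule homotopic_loops_linear)
      fix t :: real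
      show "closed_segment (circlepath 0 (R - e) t) (circlepath 0 (R + e) t) \<subseteq> Ann"
      proof
        fix w assume "w \<in> closed_segment (circlepath 0 (R - e) t) (circlepath 0 (R + e) t)"
        then obtain u where u: "0 \<le> u" "u \<le> 1"
          "w = (1 - u) *\<^sub>R circlepath 0 (R - e) t + u *\<^sub>R circlepath 0 (R + e) t"
          by (auto simp: in_segment)
        then have "w = complex_of_real (R + (2 * u - 1) * e) * exp (2 * of_real pi * \<i> * of_real t)"
          by (simp add: circlepath algebra_simps scaleR_conv_of_real)
        then have "norm w = \<bar>R + (2 * u - 1) * e\<bar>"
          by (simp add: norm_mult norm_exp_eq_Re del: of_real_add of_real_mult of_real_diff)
        moreover have "(2 * u - 1) * e \<le> e" "- e \<le> (2 * u - 1) * e"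
          using u e mult_right_mono[of "2 * u - 1" 1 e] mult_right_mono[of "-1" "2 * u - 1" e] by auto
        ultimately have "R - e \<le> norm w" "norm w \<le> R + e" using e by linarith+
        then show "w \<in> Ann" using e e' by (auto simp: Ann_def)
      qed
    qed auto
    ultimately have F: "contour_integral (circlepath 0 (R - e)) F = contour_integral (circlepath 0 (R + e)) F"
      using openAnn by (intro Cauchy_theorem_homotopic_loops) auto
    have FI: "contour_integral (circlepath 0 r) F = I r z - h z * contour_integral (circlepath 0 r) (\<lambda>w. 1 / (w - z))"
      if "sphere 0 r \<subseteq> Ann" "norm z \<noteq> r" "0 < r" for r
    proof -
      have "contour_integral (circlepath 0 r) F = contour_integral (circlepath 0 r) (\<lambda>w. h w / (w - z) - h z * (1 / (w - z)))"
        using that by (intro contour_integral_eq) (auto simp: F_def diff_divide_distrib)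
      also have "\<dots> = I r z - contour_integral (circlepath 0 r) (\<lambda>w. h z * (1 / (w - z)))"
        unfolding I_def using that
        by (intro contour_integral_diff contour_integrable_continuous_circlepath continuous_intros contM) auto
      also have "\<dots> = I r z - h z * contour_integral (circlepath 0 r) (\<lambda>w. 1 / (w - z))"
        using that by (subst contour_integral_lmul)
          (auto intro!: contour_integrable_continuous_circlepath continuous_intros)
      finally show ?thesis .
    qed
    have "contour_integral (circlepath 0 (R + e)) (\<lambda>w. 1 / (w - z)) = 2 * pi * \<i>"
      using Cauchy_integral_circlepath_simple[of "\<lambda>_. 1" 0 "R + e" z] z
      by (auto intro!: contour_integral_unique)
    moreover have "contour_integral (circlepath 0 (R - e)) (\<lambda>w. 1 / (w - z)) = 0"
    proof -
      have "(\<lambda>w. 1 / (w - z)) holomorphic_on ball 0 (norm z)" by (intro holomorphic_intros) auto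
      then show ?thesis using z e
        by (intro contour_integral_unique Cauchy_theorem_disc_simple[of _ 0 "norm z"]) auto
    qed
    ultimately have "I (R - e) z = I (R + e) z - h z * (2 * pi * \<i>)"
      using F FI[of "R - e"] FI[of "R + e"] sph z e assms by simp
    then show ?thesis by (simp add: a_def b_def field_simps)
  qed
  have "(I (R - e) \<longlongrightarrow> 0) at_infinity"
  proof -
    obtain B where B: "\<forall>y\<in>h ` sphere 0 (R - e). norm y \<le> B" "B > 0"
      using compact_continuous_image[OF contM[OF sph(1)] compact_sphere, THEN compact_imp_bounded]
      unfolding bounded_pos by blast
    have "\<forall>\<^sub>F z in at_infinity. norm (I (R - e) z) \<le> B / (norm z - (R - e)) * (2 * pi * (R - e))"
    proof -
      have "norm (I (R - e) z) \<le> B / (norm z - (R - e)) * (2 * pi * (R - e))" if "norm z > R" for z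
        unfolding I_def
      proof (rule has_contour_integral_bound_circlepath[OF has_contour_integral_integral])
        show "(\<lambda>w. h w / (w - z)) contour_integrable_on circlepath 0 (R - e)"
          using that e by (intro contour_integrable_continuous_circlepath continuous_intros contM) (use sph in auto)
        show "0 \<le> B / (norm z - (R - e))" using B that e by auto
        fix w :: complex assume w: "norm (w - 0) = R - e"
        then have "norm (w - z) \<ge> norm z - (R - e)" using norm_triangle_ineq2[of z w] by (simp add: norm_minus_commute)
        then show "norm (h w / (w - z)) \<le> B / (norm z - (R - e))"
          using B w that e by (auto simp: norm_divide intro!: frac_le)
      qed (use e in auto)
      then show ?thesis unfolding eventually_at_infinity by (meson gt_ex less_le_trans)
    qed
    moreover have "((\<lambda>z::complex. B / (norm z - (R - e)) * (2 * pi * (R - e))) \<longlongrightarrow> 0) at_infinity"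
    proof -
      have "filterlim (\<lambda>z::complex. - (R - e) + norm z) at_top at_infinity"
        by (rule filterlim_tendsto_add_at_top[OF tendsto_const filterlim_norm_at_top])
      then have "filterlim (\<lambda>z::complex. norm z - (R - e)) at_top at_infinity"
        by (simp add: algebra_simps)
      then have "((\<lambda>z::complex. B / (norm z - (R - e))) \<longlongrightarrow> 0) at_infinity"
        by (intro real_tendsto_divide_at_top[OF tendsto_const])
      then show ?thesis by (rule tendsto_mult_left_zero)
    qed
    ultimately show ?thesis by (rule Lim_null_comparison)
  qed
  then have "(b \<longlongrightarrow> 0) at_infinity"
    unfolding b_def by (rule tendsto_divide_zero)
  moreover have "z \<in> M" if "R - e < norm z" "norm z < R + e" for z
    using that AnnM e e0 by (auto simp: Ann_def e_def min_def split: if_splits)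
  ultimately show thesis using e hol eq by (intro that[of e a b]) auto
qed

lemma hol_P1_image_Some [simp]: "hol_P1 f (Some ` S) \<longleftrightarrow> f holomorphic_on S"
proof -
  have "{x. Some x \<in> Some ` S} = S" by auto
  then show ?thesis by (auto simp: hol_P1_def)
qed

section \<open>Bisection of rectangles and passage to the sphere\<close>

context O_cocycle
begin

text \<open>The function to be split lives on a slightly enlarged rectangle around the common edge.
  The left side of that rectangle contributes \<open>J4\<close>, which extends to the right; the
  other three sides contribute functions that extend to the left. Cutting both domains to the same
  horizontal strip keeps their overlap inside the rectangle.\<close>

lemma splits_near_join_Re:
  assumes "splits_near (Some ` cbox (Complex a c) (Complex m d))"
    "splits_near (Some ` cbox (Complex m c) (Complex b d))" "a \<le> m" "m \<le> b" "c \<le> d"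
  shows "splits_near (Some ` cbox (Complex a c) (Complex b d))"
proof -
  have "splits_near (Some ` cbox (Complex a c) (Complex m d) \<union> Some ` cbox (Complex m c) (Complex b d))"
  proof (rule splits_near_glue[OF assms(1,2)])
    fix M h assume M: "openin P1 M" "hol_P1 h M"
      "Some ` cbox (Complex a c) (Complex m d) \<inter> Some ` cbox (Complex m c) (Complex b d) \<subseteq> M"
    define M' where "M' = {x. Some x \<in> M}"
    have M': "open M'" "h holomorphic_on M'"
      using M by (auto simp: M'_def openin_P1_iff hol_P1_def)
    have "cbox (Complex m c) (Complex m d) \<subseteq> M'"
      using M(3) assms by (force simp: M'_def in_cbox_complex_iff image_iff)
    from cbox_complex_enlarge[OF M'(1) this] assms(5) obtain e where
      e: "e > 0" "cbox (Complex (m - e) (c - e)) (Complex (m + e) (d + e)) \<subseteq> M'" by auto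
    obtain J1 J2 J3 J4 where J: "J1 holomorphic_on {z. Im z > c - e}" "J2 holomorphic_on {z. Re z < m + e}"
      "J3 holomorphic_on {z. Im z < d + e}" "J4 holomorphic_on {z. Re z > m - e}"
      "\<And>z. z \<in> box (Complex (m - e) (c - e)) (Complex (m + e) (d + e)) \<Longrightarrow> h z = J1 z + J2 z + J3 z + J4 z"
      by (rule Cauchy_rectpath_split[OF M' e(2)]) (use e(1) assms(5) in auto)
    define SA SB where "SA = {z. c - e < Im z} \<inter> {z. Im z < d + e} \<inter> {z. Re z < m + e}"
      and "SB = {z. c - e < Im z} \<inter> {z. Im z < d + e} \<inter> {z. Re z > m - e}"
    have "open SA" "open SB" unfolding SA_def SB_def
      by (intro open_Int open_Collect_less continuous_intros)+
    moreover have "(\<lambda>z. J1 z + J2 z + J3 z) holomorphic_on SA"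
      by (intro holomorphic_intros; rule holomorphic_on_subset[OF J(1)] holomorphic_on_subset[OF J(2)]
          holomorphic_on_subset[OF J(3)]) (auto simp: SA_def)
    moreover have "(\<lambda>z. - J4 z) holomorphic_on SB"
      by (intro holomorphic_intros holomorphic_on_subset[OF J(4)]) (auto simp: SB_def)
    moreover have "z \<in> M' \<and> h z = (J1 z + J2 z + J3 z) - (- J4 z)" if "z \<in> SA \<inter> SB" for z
    proof -
      have "z \<in> box (Complex (m - e) (c - e)) (Complex (m + e) (d + e))"
        using that by (auto simp: SA_def SB_def in_box_complex_iff)
      then show ?thesis using J(5) e(2) box_subset_cbox by fastforce
    qed
    moreover have "cbox (Complex a c) (Complex m d) \<subseteq> SA" "cbox (Complex m c) (Complex b d) \<subseteq> SB"
      using e(1) by (auto simp: SA_def SB_def in_cbox_complex_iff)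
    ultimately show "\<exists>NA NB a' b'. openin P1 NA \<and> openin P1 NB \<and>
         Some ` cbox (Complex a c) (Complex m d) \<subseteq> NA \<and> Some ` cbox (Complex m c) (Complex b d) \<subseteq> NB \<and>
         hol_P1 a' NA \<and> hol_P1 b' NB \<and> (\<forall>x. Some x \<in> NA \<inter> NB \<longrightarrow> Some x \<in> M \<and> h x = a' x - b' x)"
      by (intro exI[of _ "Some ` SA"] exI[of _ "Some ` SB"] exI[of _ "\<lambda>z. J1 z + J2 z + J3 z"]
          exI[of _ "\<lambda>z. - J4 z"]) (auto simp: M'_def)
  qed
  moreover have "cbox (Complex a c) (Complex m d) \<union> cbox (Complex m c) (Complex b d) = cbox (Complex a c) (Complex b d)"
    using assms by (auto simp: in_cbox_complex_iff)
  ultimately show ?thesis by (metis image_Un)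
qed

text \<open>The same with the axes exchanged: the bottom side gives the part that extends upwards,
  the other three sides give the part that extends downwards.\<close>

lemma splits_near_join_Im:
  assumes "splits_near (Some ` cbox (Complex a c) (Complex b m))"
    "splits_near (Some ` cbox (Complex a m) (Complex b d))" "c \<le> m" "m \<le> d" "a \<le> b"
  shows "splits_near (Some ` cbox (Complex a c) (Complex b d))"
proof -
  have "splits_near (Some ` cbox (Complex a c) (Complex b m) \<union> Some ` cbox (Complex a m) (Complex b d))"
  proof (rule splits_near_glue[OF assms(1,2)])
    fix M h assume M: "openin P1 M" "hol_P1 h M"
      "Some ` cbox (Complex a c) (Complex b m) \<inter> Some ` cbox (Complex a m) (Complex b d) \<subseteq> M"
    define M' where "M' = {x. Some x \<in> M}"
    have M': "open M'" "h holomorphic_on M'"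
      using M by (auto simp: M'_def openin_P1_iff hol_P1_def)
    have "cbox (Complex a m) (Complex b m) \<subseteq> M'"
      using M(3) assms by (force simp: M'_def in_cbox_complex_iff image_iff)
    from cbox_complex_enlarge[OF M'(1) this] assms(5) obtain e where
      e: "e > 0" "cbox (Complex (a - e) (m - e)) (Complex (b + e) (m + e)) \<subseteq> M'" by auto
    obtain J1 J2 J3 J4 where J: "J1 holomorphic_on {z. Im z > m - e}" "J2 holomorphic_on {z. Re z < b + e}"
      "J3 holomorphic_on {z. Im z < m + e}" "J4 holomorphic_on {z. Re z > a - e}"
      "\<And>z. z \<in> box (Complex (a - e) (m - e)) (Complex (b + e) (m + e)) \<Longrightarrow> h z = J1 z + J2 z + J3 z + J4 z"
      by (rule Cauchy_rectpath_split[OF M' e(2)]) (use e(1) assms(5) in auto)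
    define SA SB where "SA = {z. a - e < Re z} \<inter> {z. Re z < b + e} \<inter> {z. Im z < m + e}"
      and "SB = {z. a - e < Re z} \<inter> {z. Re z < b + e} \<inter> {z. Im z > m - e}"
    have "open SA" "open SB" unfolding SA_def SB_def
      by (intro open_Int open_Collect_less continuous_intros)+
    moreover have "(\<lambda>z. J2 z + J3 z + J4 z) holomorphic_on SA"
      by (intro holomorphic_intros; rule holomorphic_on_subset[OF J(2)] holomorphic_on_subset[OF J(3)]
          holomorphic_on_subset[OF J(4)]) (auto simp: SA_def)
    moreover have "(\<lambda>z. - J1 z) holomorphic_on SB"
      by (intro holomorphic_intros holomorphic_on_subset[OF J(1)]) (auto simp: SB_def)
    moreover have "z \<in> M' \<and> h z = (J2 z + J3 z + J4 z) - (- J1 z)" if "z \<in> SA \<inter> SB" for z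
    proof -
      have "z \<in> box (Complex (a - e) (m - e)) (Complex (b + e) (m + e))"
        using that by (auto simp: SA_def SB_def in_box_complex_iff)
      then show ?thesis using J(5) e(2) box_subset_cbox by fastforce
    qed
    moreover have "cbox (Complex a c) (Complex b m) \<subseteq> SA" "cbox (Complex a m) (Complex b d) \<subseteq> SB"
      using e(1) by (auto simp: SA_def SB_def in_cbox_complex_iff)
    ultimately show "\<exists>NA NB a' b'. openin P1 NA \<and> openin P1 NB \<and>
         Some ` cbox (Complex a c) (Complex b m) \<subseteq> NA \<and> Some ` cbox (Complex a m) (Complex b d) \<subseteq> NB \<and>
         hol_P1 a' NA \<and> hol_P1 b' NB \<and> (\<forall>x. Some x \<in> NA \<inter> NB \<longrightarrow> Some x \<in> M \<and> h x = a' x - b' x)"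
      by (intro exI[of _ "Some ` SA"] exI[of _ "Some ` SB"] exI[of _ "\<lambda>z. J2 z + J3 z + J4 z"]
          exI[of _ "\<lambda>z. - J1 z"]) (auto simp: M'_def)
  qed
  moreover have "cbox (Complex a c) (Complex b m) \<union> cbox (Complex a m) (Complex b d) = cbox (Complex a c) (Complex b d)"
    using assms by (auto simp: in_cbox_complex_iff)
  ultimately show ?thesis by (metis image_Un)
qed

lemma splits_near_small:
  obtains e where "e > 0" "splits_near (Some ` ball x e)"
proof -
  have "open {y. Some y \<in> U (Some x)}" using openU[of "Some x"] by (simp add: openin_P1_iff)
  moreover have "x \<in> {y. Some y \<in> U (Some x)}" using memU by simp
  ultimately obtain e where "e > 0" "ball x e \<subseteq> {y. Some y \<in> U (Some x)}"
    unfolding open_contains_ball by meson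
  then show thesis using that[of e] splits_near_local[of "Some ` ball x e" "Some x"] by auto
qed

text \<open>Bisection in two rounds: along the real axis it produces a thin horizontal strip near
  which the cocycle splits, along the imaginary axis it stacks such strips. Small discs start the
  induction.\<close>

lemma splits_near_cbox:
  assumes "a \<le> b" "c \<le> d"
  shows "splits_near (Some ` cbox (Complex a c) (Complex b d))"
proof -
  \<comment> \<open>The height is existentially quantified because joining two pieces forces the
    smaller of their heights.\<close>
  have strip: "\<exists>e>0. splits_near (Some ` cbox (Complex a (y - e)) (Complex b (y + e)))" for y
    using \<open>a \<le> b\<close>
  proof (induct rule: Bolzano)
    case (trans a' m b')
    from trans(1) obtain e1 where e1: "e1 > 0" "splits_near (Some ` cbox (Complex a' (y - e1)) (Complex m (y + e1)))" by auto
    from trans(2) obtain e2 where e2: "e2 > 0" "splits_near (Some ` cbox (Complex m (y - e2)) (Complex b' (y + e2)))" by auto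
    note e = e1 e2
    define e where "e = min e1 e2"
    have "splits_near (Some ` cbox (Complex a' (y - e)) (Complex m (y + e)))"
      by (rule splits_near_subset[OF e(2) image_mono]) (auto simp: e_def in_cbox_complex_iff)
    moreover have "splits_near (Some ` cbox (Complex m (y - e)) (Complex b' (y + e)))"
      by (rule splits_near_subset[OF e(4) image_mono]) (auto simp: e_def in_cbox_complex_iff)
    ultimately have "splits_near (Some ` cbox (Complex a' (y - e)) (Complex b' (y + e)))"
      by (rule splits_near_join_Re[OF _ _ trans(3,4)]) (use e1(1) e2(1) in \<open>simp add: e_def min_def\<close>)
    moreover have "e > 0" using e by (simp add: e_def)
    ultimately show ?case by blast
  next
    case (local x)
    obtain e where e: "e > 0" "splits_near (Some ` ball (Complex x y) e)"
      by (rule splits_near_small)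
    show ?case
    proof (rule exI[of _ "e / 2"], intro conjI allI impI)
      fix a' b' assume ab: "a' \<le> x \<and> x \<le> b' \<and> b' - a' < e / 2"
      have "cbox (Complex a' (y - e/2)) (Complex b' (y + e/2)) \<subseteq> ball (Complex x y) e"
      proof
        fix z assume "z \<in> cbox (Complex a' (y - e/2)) (Complex b' (y + e/2))"
        then have "\<bar>Re (z - Complex x y)\<bar> < e / 2" "\<bar>Im (z - Complex x y)\<bar> \<le> e / 2"
          using ab by (auto simp: in_cbox_complex_iff abs_if)
        then show "z \<in> ball (Complex x y) e"
          using cmod_le[of "z - Complex x y"] by (simp add: dist_norm norm_minus_commute)
      qed
      then show "\<exists>e>0. splits_near (Some ` cbox (Complex a' (y - e)) (Complex b' (y + e)))"
        using e(1) by (intro exI[of _ "e/2"] conjI splits_near_subset[OF e(2) image_mono]) auto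
    qed (use e in auto)
  qed
  show ?thesis
    using \<open>c \<le> d\<close>
  proof (induct rule: Bolzano)
    case (trans c m d)
    show ?case by (rule splits_near_join_Im[OF trans assms(1)])
  next
    case (local y)
    obtain e where e: "e > 0" "splits_near (Some ` cbox (Complex a (y - e)) (Complex b (y + e)))"
      using strip[of y] by auto
    show ?case
    proof (intro exI[of _ e] conjI allI impI)
      fix c' d' assume "c' \<le> y \<and> y \<le> d' \<and> d' - c' < e"
      then have "cbox (Complex a c') (Complex b d') \<subseteq> cbox (Complex a (y - e)) (Complex b (y + e))"
        by (auto simp: in_cbox_complex_iff)
      then show "splits_near (Some ` cbox (Complex a c') (Complex b d'))"
        by (rule splits_near_subset[OF e(2) image_mono])
    qed (rule e(1))
  qed
qed

text \<open>The outside of a large disc lies in the member of \<open>None\<close>, where the cocycle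
  splits trivially; the disc itself lies in a rectangle. The annulus decomposition joins the two
  along the circle.\<close>

theorem H1_O_vanishes:
  obtains g where "\<And>p. hol_P1 (g p) (U p)"
    "\<And>p q x. Some x \<in> U p \<inter> U q \<Longrightarrow> f p q x = g p x - g q x"
proof -
  obtain R0 where R0: "\<forall>x. norm x \<ge> R0 \<longrightarrow> Some x \<in> U None"
    using openU[of None] memU[of None] by (auto simp: openin_P1_iff eventually_at_infinity)
  define R where "R = max R0 1"
  define A B where "A = Some ` cball (0::complex) R" and "B = insert None (Some ` {x::complex. norm x \<ge> R})"
  have "R > 0" by (simp add: R_def)
  have "cball 0 R \<subseteq> cbox (Complex (-R) (-R)) (Complex R R)"
  proof
    fix z :: complex assume "z \<in> cball 0 R"
    then have "\<bar>Re z\<bar> \<le> R" "\<bar>Im z\<bar> \<le> R"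
      using abs_Re_le_cmod[of z] abs_Im_le_cmod[of z] by auto
    then show "z \<in> cbox (Complex (-R) (-R)) (Complex R R)" by (auto simp: in_cbox_complex_iff)
  qed
  moreover have "splits_near (Some ` cbox (Complex (-R) (-R)) (Complex R R))"
    by (rule splits_near_cbox) (auto simp: R_def)
  ultimately have A: "splits_near A" unfolding A_def by (blast intro: splits_near_subset)
  have B: "splits_near B"
    by (rule splits_near_local[of _ None]) (use R0 memU in \<open>auto simp: B_def R_def\<close>)
  have "splits_near (A \<union> B)"
  proof (rule splits_near_glue[OF A B])
    fix M h assume M: "openin P1 M" "hol_P1 h M" "A \<inter> B \<subseteq> M"
    define M' where "M' = {x. Some x \<in> M}"
    have M': "open M'" "h holomorphic_on M'"
      using M by (auto simp: M'_def openin_P1_iff hol_P1_def)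
    have "sphere 0 R \<subseteq> M'"
      using M(3) by (force simp: M'_def A_def B_def)
    then obtain e a b where e: "0 < e" "e < R"
      "a holomorphic_on ball 0 (R + e)" "b holomorphic_on {z. norm z > R - e}" "(b \<longlongrightarrow> 0) at_infinity"
      "\<And>z. R - e < norm z \<Longrightarrow> norm z < R + e \<Longrightarrow> z \<in> M' \<and> h z = a z - b z"
      using annulus_split[OF M' _ \<open>R > 0\<close>] by blast
    define NB where "NB = insert None (Some ` {z::complex. norm z > R - e})"
    have NB: "{x. Some x \<in> NB} = {z. norm z > R - e}" by (auto simp: NB_def)
    have "open {z::complex. norm z > R - e}" by (intro open_Collect_less continuous_intros)
    moreover have "\<forall>\<^sub>F x in at_infinity. Some (x::complex) \<in> NB"
      unfolding eventually_at_infinity using e by (intro exI[of _ R]) (auto simp: NB_def)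
    ultimately have "openin P1 NB" unfolding openin_P1_iff NB by simp
    moreover have "hol_P1 b NB" using e(4,5) unfolding hol_P1_def NB by blast
    ultimately show "\<exists>NA NB a b. openin P1 NA \<and> openin P1 NB \<and> A \<subseteq> NA \<and> B \<subseteq> NB \<and>
         hol_P1 a NA \<and> hol_P1 b NB \<and> (\<forall>x. Some x \<in> NA \<inter> NB \<longrightarrow> Some x \<in> M \<and> h x = a x - b x)"
      using e by (intro exI[of _ "Some ` ball 0 (R + e)"] exI[of _ NB] exI[of _ a] exI[of _ b])
        (auto simp: A_def B_def NB_def M'_def)
  qed
  moreover have "A \<union> B = UNIV"
  proof (intro set_eqI)
    fix p show "p \<in> A \<union> B \<longleftrightarrow> p \<in> UNIV" by (cases p) (force simp: A_def B_def image_iff)+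
  qed
  ultimately obtain N g where "UNIV \<subseteq> N" "\<And>p. hol_P1 (g p) (U p \<inter> N)"
     "\<And>p q x. Some x \<in> U p \<inter> U q \<inter> N \<Longrightarrow> f p q x = g p x - g q x"
    unfolding splits_near_def by metis
  then show thesis using that[of g] by (simp add: top.extremum_unique)
qed

end

section \<open>The sheaf of endomorphisms\<close>

(* fps_nth has the same infix symbol as vec_nth, which makes parsing matrix entries exponential. *)
no_notation fps_nth (infixl \<open>$\<close> 75)

lemma mat2_nth [simp]:
  "mat2 a b c d $ 1 $ 1 = a" "mat2 a b c d $ 1 $ 2 = b"
  "mat2 a b c d $ 2 $ 1 = c" "mat2 a b c d $ 2 $ 2 = d"
  by (simp_all add: mat2_def)

lemma mat2_eq_iff:
  fixes A B :: "complex^2^2"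
  shows "A = B \<longleftrightarrow> A$1$1 = B$1$1 \<and> A$1$2 = B$1$2 \<and> A$2$1 = B$2$1 \<and> A$2$2 = B$2$2"
  by (auto simp: vec_eq_iff forall_2)

lemma matrix_mult_2_nth: "((A :: complex^2^2) ** B) $ i $ j = A$i$1 * B$1$j + A$i$2 * B$2$j"
  by (simp add: matrix_matrix_mult_def sum_2)

lemma mscale_nth [simp]: "mscale z A $ i $ j = z * A $ i $ j"
  using exhaust_2[of i] by (auto simp: mscale_def matrix_mult_2_nth mat_def)

lemma trace_2: "trace (A :: complex^2^2) = A$1$1 + A$2$2"
  by (simp add: trace_def sum_2)

lemma matrix_inv_eqI:
  fixes A B :: "complex^2^2"
  assumes "A ** B = mat 1" "B ** A = mat 1"
  shows "matrix_inv A = B"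
proof -
  have "A ** matrix_inv A = mat 1 \<and> matrix_inv A ** A = mat 1"
    unfolding matrix_inv_def by (rule someI[of _ B]) (use assms in auto)
  then have "matrix_inv A ** (A ** B) = B" by (simp add: matrix_mul_assoc)
  then show ?thesis by (simp add: assms)
qed

section \<open>The passage to the chart at infinity\<close>

lemma matrix_inv_to_inf: "u \<noteq> 0 \<Longrightarrow> matrix_inv (to_inf u) = mat2 u 0 0 (u\<^sup>2)"
  by (rule matrix_inv_eqI) (auto simp: mat2_eq_iff matrix_mult_2_nth to_inf_def mat_def)

lemma conj_to_inf:
  assumes "u \<noteq> 0"
  shows "to_inf u ** A ** matrix_inv (to_inf u) = mat2 (A$1$1) (u * A$1$2) (A$2$1 / u) (A$2$2)"
  unfolding matrix_inv_to_inf[OF assms] using assms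
  by (simp add: mat2_eq_iff matrix_mult_2_nth to_inf_def power2_eq_square)

lemma endo_inf_0 [simp]: "endo_inf A 0 = A None"
  by (simp add: endo_inf_def)

lemma endo_inf_eq:
  "u \<noteq> 0 \<Longrightarrow> endo_inf A u = (let B = A (Some (inverse u)) in mat2 (B$1$1) (u * B$1$2) (B$2$1 / u) (B$2$2))"
  by (simp add: endo_inf_def conj_to_inf Let_def)

lemma open_chart_inf:
  assumes "openin P1 U" shows "open {u. chart_inf u \<in> U}"
proof -
  define V where "V = {x. Some x \<in> U}"
  have V: "open V" using assms by (simp add: V_def openin_P1_iff)
  have 1: "open (inverse -` V \<inter> - {0})"
    using continuous_open_preimage[of "- {0}" inverse V] V
    by (simp add: Int_commute continuous_on_inverse open_Compl)
  show ?thesis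
  proof (cases "None \<in> U")
    case False
    then have "{u. chart_inf u \<in> U} = inverse -` V \<inter> - {0}"
      by (auto simp: chart_inf_def V_def)
    with 1 show ?thesis by simp
  next
    case True
    then have "\<forall>\<^sub>F x in at_infinity. x \<in> V" using assms by (simp add: openin_P1_iff V_def)
    then have "\<forall>\<^sub>F u in at 0. inverse u \<in> V"
      by (simp add: at_to_infinity eventually_filtermap)
    then obtain e where e: "e > 0" "\<forall>u. u \<noteq> 0 \<and> dist u 0 < e \<longrightarrow> inverse u \<in> V"
      by (auto simp: eventually_at)
    have "{u. chart_inf u \<in> U} = (inverse -` V \<inter> - {0}) \<union> ball 0 e"
      using e True by (auto simp: chart_inf_def V_def split: if_splits)
    then show ?thesis using open_Un[OF 1 open_ball] by (simp only:)
  qed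
qed

text \<open>Riemann's theorem on removable singularities: away from \<open>u = 0\<close>,
  \<open>F\<close> is a composition with inversion, so only continuity at that point is in question.
  The point \<open>x = 0\<close> is left out because no \<open>u\<close> of the chart corresponds to
  it, which admits functions such as \<open>inverse x * f x\<close>.\<close>

lemma chart_inf_holomorphic_iff:
  assumes U: "openin P1 U" and G: "G holomorphic_on {x. Some x \<in> U \<and> x \<noteq> 0}"
    and F: "\<And>u. u \<noteq> 0 \<Longrightarrow> F u = G (inverse u)"
  shows "F holomorphic_on {u. chart_inf u \<in> U} \<longleftrightarrow> (None \<in> U \<longrightarrow> (G \<longlongrightarrow> F 0) at_infinity)"
proof -
  let ?S = "{u. chart_inf u \<in> U}"
  have S: "open ?S" by (rule open_chart_inf[OF U])
  have lim: "(G \<longlongrightarrow> F 0) at_infinity \<longleftrightarrow> (F \<longlongrightarrow> F 0) (at 0)"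
  proof -
    have "(G \<longlongrightarrow> F 0) at_infinity \<longleftrightarrow> ((\<lambda>u. G (inverse u)) \<longlongrightarrow> F 0) (at 0)"
      by (simp add: at_to_infinity filterlim_filtermap)
    also have "\<dots> \<longleftrightarrow> (F \<longlongrightarrow> F 0) (at 0)"
      by (rule filterlim_cong) (auto simp: eventually_at_filter F)
    finally show ?thesis .
  qed
  have "(G \<circ> inverse) holomorphic_on ?S - {0}"
    using G by (rule holomorphic_on_compose_gen[rotated])
      (auto intro!: holomorphic_intros simp: chart_inf_def)
  then have hol: "F holomorphic_on ?S - {0}"
    by (rule holomorphic_transform) (simp add: F)
  show ?thesis
  proof (cases "None \<in> U")
    case False
    then have "?S - {0} = ?S" by (auto simp: chart_inf_def)
    with hol False show ?thesis by simp
  next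
    case True
    then have 0: "0 \<in> ?S" by (simp add: chart_inf_def)
    show ?thesis
    proof
      assume "F holomorphic_on ?S"
      then have "isCont F 0"
        using 0 S holomorphic_on_imp_continuous_on continuous_on_eq_continuous_at by blast
      then show "None \<in> U \<longrightarrow> (G \<longlongrightarrow> F 0) at_infinity" using lim by (simp add: isCont_def)
    next
      assume "None \<in> U \<longrightarrow> (G \<longlongrightarrow> F 0) at_infinity"
      with True lim have "isCont F 0" by (simp add: isCont_def)
      moreover have "continuous_on (?S - {0}) F" using hol by (rule holomorphic_on_imp_continuous_on)
      then have "\<forall>u\<in>?S - {0}. isCont F u" using S by (simp add: continuous_on_eq_continuous_at open_delete)
      ultimately have "continuous_on ?S F" using S by (auto simp: continuous_on_eq_continuous_at)
      then show "F holomorphic_on ?S"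
        using hol S no_isolated_singularity[of ?S F "{0}"] by simp
    qed
  qed
qed

text \<open>The limit is the derivative at \<open>u = 0\<close> of \<open>f\<close> in the chart
  \<open>u = 1/x\<close>, where \<open>f\<close> has a zero.\<close>

lemma tendsto_at_infinity_mult_ident:
  assumes "openin P1 U" "None \<in> U" "f holomorphic_on {x. Some x \<in> U}" "(f \<longlongrightarrow> 0) at_infinity"
  shows "\<exists>L. ((\<lambda>x. x * f x) \<longlongrightarrow> L) at_infinity"
proof -
  define F where "F = (\<lambda>u. if u = 0 then 0 else f (inverse u))"
  have "F holomorphic_on {u. chart_inf u \<in> U}"
    using assms by (subst chart_inf_holomorphic_iff[where G = f]) (auto simp: F_def intro: holomorphic_on_subset)
  moreover have "0 \<in> {u. chart_inf u \<in> U}" using assms by (simp add: chart_inf_def)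
  ultimately have "(F has_field_derivative deriv F 0) (at 0)"
    using open_chart_inf[OF assms(1)] by (simp add: holomorphic_derivI)
  then have "((\<lambda>u. (F u - F 0) / (u - 0)) \<longlongrightarrow> deriv F 0) (at 0)"
    by (simp add: has_field_derivative_iff)
  then have "((\<lambda>u. inverse u * f (inverse u)) \<longlongrightarrow> deriv F 0) (at 0)"
    by (rule Lim_transform_eventually) (auto simp: eventually_at_filter F_def divide_inverse)
  then show ?thesis by (auto simp: at_to_infinity filterlim_filtermap)
qed

text \<open>The quadratic expression is the determinant of the vectors \<open>A *v v\<close> and
  \<open>v\<close> for \<open>v = vector [z, 1]\<close>.\<close>

lemma preserves_line_slope:
  "preserves_line A {v. v$1 = z * v$2} \<longleftrightarrow> A$1$2 + (A$1$1 - A$2$2) * z - A$2$1 * z\<^sup>2 = 0"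
proof
  assume *: "preserves_line A {v. v$1 = z * v$2}"
  have "A *v vector [z, 1] \<in> {v. v$1 = z * v$2}"
    using * unfolding preserves_line_def by (rule bspec) simp
  then show "A$1$2 + (A$1$1 - A$2$2) * z - A$2$1 * z\<^sup>2 = 0"
    by (simp add: matrix_vector_mult_def sum_2 algebra_simps power2_eq_square)
next
  assume *: "A$1$2 + (A$1$1 - A$2$2) * z - A$2$1 * z\<^sup>2 = 0"
  show "preserves_line A {v. v$1 = z * v$2}" unfolding preserves_line_def
  proof
    fix v :: "complex^2" assume "v \<in> {v. v$1 = z * v$2}"
    then have "v$1 = z * v$2" by simp
    moreover have "A$1$1 * z + A$1$2 = z * (A$2$1 * z + A$2$2)"
      using * by (simp add: algebra_simps power2_eq_square)
    then have "(A$1$1 * z + A$1$2) * v$2 = z * (A$2$1 * z + A$2$2) * v$2" by simp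
    ultimately show "A *v v \<in> {v. v$1 = z * v$2}"
      by (simp add: matrix_vector_mult_def sum_2 algebra_simps)
  qed
qed

section \<open>Sections that preserve the lines\<close>

locale parabolic_data =
  fixes r s t R S T :: complex
  assumes points: "r \<notin> {0, 1}" "s \<notin> {0, 1}" "t \<notin> {0, 1}" "r \<noteq> s" "r \<noteq> t" "s \<noteq> t"
begin

text \<open>Each of the six lines is spanned by a vector with second coordinate 1, so the first
  coordinate parametrises them all. The default 0 supplies the lines over 0 and infinity.\<close>

definition slope :: "complex option \<Rightarrow> complex" where
  "slope w = (if w = Some 1 then 1 else if w = Some r then R else if w = Some s then S
     else if w = Some t then T else 0)"

abbreviation "line \<equiv> par_line r s t R S T"
abbreviation "W \<equiv> marked r s t"
abbreviation "F \<equiv> sl_sheaf W line"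

lemma slope_simps [simp]: "slope (Some 0) = 0" "slope (Some 1) = 1" "slope (Some r) = R"
  "slope (Some s) = S" "slope (Some t) = T" "slope None = 0"
  using points by (auto simp: slope_def)

lemma line_eq: "line w = {v. v$1 = slope w * v$2}"
proof -
  have span: "vec.span {vector [z, 1]} = {v :: complex^2. v$1 = z * v$2}" for z
    unfolding vec.span_singleton
  proof (intro set_eqI iffI)
    fix v :: "complex^2" assume "v \<in> {v. v$1 = z * v$2}"
    then have "v = v$2 *s vector [z, 1]" by (simp add: vec_eq_iff forall_2)
    then show "v \<in> range (\<lambda>k. k *s vector [z, 1])" by blast
  qed auto
  then show ?thesis by (auto simp: par_line_def slope_def)
qed

text \<open>With vanishing trace, three entries determine the matrix. Conjugation by
  \<open>to_inf\<close> multiplies the upper right entry by \<open>u\<close> and divides the lower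
  left one by \<open>u\<close>, which produces the three limits. The line over infinity has slope 0
  and is covered by the condition on \<open>W \<inter> U\<close>.\<close>

lemma F_iff:
  assumes "openin P1 U"
  shows "A \<in> F U \<longleftrightarrow>
     (\<forall>i j. (\<lambda>x. A (Some x) $ i $ j) holomorphic_on {x. Some x \<in> U}) \<and>
     (\<forall>p\<in>U. A p $ 2 $ 2 = - A p $ 1 $ 1) \<and>
     (\<forall>w\<in>W \<inter> U. A w $ 1 $ 2 + 2 * slope w * A w $ 1 $ 1 - (slope w)\<^sup>2 * A w $ 2 $ 1 = 0) \<and>
     (None \<in> U \<longrightarrow> ((\<lambda>x. A (Some x) $ 1 $ 1) \<longlongrightarrow> A None $ 1 $ 1) at_infinity \<and>
        ((\<lambda>x. inverse x * A (Some x) $ 1 $ 2) \<longlongrightarrow> A None $ 1 $ 2) at_infinity \<and>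
        ((\<lambda>x. x * A (Some x) $ 2 $ 1) \<longlongrightarrow> A None $ 2 $ 1) at_infinity)"
proof -
  let ?I = "{u. chart_inf u \<in> U}"
  have forall_22: "(\<forall>i j. P i j) \<longleftrightarrow> P 1 1 \<and> P 1 2 \<and> P 2 1 \<and> P 2 2" for P :: "2 \<Rightarrow> 2 \<Rightarrow> bool"
    by (auto simp: forall_2)
  have tr: "trace (A p) = 0 \<longleftrightarrow> A p $ 2 $ 2 = - A p $ 1 $ 1" for p
    by (auto simp: trace_2 add_eq_0_iff)
  have pl: "preserves_line (A w) (line w) \<longleftrightarrow>
      A w $ 1 $ 2 + 2 * slope w * A w $ 1 $ 1 - (slope w)\<^sup>2 * A w $ 2 $ 1 = 0"
    if "trace (A w) = 0" for w
    using that[unfolded tr] unfolding line_eq preserves_line_slope by (simp add: algebra_simps)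
  have inf: "(\<lambda>u. endo_inf A u $ 1 $ 1) holomorphic_on ?I \<longleftrightarrow>
      (None \<in> U \<longrightarrow> ((\<lambda>x. A (Some x) $ 1 $ 1) \<longlongrightarrow> A None $ 1 $ 1) at_infinity)"
    "(\<lambda>u. endo_inf A u $ 1 $ 2) holomorphic_on ?I \<longleftrightarrow>
      (None \<in> U \<longrightarrow> ((\<lambda>x. inverse x * A (Some x) $ 1 $ 2) \<longlongrightarrow> A None $ 1 $ 2) at_infinity)"
    "(\<lambda>u. endo_inf A u $ 2 $ 1) holomorphic_on ?I \<longleftrightarrow>
      (None \<in> U \<longrightarrow> ((\<lambda>x. x * A (Some x) $ 2 $ 1) \<longlongrightarrow> A None $ 2 $ 1) at_infinity)"
    "(\<lambda>u. endo_inf A u $ 2 $ 2) holomorphic_on ?I \<longleftrightarrow>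
      (None \<in> U \<longrightarrow> ((\<lambda>x. A (Some x) $ 2 $ 2) \<longlongrightarrow> A None $ 2 $ 2) at_infinity)"
    if hol: "\<And>i j. (\<lambda>x. A (Some x) $ i $ j) holomorphic_on {x. Some x \<in> U}"
  proof -
    have hol': "(\<lambda>x. A (Some x) $ i $ j) holomorphic_on {x. Some x \<in> U \<and> x \<noteq> 0}" for i j
      using hol by (rule holomorphic_on_subset) auto
    show "(\<lambda>u. endo_inf A u $ 1 $ 1) holomorphic_on ?I \<longleftrightarrow>
      (None \<in> U \<longrightarrow> ((\<lambda>x. A (Some x) $ 1 $ 1) \<longlongrightarrow> A None $ 1 $ 1) at_infinity)"
      by (subst chart_inf_holomorphic_iff[OF assms, where G = "\<lambda>x. A (Some x) $ 1 $ 1"])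
        (auto intro!: holomorphic_intros hol' simp: endo_inf_eq Let_def)
    show "(\<lambda>u. endo_inf A u $ 1 $ 2) holomorphic_on ?I \<longleftrightarrow>
      (None \<in> U \<longrightarrow> ((\<lambda>x. inverse x * A (Some x) $ 1 $ 2) \<longlongrightarrow> A None $ 1 $ 2) at_infinity)"
      by (subst chart_inf_holomorphic_iff[OF assms, where G = "\<lambda>x. inverse x * A (Some x) $ 1 $ 2"])
        (auto intro!: holomorphic_intros hol' simp: endo_inf_eq Let_def)
    show "(\<lambda>u. endo_inf A u $ 2 $ 1) holomorphic_on ?I \<longleftrightarrow>
      (None \<in> U \<longrightarrow> ((\<lambda>x. x * A (Some x) $ 2 $ 1) \<longlongrightarrow> A None $ 2 $ 1) at_infinity)"
      by (subst chart_inf_holomorphic_iff[OF assms, where G = "\<lambda>x. x * A (Some x) $ 2 $ 1"])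
        (auto intro!: holomorphic_intros hol' simp: endo_inf_eq Let_def field_simps)
    show "(\<lambda>u. endo_inf A u $ 2 $ 2) holomorphic_on ?I \<longleftrightarrow>
      (None \<in> U \<longrightarrow> ((\<lambda>x. A (Some x) $ 2 $ 2) \<longlongrightarrow> A None $ 2 $ 2) at_infinity)"
      by (subst chart_inf_holomorphic_iff[OF assms, where G = "\<lambda>x. A (Some x) $ 2 $ 2"])
        (auto intro!: holomorphic_intros hol' simp: endo_inf_eq Let_def)
  qed
  have lim22: "((\<lambda>x. A (Some x) $ 2 $ 2) \<longlongrightarrow> A None $ 2 $ 2) at_infinity"
    if "\<forall>p\<in>U. A p $ 2 $ 2 = - A p $ 1 $ 1" "None \<in> U"
       "((\<lambda>x. A (Some x) $ 1 $ 1) \<longlongrightarrow> A None $ 1 $ 1) at_infinity"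
  proof -
    have "((\<lambda>x. - A (Some x) $ 1 $ 1) \<longlongrightarrow> A None $ 2 $ 2) at_infinity"
      using tendsto_minus[OF that(3)] that(1,2) by simp
    moreover have "\<forall>\<^sub>F x in at_infinity. - A (Some x) $ 1 $ 1 = A (Some x) $ 2 $ 2"
      using assms that(1,2) unfolding openin_P1_iff by (auto elim!: eventually_mono)
    ultimately show ?thesis by (rule Lim_transform_eventually)
  qed
  have A: "A \<in> F U \<longleftrightarrow> (\<forall>i j. (\<lambda>x. A (Some x) $ i $ j) holomorphic_on {x. Some x \<in> U}) \<and>
     (\<forall>i j. (\<lambda>u. endo_inf A u $ i $ j) holomorphic_on ?I) \<and> (\<forall>p\<in>U. trace (A p) = 0) \<and>
     (\<forall>w\<in>W \<inter> U. preserves_line (A w) (line w))"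
    by (simp add: sl_sheaf_def holomorphic_endo_on_def holomorphic_matrix_on_def)
  show ?thesis
  proof (cases "(\<forall>i j. (\<lambda>x. A (Some x) $ i $ j) holomorphic_on {x. Some x \<in> U}) \<and> (\<forall>p\<in>U. trace (A p) = 0)")
    case True
    then have 1: "(\<forall>w\<in>W \<inter> U. preserves_line (A w) (line w)) \<longleftrightarrow>
      (\<forall>w\<in>W \<inter> U. A w $ 1 $ 2 + 2 * slope w * A w $ 1 $ 1 - (slope w)\<^sup>2 * A w $ 2 $ 1 = 0)"
      using pl by (intro ball_cong) auto
    have tr22: "\<forall>p\<in>U. A p $ 2 $ 2 = - A p $ 1 $ 1" using True tr by blast
    from True have "\<And>i j. (\<lambda>x. A (Some x) $ i $ j) holomorphic_on {x. Some x \<in> U}" by blast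
    note inf = inf[OF this]
    have 2: "(\<forall>i j. (\<lambda>u. endo_inf A u $ i $ j) holomorphic_on ?I) \<longleftrightarrow>
      (None \<in> U \<longrightarrow> ((\<lambda>x. A (Some x) $ 1 $ 1) \<longlongrightarrow> A None $ 1 $ 1) at_infinity \<and>
        ((\<lambda>x. inverse x * A (Some x) $ 1 $ 2) \<longlongrightarrow> A None $ 1 $ 2) at_infinity \<and>
        ((\<lambda>x. x * A (Some x) $ 2 $ 1) \<longlongrightarrow> A None $ 2 $ 1) at_infinity)"
      unfolding forall_22[of "\<lambda>i j. (\<lambda>u. endo_inf A u $ i $ j) holomorphic_on ?I"] inf
      using lim22[OF tr22] by auto
    show ?thesis unfolding A 1 2 using True tr22 by argo
  next
    case False
    then show ?thesis using A tr by blast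
  qed
qed

lemma F_subset:
  assumes "A \<in> F V" "U \<subseteq> V" shows "A \<in> F U"
proof -
  have "{x. Some x \<in> U} \<subseteq> {x. Some x \<in> V}" "{u. chart_inf u \<in> U} \<subseteq> {u. chart_inf u \<in> V}"
    using assms(2) by auto
  note sub = this[THEN holomorphic_on_subset[rotated]]
  show ?thesis
    using assms sub unfolding sl_sheaf_def holomorphic_endo_on_def holomorphic_matrix_on_def by blast
qed

lemma F_lin:
  assumes U: "openin P1 U" and A: "A \<in> F U" and B: "B \<in> F U"
  shows "(\<lambda>p. mscale a (A p) + mscale b (B p)) \<in> F U"
proof -
  note A' = A[unfolded F_iff[OF U]] and B' = B[unfolded F_iff[OF U]]
  show ?thesis unfolding F_iff[OF U]
  proof (intro conjI allI ballI impI)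
    fix i j show "(\<lambda>x. (mscale a (A (Some x)) + mscale b (B (Some x))) $ i $ j) holomorphic_on {x. Some x \<in> U}"
      using A' B' by (auto intro!: holomorphic_intros)
  next
    fix p assume "p \<in> U"
    then show "(mscale a (A p) + mscale b (B p)) $ 2 $ 2 = - (mscale a (A p) + mscale b (B p)) $ 1 $ 1"
      using A' B' by simp
  next
    fix w assume "w \<in> W \<inter> U"
    then have *: "A w $ 1 $ 2 + 2 * slope w * A w $ 1 $ 1 - (slope w)\<^sup>2 * A w $ 2 $ 1 = 0"
      "B w $ 1 $ 2 + 2 * slope w * B w $ 1 $ 1 - (slope w)\<^sup>2 * B w $ 2 $ 1 = 0"
      using A' B' by blast+
    have "(mscale a (A w) + mscale b (B w)) $ 1 $ 2 + 2 * slope w * (mscale a (A w) + mscale b (B w)) $ 1 $ 1 -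
        (slope w)\<^sup>2 * (mscale a (A w) + mscale b (B w)) $ 2 $ 1 =
       a * (A w $ 1 $ 2 + 2 * slope w * A w $ 1 $ 1 - (slope w)\<^sup>2 * A w $ 2 $ 1) +
       b * (B w $ 1 $ 2 + 2 * slope w * B w $ 1 $ 1 - (slope w)\<^sup>2 * B w $ 2 $ 1)"
      by (simp add: algebra_simps)
    also have "\<dots> = 0" unfolding * by simp
    finally show "(mscale a (A w) + mscale b (B w)) $ 1 $ 2 + 2 * slope w * (mscale a (A w) + mscale b (B w)) $ 1 $ 1 -
        (slope w)\<^sup>2 * (mscale a (A w) + mscale b (B w)) $ 2 $ 1 = 0" .
  next
    assume n: "None \<in> U"
    show "((\<lambda>x. (mscale a (A (Some x)) + mscale b (B (Some x))) $ 1 $ 1) \<longlongrightarrow> (mscale a (A None) + mscale b (B None)) $ 1 $ 1) at_infinity"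
      using A' B' n by (auto intro!: tendsto_intros)
    have "((\<lambda>x. a * (inverse x * A (Some x) $ 1 $ 2) + b * (inverse x * B (Some x) $ 1 $ 2))
        \<longlongrightarrow> a * A None $ 1 $ 2 + b * B None $ 1 $ 2) at_infinity"
      using A' B' n by (intro tendsto_intros) auto
    then show "((\<lambda>x. inverse x * (mscale a (A (Some x)) + mscale b (B (Some x))) $ 1 $ 2) \<longlongrightarrow> (mscale a (A None) + mscale b (B None)) $ 1 $ 2) at_infinity"
      by (simp add: algebra_simps)
    have "((\<lambda>x. a * (x * A (Some x) $ 2 $ 1) + b * (x * B (Some x) $ 2 $ 1))
        \<longlongrightarrow> a * A None $ 2 $ 1 + b * B None $ 2 $ 1) at_infinity"
      using A' B' n by (intro tendsto_intros) auto
    then show "((\<lambda>x. x * (mscale a (A (Some x)) + mscale b (B (Some x))) $ 2 $ 1) \<longlongrightarrow> (mscale a (A None) + mscale b (B None)) $ 2 $ 1) at_infinity"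
      by (simp add: algebra_simps)
  qed
qed

text \<open>A priori the upper right entry may grow linearly at infinity. The line of slope 0 there
  forces \<open>A None $ 1 $ 2 = 0\<close>, so the entry divided by \<open>x\<close> tends to 0;
  being holomorphic in \<open>u\<close>, that quotient has a zero at \<open>u = 0\<close>, and the
  entry itself has a finite limit.\<close>

lemma F_entries:
  assumes U: "openin P1 U" and A: "A \<in> F U"
  shows "hol_P1 (\<lambda>x. A (Some x) $ 1 $ 1) U" "hol_P1 (\<lambda>x. A (Some x) $ 1 $ 2) U"
    "hol_P1 (\<lambda>x. A (Some x) $ 2 $ 1) U"
    "None \<in> U \<Longrightarrow> ((\<lambda>x. A (Some x) $ 2 $ 1) \<longlongrightarrow> 0) at_infinity"
proof -
  note A' = A[unfolded F_iff[OF U]]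
  show "hol_P1 (\<lambda>x. A (Some x) $ 1 $ 1) U" using A' by (auto simp: hol_P1_def)
  show lim: "((\<lambda>x. A (Some x) $ 2 $ 1) \<longlongrightarrow> 0) at_infinity" if n: "None \<in> U"
  proof -
    have "((\<lambda>x. inverse x * (x * A (Some x) $ 2 $ 1)) \<longlongrightarrow> 0 * A None $ 2 $ 1) at_infinity"
      using A' n by (intro tendsto_mult tendsto_inverse_0) auto
    moreover have "\<forall>\<^sub>F x in at_infinity. inverse x * (x * A (Some x) $ 2 $ 1) = A (Some x) $ 2 $ 1"
      using eventually_not_equal_at_infinity[of 0] by (auto elim!: eventually_mono)
    ultimately have "((\<lambda>x. A (Some x) $ 2 $ 1) \<longlongrightarrow> 0 * A None $ 2 $ 1) at_infinity"
      by (rule Lim_transform_eventually)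
    then show ?thesis by simp
  qed
  show "hol_P1 (\<lambda>x. A (Some x) $ 2 $ 1) U" using A' lim by (auto simp: hol_P1_def)
  have "\<exists>l. ((\<lambda>x. A (Some x) $ 1 $ 2) \<longlongrightarrow> l) at_infinity" if n: "None \<in> U"
  proof -
    \<comment> \<open>Removing \<open>Some 0\<close> makes \<open>inverse x\<close> holomorphic
      without changing anything near infinity.\<close>
    let ?V = "U - {Some 0}"
    have eq: "{x. Some x \<in> ?V} = {x. Some x \<in> U} - {0}" by auto
    have V: "openin P1 ?V"
      using U eventually_not_equal_at_infinity[of "0::complex"]
      unfolding openin_P1_iff eq by (auto simp: open_delete elim: eventually_elim2)
    have "None \<in> W \<inter> U" using n by (simp add: marked_def)
    moreover have "\<forall>w\<in>W \<inter> U. A w $ 1 $ 2 + 2 * slope w * A w $ 1 $ 1 - (slope w)\<^sup>2 * A w $ 2 $ 1 = 0"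
      using A' by blast
    ultimately have "A None $ 1 $ 2 + 2 * slope None * A None $ 1 $ 1 - (slope None)\<^sup>2 * A None $ 2 $ 1 = 0"
      by (rule bspec[rotated])
    then have "A None $ 1 $ 2 = 0" by simp
    then have "((\<lambda>x. inverse x * A (Some x) $ 1 $ 2) \<longlongrightarrow> 0) at_infinity" using A' n by simp
    moreover have "(\<lambda>x. inverse x * A (Some x) $ 1 $ 2) holomorphic_on {x. Some x \<in> ?V}"
    proof -
      have "(\<lambda>x. A (Some x) $ 1 $ 2) holomorphic_on {x. Some x \<in> U} - {0}"
        by (rule holomorphic_on_subset[of _ "{x. Some x \<in> U}"]) (use conjunct1[OF A'] in auto)
      then show ?thesis unfolding eq by (intro holomorphic_intros) auto
    qed
    ultimately obtain L where "((\<lambda>x. x * (inverse x * A (Some x) $ 1 $ 2)) \<longlongrightarrow> L) at_infinity"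
      using tendsto_at_infinity_mult_ident[OF V] n by blast
    moreover have "\<forall>\<^sub>F x in at_infinity. x * (inverse x * A (Some x) $ 1 $ 2) = A (Some x) $ 1 $ 2"
      using eventually_not_equal_at_infinity[of 0] by (auto elim!: eventually_mono)
    ultimately have "((\<lambda>x. A (Some x) $ 1 $ 2) \<longlongrightarrow> L) at_infinity"
      by (rule Lim_transform_eventually)
    then show ?thesis ..
  qed
  then show "hol_P1 (\<lambda>x. A (Some x) $ 1 $ 2) U" using A' by (auto simp: hol_P1_def)
qed

text \<open>The values at infinity are forced to be limits of the finite ones, hence
  \<open>Lim\<close>; the zero of \<open>c\<close> provides the limit of
  \<open>x * c x\<close>.\<close>

lemma F_of_entries:
  assumes U: "openin P1 U" and a: "hol_P1 a U" and b: "hol_P1 b U" and c: "hol_P1 c U"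
    and c0: "None \<in> U \<Longrightarrow> (c \<longlongrightarrow> 0) at_infinity"
    and W: "\<And>x. Some x \<in> W \<inter> U \<Longrightarrow> b x + 2 * slope (Some x) * a x - (slope (Some x))\<^sup>2 * c x = 0"
  obtains A where "A \<in> F U" "\<And>x. A (Some x) = mat2 (a x) (b x) (c x) (- a x)"
proof -
  define la Lc where "la = Lim at_infinity a" and "Lc = Lim at_infinity (\<lambda>x. x * c x)"
  define A where "A p = (case p of None \<Rightarrow> mat2 la 0 Lc (- la)
     | Some x \<Rightarrow> mat2 (a x) (b x) (c x) (- a x))" for p
  have "A \<in> F U" unfolding F_iff[OF U]
  proof (intro conjI allI ballI impI)
    fix i j :: 2 show "(\<lambda>x. A (Some x) $ i $ j) holomorphic_on {x. Some x \<in> U}"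
      using exhaust_2[of i] exhaust_2[of j] a b c
      by (auto simp: A_def hol_P1_def intro!: holomorphic_intros)
  next
    fix p show "A p $ 2 $ 2 = - A p $ 1 $ 1" by (simp add: A_def split: option.split)
  next
    fix w assume "w \<in> W \<inter> U"
    then show "A w $ 1 $ 2 + 2 * slope w * A w $ 1 $ 1 - (slope w)\<^sup>2 * A w $ 2 $ 1 = 0"
      using W by (cases w) (auto simp: A_def)
  next
    assume n: "None \<in> U"
    show "((\<lambda>x. A (Some x) $ 1 $ 1) \<longlongrightarrow> A None $ 1 $ 1) at_infinity"
      using a n tendsto_Lim[OF trivial_limit_at_infinity, of a]
      by (auto simp: A_def la_def hol_P1_def)
    obtain l where "(b \<longlongrightarrow> l) at_infinity" using b n by (auto simp: hol_P1_def)
    then have "((\<lambda>x. inverse x * b x) \<longlongrightarrow> 0 * l) at_infinity"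
      by (intro tendsto_mult tendsto_inverse_0)
    then show "((\<lambda>x. inverse x * A (Some x) $ 1 $ 2) \<longlongrightarrow> A None $ 1 $ 2) at_infinity"
      by (simp add: A_def)
    obtain L where "((\<lambda>x. x * c x) \<longlongrightarrow> L) at_infinity"
      using tendsto_at_infinity_mult_ident[OF U n _ c0[OF n]] c by (auto simp: hol_P1_def)
    then show "((\<lambda>x. x * A (Some x) $ 2 $ 1) \<longlongrightarrow> A None $ 2 $ 1) at_infinity"
      using tendsto_Lim[OF trivial_limit_at_infinity, of "\<lambda>x. x * c x"] by (auto simp: A_def Lc_def)
  qed
  then show thesis by (rule that) (simp add: A_def)
qed

text \<open>The value at infinity is a limit of finite values in every entry. Coboundary identities
  can therefore be checked in the affine chart.\<close>

lemma F_eq_at_infinity: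
  assumes U: "openin P1 U" and A: "A \<in> F U" and B: "B \<in> F U" and "None \<in> U"
    and eq: "\<And>x. Some x \<in> U \<Longrightarrow> A (Some x) = B (Some x)"
  shows "A None = B None"
proof -
  note A' = A[unfolded F_iff[OF U]] and B' = B[unfolded F_iff[OF U]]
  have ev: "\<forall>\<^sub>F x in at_infinity. A (Some x) = B (Some x)"
    using U \<open>None \<in> U\<close> eq unfolding openin_P1_iff by (auto elim!: eventually_mono)
  have "((\<lambda>x. B (Some x) $ 1 $ 1) \<longlongrightarrow> A None $ 1 $ 1) at_infinity"
    by (rule Lim_transform_eventually) (use A' assms ev in \<open>auto elim!: eventually_mono\<close>)
  then have 1: "A None $ 1 $ 1 = B None $ 1 $ 1"
    using B' \<open>None \<in> U\<close> tendsto_unique trivial_limit_at_infinity by blast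
  have "((\<lambda>x. inverse x * B (Some x) $ 1 $ 2) \<longlongrightarrow> A None $ 1 $ 2) at_infinity"
    by (rule Lim_transform_eventually[of "\<lambda>x. inverse x * A (Some x) $ 1 $ 2"])
      (use A' assms ev in \<open>auto elim!: eventually_mono\<close>)
  then have 2: "A None $ 1 $ 2 = B None $ 1 $ 2"
    using B' \<open>None \<in> U\<close> tendsto_unique trivial_limit_at_infinity by blast
  have "((\<lambda>x. x * B (Some x) $ 2 $ 1) \<longlongrightarrow> A None $ 2 $ 1) at_infinity"
    by (rule Lim_transform_eventually[of "\<lambda>x. x * A (Some x) $ 2 $ 1"])
      (use A' assms ev in \<open>auto elim!: eventually_mono\<close>)
  then have 3: "A None $ 2 $ 1 = B None $ 2 $ 1"
    using B' \<open>None \<in> U\<close> tendsto_unique trivial_limit_at_infinity by blast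
  show ?thesis using 1 2 3 A' B' \<open>None \<in> U\<close> by (simp add: mat2_eq_iff)
qed

end

section \<open>Cech cohomology of a presheaf of vector spaces\<close>

lemma point_cover_Int: "point_cover X U \<Longrightarrow> point_cover X V \<Longrightarrow> point_cover X (\<lambda>p. U p \<inter> V p)"
  by (auto simp: point_cover_def)

text \<open>Restriction and linear combinations are all that the vector space structure on
  cohomology rests on. Restriction keeps the function unchanged, since sections over
  \<open>U\<close> are total functions whose values on \<open>U\<close> alone count.\<close>

locale presheaf =
  fixes X :: "'a topology" and F :: "'a set \<Rightarrow> ('a \<Rightarrow> 'b::ab_group_add) set"
    and sc :: "complex \<Rightarrow> 'b \<Rightarrow> 'b"
  assumes restrict: "A \<in> F V \<Longrightarrow> U \<subseteq> V \<Longrightarrow> A \<in> F U"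
    and zero_mem: "openin X U \<Longrightarrow> (\<lambda>p. 0) \<in> F U"
    and lin_mem: "openin X U \<Longrightarrow> A \<in> F U \<Longrightarrow> B \<in> F U \<Longrightarrow> (\<lambda>p. sc a (A p) + sc b (B p)) \<in> F U"
    and sc_add_right: "sc z (v + w) = sc z v + sc z w"
    and sc_add_left: "sc (z + z') v = sc z v + sc z' v"
    and sc_mult: "sc (z * z') v = sc z (sc z' v)"
    and sc_one [simp]: "sc 1 v = v"
begin

lemma sc_zero_left [simp]: "sc 0 v = 0"
  using sc_add_left[of 0 0 v] by simp

lemma sc_zero_right [simp]: "sc z 0 = 0"
  using sc_add_right[of z 0 0] by simp

lemma sc_minus_left: "sc (- z) v = - sc z v"
  using sc_add_left[of z "- z" v] by (simp add: eq_neg_iff_add_eq_0 add.commute)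

lemma sc_minus_right: "sc z (- v) = - sc z v"
  using sc_add_right[of z v "- v"] by (simp add: eq_neg_iff_add_eq_0 add.commute)

lemma sc_diff_right: "sc z (v - w) = sc z v - sc z w"
  using sc_add_right[of z v "- w"] by (simp add: sc_minus_right)

lemma add_mem: "openin X U \<Longrightarrow> A \<in> F U \<Longrightarrow> B \<in> F U \<Longrightarrow> (\<lambda>p. A p + B p) \<in> F U"
  using lin_mem[of U A B 1 1] by simp

lemma scale_mem: "openin X U \<Longrightarrow> A \<in> F U \<Longrightarrow> (\<lambda>p. sc z (A p)) \<in> F U"
  using lin_mem[of U A A z 0] by simp

lemma minus_mem: "openin X U \<Longrightarrow> A \<in> F U \<Longrightarrow> (\<lambda>p. - A p) \<in> F U"
  using scale_mem[of U A "-1"] by (simp add: sc_minus_left)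

lemma diff_mem: "openin X U \<Longrightarrow> A \<in> F U \<Longrightarrow> B \<in> F U \<Longrightarrow> (\<lambda>p. A p - B p) \<in> F U"
  using add_mem[of U A "\<lambda>p. - B p"] by (simp add: minus_mem)

abbreviation "cocycles \<equiv> cech_cocycles X F"
abbreviation "rel \<equiv> cech_rel X F"

lemma cocycles_iff:
  "\<xi> \<in> cocycles \<longleftrightarrow> point_cover X (fst \<xi>) \<and>
     (\<forall>p\<in>topspace X. \<forall>q\<in>topspace X. snd \<xi> p q \<in> F (fst \<xi> p \<inter> fst \<xi> q)) \<and>
     (\<forall>p\<in>topspace X. \<forall>q\<in>topspace X. \<forall>m\<in>topspace X. \<forall>x\<in>fst \<xi> p \<inter> fst \<xi> q \<inter> fst \<xi> m.
        snd \<xi> p q x + snd \<xi> q m x = snd \<xi> p m x)"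
  by (simp add: cech_cocycles_def case_prod_beta)

lemma rel_iff:
  "(\<xi>, \<eta>) \<in> rel \<longleftrightarrow> \<xi> \<in> cocycles \<and> \<eta> \<in> cocycles \<and>
     (\<exists>W g. point_cover X W \<and>
        (\<forall>p\<in>topspace X. W p \<subseteq> fst \<xi> p \<inter> fst \<eta> p \<and> g p \<in> F (W p)) \<and>
        (\<forall>p\<in>topspace X. \<forall>q\<in>topspace X. \<forall>x\<in>W p \<inter> W q. snd \<xi> p q x - snd \<eta> p q x = g p x - g q x))"
  by (simp add: cech_rel_def case_prod_beta)

lemma relI:
  assumes "\<xi> \<in> cocycles" "\<eta> \<in> cocycles" "point_cover X W"
    "\<And>p. p \<in> topspace X \<Longrightarrow> W p \<subseteq> fst \<xi> p \<inter> fst \<eta> p"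
    "\<And>p. p \<in> topspace X \<Longrightarrow> g p \<in> F (W p)"
    "\<And>p q x. p \<in> topspace X \<Longrightarrow> q \<in> topspace X \<Longrightarrow> x \<in> W p \<Longrightarrow> x \<in> W q \<Longrightarrow>
        snd \<xi> p q x - snd \<eta> p q x = g p x - g q x"
  shows "(\<xi>, \<eta>) \<in> rel"
  unfolding rel_iff using assms by blast

lemma relE:
  assumes "(\<xi>, \<eta>) \<in> rel"
  obtains W g where "\<xi> \<in> cocycles" "\<eta> \<in> cocycles" "point_cover X W"
    "\<And>p. p \<in> topspace X \<Longrightarrow> W p \<subseteq> fst \<xi> p \<inter> fst \<eta> p"
    "\<And>p. p \<in> topspace X \<Longrightarrow> g p \<in> F (W p)"
    "\<And>p q x. p \<in> topspace X \<Longrightarrow> q \<in> topspace X \<Longrightarrow> x \<in> W p \<Longrightarrow> x \<in> W q \<Longrightarrow>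
        snd \<xi> p q x - snd \<eta> p q x = g p x - g q x"
  using assms unfolding rel_iff by (metis IntI)

lemma open_cover: "point_cover X U \<Longrightarrow> p \<in> topspace X \<Longrightarrow> openin X (U p)"
  by (simp add: point_cover_def)

text \<open>The zero cochain on a common refinement compares the two: a class depends on the
  functions and not on the covering. Vector space laws, whose two sides may carry different
  coverings, follow from this.\<close>

lemma rel_of_eq:
  assumes "\<xi> \<in> cocycles" "\<eta> \<in> cocycles" "snd \<xi> = snd \<eta>"
  shows "(\<xi>, \<eta>) \<in> rel"
proof (rule relI[OF assms(1,2)])
  show "point_cover X (\<lambda>p. fst \<xi> p \<inter> fst \<eta> p)"
    using assms by (auto simp: cocycles_iff intro: point_cover_Int)
  then show "(\<lambda>p. 0) \<in> F (fst \<xi> p \<inter> fst \<eta> p)" if "p \<in> topspace X" for p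
    using that open_cover zero_mem by blast
qed (use assms in auto)

lemma equiv_rel: "equiv cocycles rel"
proof (rule equivI)
  show "rel \<subseteq> cocycles \<times> cocycles" by (auto simp: rel_iff)
  show "refl_on cocycles rel"
    using rel_of_eq by (auto simp: refl_on_def)
  show "sym rel"
  proof (rule symI)
    fix \<xi> \<eta> assume "(\<xi>, \<eta>) \<in> rel"
    then obtain W g where W: "\<xi> \<in> cocycles" "\<eta> \<in> cocycles" "point_cover X W"
      "\<And>p. p \<in> topspace X \<Longrightarrow> W p \<subseteq> fst \<xi> p \<inter> fst \<eta> p"
      "\<And>p. p \<in> topspace X \<Longrightarrow> g p \<in> F (W p)"
      "\<And>p q x. p \<in> topspace X \<Longrightarrow> q \<in> topspace X \<Longrightarrow> x \<in> W p \<Longrightarrow> x \<in> W q \<Longrightarrow>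
          snd \<xi> p q x - snd \<eta> p q x = g p x - g q x" by (rule relE) blast
    show "(\<eta>, \<xi>) \<in> rel"
    proof (rule relI[OF W(2,1,3)])
      show "(\<lambda>x. - g p x) \<in> F (W p)" if "p \<in> topspace X" for p
        using that W by (intro minus_mem open_cover)
      show "snd \<eta> p q x - snd \<xi> p q x = - g p x - (- g q x)"
        if "p \<in> topspace X" "q \<in> topspace X" "x \<in> W p" "x \<in> W q" for p q x
      proof -
        have "snd \<eta> p q x - snd \<xi> p q x = - (snd \<xi> p q x - snd \<eta> p q x)" by simp
        also have "\<dots> = - (g p x - g q x)" by (simp only: W(6)[OF that])
        finally show ?thesis by simp
      qed
    qed (use W(4) in auto)
  qed
  show "trans rel"
  proof (rule transI)
    fix \<xi> \<eta> \<zeta> assume "(\<xi>, \<eta>) \<in> rel" "(\<eta>, \<zeta>) \<in> rel"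
    from this(1) obtain W g where W: "\<xi> \<in> cocycles" "\<eta> \<in> cocycles" "point_cover X W"
      "\<And>p. p \<in> topspace X \<Longrightarrow> W p \<subseteq> fst \<xi> p \<inter> fst \<eta> p"
      "\<And>p. p \<in> topspace X \<Longrightarrow> g p \<in> F (W p)"
      "\<And>p q x. p \<in> topspace X \<Longrightarrow> q \<in> topspace X \<Longrightarrow> x \<in> W p \<Longrightarrow> x \<in> W q \<Longrightarrow>
          snd \<xi> p q x - snd \<eta> p q x = g p x - g q x" by (rule relE) blast
    from \<open>(\<eta>, \<zeta>) \<in> rel\<close> obtain V h where V: "\<eta> \<in> cocycles" "\<zeta> \<in> cocycles" "point_cover X V"
      "\<And>p. p \<in> topspace X \<Longrightarrow> V p \<subseteq> fst \<eta> p \<inter> fst \<zeta> p"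
      "\<And>p. p \<in> topspace X \<Longrightarrow> h p \<in> F (V p)"
      "\<And>p q x. p \<in> topspace X \<Longrightarrow> q \<in> topspace X \<Longrightarrow> x \<in> V p \<Longrightarrow> x \<in> V q \<Longrightarrow>
          snd \<eta> p q x - snd \<zeta> p q x = h p x - h q x" by (rule relE) blast
    note WV = point_cover_Int[OF W(3) V(3)]
    show "(\<xi>, \<zeta>) \<in> rel"
    proof (rule relI[OF W(1) V(2) WV])
      show "W p \<inter> V p \<subseteq> fst \<xi> p \<inter> fst \<zeta> p" if "p \<in> topspace X" for p
        using W(4) V(4) that by blast
      show "(\<lambda>x. g p x + h p x) \<in> F (W p \<inter> V p)" if p: "p \<in> topspace X" for p
        by (intro add_mem open_cover[OF WV] p restrict[OF W(5)[OF p]] restrict[OF V(5)[OF p]]) auto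
      show "snd \<xi> p q x - snd \<zeta> p q x = g p x + h p x - (g q x + h q x)"
        if "p \<in> topspace X" "q \<in> topspace X" "x \<in> W p \<inter> V p" "x \<in> W q \<inter> V q" for p q x
      proof -
        have "snd \<xi> p q x - snd \<zeta> p q x = (snd \<xi> p q x - snd \<eta> p q x) + (snd \<eta> p q x - snd \<zeta> p q x)"
          by simp
        also have "\<dots> = (g p x - g q x) + (h p x - h q x)"
          using that W(6)[of p q x] V(6)[of p q x] by simp
        finally show ?thesis by (simp add: algebra_simps)
      qed
    qed
  qed
qed

lemma fst_cech_add [simp]: "fst (cech_add \<xi> \<eta>) = (\<lambda>p. fst \<xi> p \<inter> fst \<eta> p)"
  and snd_cech_add [simp]: "snd (cech_add \<xi> \<eta>) = (\<lambda>p q x. snd \<xi> p q x + snd \<eta> p q x)"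
  and fst_cech_scale [simp]: "fst (cech_scale sc z \<xi>) = fst \<xi>"
  and snd_cech_scale [simp]: "snd (cech_scale sc z \<xi>) = (\<lambda>p q x. sc z (snd \<xi> p q x))"
  by (simp_all add: cech_add_def cech_scale_def)

lemma cech_add_cocycles:
  assumes \<xi>: "\<xi> \<in> cocycles" and \<eta>: "\<eta> \<in> cocycles" shows "cech_add \<xi> \<eta> \<in> cocycles"
  unfolding cocycles_iff
proof (intro conjI ballI)
  show c: "point_cover X (fst (cech_add \<xi> \<eta>))"
    using \<xi> \<eta> by (auto simp: cocycles_iff intro: point_cover_Int)
  show "snd (cech_add \<xi> \<eta>) p q \<in> F (fst (cech_add \<xi> \<eta>) p \<inter> fst (cech_add \<xi> \<eta>) q)"
    if pq: "p \<in> topspace X" "q \<in> topspace X" for p q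
  proof -
    have "openin X (fst (cech_add \<xi> \<eta>) p \<inter> fst (cech_add \<xi> \<eta>) q)"
      using c pq by (intro openin_Int open_cover)
    moreover have "snd \<xi> p q \<in> F (fst \<xi> p \<inter> fst \<xi> q)" "snd \<eta> p q \<in> F (fst \<eta> p \<inter> fst \<eta> q)"
      using \<xi> \<eta> pq by (auto simp: cocycles_iff)
    then have "snd \<xi> p q \<in> F (fst (cech_add \<xi> \<eta>) p \<inter> fst (cech_add \<xi> \<eta>) q)"
      "snd \<eta> p q \<in> F (fst (cech_add \<xi> \<eta>) p \<inter> fst (cech_add \<xi> \<eta>) q)"
      by (auto elim!: restrict)
    ultimately show ?thesis unfolding snd_cech_add by (intro add_mem)
  qed
  show "snd (cech_add \<xi> \<eta>) p q x + snd (cech_add \<xi> \<eta>) q m x = snd (cech_add \<xi> \<eta>) p m x"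
    if "p \<in> topspace X" "q \<in> topspace X" "m \<in> topspace X"
      "x \<in> fst (cech_add \<xi> \<eta>) p \<inter> fst (cech_add \<xi> \<eta>) q \<inter> fst (cech_add \<xi> \<eta>) m" for p q m x
  proof -
    have "snd \<xi> p q x + snd \<xi> q m x = snd \<xi> p m x" "snd \<eta> p q x + snd \<eta> q m x = snd \<eta> p m x"
      using \<xi> \<eta> that by (auto simp: cocycles_iff)
    moreover have "snd (cech_add \<xi> \<eta>) p q x + snd (cech_add \<xi> \<eta>) q m x =
        (snd \<xi> p q x + snd \<xi> q m x) + (snd \<eta> p q x + snd \<eta> q m x)"
      by (simp add: add_ac)
    ultimately show ?thesis by simp
  qed
qed

lemma cech_scale_cocycles:
  assumes \<xi>: "\<xi> \<in> cocycles" shows "cech_scale sc z \<xi> \<in> cocycles"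
proof -
  have "openin X (fst \<xi> p \<inter> fst \<xi> q)" if "p \<in> topspace X" "q \<in> topspace X" for p q
    using \<xi> that by (auto simp: cocycles_iff point_cover_def)
  then show ?thesis
    using \<xi> unfolding cocycles_iff by (auto simp: sc_add_right[symmetric] intro!: scale_mem)
qed

lemma cech_add_rel:
  assumes "(\<xi>, \<xi>') \<in> rel" "(\<eta>, \<eta>') \<in> rel"
  shows "(cech_add \<xi> \<eta>, cech_add \<xi>' \<eta>') \<in> rel"
proof -
  from assms(1) obtain W g where W: "\<xi> \<in> cocycles" "\<xi>' \<in> cocycles" "point_cover X W"
    "\<And>p. p \<in> topspace X \<Longrightarrow> W p \<subseteq> fst \<xi> p \<inter> fst \<xi>' p"
    "\<And>p. p \<in> topspace X \<Longrightarrow> g p \<in> F (W p)"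
    "\<And>p q x. p \<in> topspace X \<Longrightarrow> q \<in> topspace X \<Longrightarrow> x \<in> W p \<Longrightarrow> x \<in> W q \<Longrightarrow>
        snd \<xi> p q x - snd \<xi>' p q x = g p x - g q x" by (rule relE) blast
  from assms(2) obtain V h where V: "\<eta> \<in> cocycles" "\<eta>' \<in> cocycles" "point_cover X V"
    "\<And>p. p \<in> topspace X \<Longrightarrow> V p \<subseteq> fst \<eta> p \<inter> fst \<eta>' p"
    "\<And>p. p \<in> topspace X \<Longrightarrow> h p \<in> F (V p)"
    "\<And>p q x. p \<in> topspace X \<Longrightarrow> q \<in> topspace X \<Longrightarrow> x \<in> V p \<Longrightarrow> x \<in> V q \<Longrightarrow>
        snd \<eta> p q x - snd \<eta>' p q x = h p x - h q x" by (rule relE) blast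
  note WV = point_cover_Int[OF W(3) V(3)]
  show ?thesis
  proof (rule relI[OF cech_add_cocycles[OF W(1) V(1)] cech_add_cocycles[OF W(2) V(2)] WV])
    show "W p \<inter> V p \<subseteq> fst (cech_add \<xi> \<eta>) p \<inter> fst (cech_add \<xi>' \<eta>') p" if "p \<in> topspace X" for p
      using W(4)[OF that] V(4)[OF that] by auto
    show "(\<lambda>x. g p x + h p x) \<in> F (W p \<inter> V p)" if p: "p \<in> topspace X" for p
      by (intro add_mem open_cover[OF WV] p restrict[OF W(5)[OF p]] restrict[OF V(5)[OF p]]) auto
    show "snd (cech_add \<xi> \<eta>) p q x - snd (cech_add \<xi>' \<eta>') p q x = g p x + h p x - (g q x + h q x)"
      if "p \<in> topspace X" "q \<in> topspace X" "x \<in> W p \<inter> V p" "x \<in> W q \<inter> V q" for p q x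
    proof -
      have "snd (cech_add \<xi> \<eta>) p q x - snd (cech_add \<xi>' \<eta>') p q x =
          (snd \<xi> p q x - snd \<xi>' p q x) + (snd \<eta> p q x - snd \<eta>' p q x)" by simp
      also have "\<dots> = (g p x - g q x) + (h p x - h q x)"
        using that W(6)[of p q x] V(6)[of p q x] by simp
      finally show ?thesis by (simp add: algebra_simps)
    qed
  qed
qed

lemma cech_scale_rel:
  assumes "(\<xi>, \<xi>') \<in> rel" shows "(cech_scale sc z \<xi>, cech_scale sc z \<xi>') \<in> rel"
proof -
  from assms obtain W g where W: "\<xi> \<in> cocycles" "\<xi>' \<in> cocycles" "point_cover X W"
    "\<And>p. p \<in> topspace X \<Longrightarrow> W p \<subseteq> fst \<xi> p \<inter> fst \<xi>' p"
    "\<And>p. p \<in> topspace X \<Longrightarrow> g p \<in> F (W p)"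
    "\<And>p q x. p \<in> topspace X \<Longrightarrow> q \<in> topspace X \<Longrightarrow> x \<in> W p \<Longrightarrow> x \<in> W q \<Longrightarrow>
        snd \<xi> p q x - snd \<xi>' p q x = g p x - g q x" by (rule relE) blast
  show ?thesis
  proof (rule relI[OF cech_scale_cocycles[OF W(1)] cech_scale_cocycles[OF W(2)] W(3)])
    show "W p \<subseteq> fst (cech_scale sc z \<xi>) p \<inter> fst (cech_scale sc z \<xi>') p" if "p \<in> topspace X" for p
      using W(4)[OF that] by simp
    show "(\<lambda>x. sc z (g p x)) \<in> F (W p)" if "p \<in> topspace X" for p
      using that by (intro scale_mem open_cover[OF W(3)] W(5))
    show "snd (cech_scale sc z \<xi>) p q x - snd (cech_scale sc z \<xi>') p q x = sc z (g p x) - sc z (g q x)"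
      if "p \<in> topspace X" "q \<in> topspace X" "x \<in> W p" "x \<in> W q" for p q x
      using W(6)[OF that] by (simp add: sc_diff_right[symmetric])
  qed
qed

abbreviation "H1 \<equiv> cech_H1 X F sc"

lemma rel_trans: "(\<xi>, \<eta>) \<in> rel \<Longrightarrow> (\<eta>, \<zeta>) \<in> rel \<Longrightarrow> (\<xi>, \<zeta>) \<in> rel"
  using equiv_rel by (rule equivE) (erule transD)

text \<open>Operations on classes are defined by saturating the set of all results on
  representatives. When these results are equivalent, one of them computes the class.\<close>

lemma Image_rel_eqI:
  assumes "\<xi> \<in> A" "\<And>\<xi>'. \<xi>' \<in> A \<Longrightarrow> (\<xi>, \<xi>') \<in> rel"
  shows "rel `` A = rel `` {\<xi>}"
proof
  show "rel `` A \<subseteq> rel `` {\<xi>}"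
  proof
    fix \<zeta> assume "\<zeta> \<in> rel `` A"
    then obtain \<xi>' where "\<xi>' \<in> A" "(\<xi>', \<zeta>) \<in> rel" ..
    with rel_trans[OF assms(2)] show "\<zeta> \<in> rel `` {\<xi>}" by simp
  qed
qed (use assms(1) in auto)

lemma add_class:
  assumes "\<xi> \<in> cocycles" "\<eta> \<in> cocycles"
  shows "cs_add H1 (rel `` {\<xi>}) (rel `` {\<eta>}) = rel `` {cech_add \<xi> \<eta>}"
proof -
  let ?A = "{cech_add \<xi>' \<eta>' |\<xi>' \<eta>'. \<xi>' \<in> rel `` {\<xi>} \<and> \<eta>' \<in> rel `` {\<eta>}}"
  have "(\<xi>, \<xi>) \<in> rel" "(\<eta>, \<eta>) \<in> rel" using assms rel_of_eq by simp_all
  then have "cech_add \<xi> \<eta> \<in> ?A" by (intro CollectI exI[of _ \<xi>] exI[of _ \<eta>]) simp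
  moreover have "(cech_add \<xi> \<eta>, \<zeta>) \<in> rel" if "\<zeta> \<in> ?A" for \<zeta>
  proof -
    from that obtain \<xi>' \<eta>' where "\<zeta> = cech_add \<xi>' \<eta>'" "\<xi>' \<in> rel `` {\<xi>}" "\<eta>' \<in> rel `` {\<eta>}"
      unfolding mem_Collect_eq by metis
    then show ?thesis using cech_add_rel[of \<xi> \<xi>' \<eta> \<eta>'] by simp
  qed
  ultimately show ?thesis using Image_rel_eqI[of "cech_add \<xi> \<eta>" ?A] by (simp add: cech_H1_def)
qed

lemma scale_class:
  assumes "\<xi> \<in> cocycles"
  shows "cs_scale H1 z (rel `` {\<xi>}) = rel `` {cech_scale sc z \<xi>}"
proof -
  have "(\<xi>, \<xi>) \<in> rel" using assms rel_of_eq by simp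
  then have "rel `` (cech_scale sc z ` (rel `` {\<xi>})) = rel `` {cech_scale sc z \<xi>}"
    by (intro Image_rel_eqI) (auto intro: cech_scale_rel)
  then show ?thesis by (simp add: cech_H1_def)
qed

definition comb3 where
  "comb3 \<xi> \<eta> \<zeta> k = cech_add (cech_add (cech_scale sc (k$1) \<xi>) (cech_scale sc (k$2) \<eta>)) (cech_scale sc (k$3) \<zeta>)"
  for k :: "complex^3"

lemma comb3_cocycles:
  "\<xi> \<in> cocycles \<Longrightarrow> \<eta> \<in> cocycles \<Longrightarrow> \<zeta> \<in> cocycles \<Longrightarrow> comb3 \<xi> \<eta> \<zeta> k \<in> cocycles"
  unfolding comb3_def by (intro cech_add_cocycles cech_scale_cocycles)

lemma snd_comb3: "snd (comb3 \<xi> \<eta> \<zeta> k) =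
    (\<lambda>p q x. sc (k$1) (snd \<xi> p q x) + sc (k$2) (snd \<eta> p q x) + sc (k$3) (snd \<zeta> p q x))"
  by (simp add: comb3_def)

lemma lin_comb3_class:
  assumes "\<xi> \<in> cocycles" "\<eta> \<in> cocycles" "\<zeta> \<in> cocycles"
  shows "lin_comb3 H1 (rel `` {\<xi>}) (rel `` {\<eta>}) (rel `` {\<zeta>}) k = rel `` {comb3 \<xi> \<eta> \<zeta> k}"
  unfolding lin_comb3_def comb3_def using assms
  by (simp add: scale_class add_class cech_scale_cocycles cech_add_cocycles)

text \<open>Additivity and homogeneity of the coordinate map hold for the cocycle functions
  themselves, so generation and independence are what remains to be supplied.\<close>

lemma is_basis3_H1I:
  assumes c: "\<xi> \<in> cocycles" "\<eta> \<in> cocycles" "\<zeta> \<in> cocycles"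
    and gen: "\<And>\<omega>. \<omega> \<in> cocycles \<Longrightarrow> \<exists>k. (\<omega>, comb3 \<xi> \<eta> \<zeta> k) \<in> rel"
    and indep: "\<And>k l. (comb3 \<xi> \<eta> \<zeta> k, comb3 \<xi> \<eta> \<zeta> l) \<in> rel \<Longrightarrow> k = l"
  shows "is_basis3 H1 (rel `` {\<xi>}) (rel `` {\<eta>}) (rel `` {\<zeta>})"
proof -
  let ?l = "lin_comb3 H1 (rel `` {\<xi>}) (rel `` {\<eta>}) (rel `` {\<zeta>})"
  note l = lin_comb3_class[OF c]
  have carrier: "cs_carrier H1 = cocycles // rel" by (simp add: cech_H1_def)
  have "inj ?l"
  proof (rule injI)
    fix k k' assume "?l k = ?l k'"
    then have "(comb3 \<xi> \<eta> \<zeta> k, comb3 \<xi> \<eta> \<zeta> k') \<in> rel"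
      unfolding l using eq_equiv_class[OF _ equiv_rel comb3_cocycles[OF c]] by blast
    then show "k = k'" by (rule indep)
  qed
  moreover have "range ?l = cs_carrier H1"
  proof
    show "range ?l \<subseteq> cs_carrier H1" unfolding carrier l using comb3_cocycles[OF c] by (auto simp: quotientI)
    show "cs_carrier H1 \<subseteq> range ?l"
    proof
      fix a assume "a \<in> cs_carrier H1"
      then obtain \<omega> where \<omega>: "\<omega> \<in> cocycles" "a = rel `` {\<omega>}" unfolding carrier by (auto elim: quotientE)
      then obtain k where "(\<omega>, comb3 \<xi> \<eta> \<zeta> k) \<in> rel" using gen by blast
      then have "a = ?l k" unfolding \<omega>(2) l by (rule equiv_class_eq[OF equiv_rel])
      then show "a \<in> range ?l" by blast
    qed
  qed
  moreover have "?l (k + k') = cs_add H1 (?l k) (?l k')" for k k'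
    unfolding l add_class[OF comb3_cocycles[OF c] comb3_cocycles[OF c]]
    by (intro equiv_class_eq[OF equiv_rel] rel_of_eq comb3_cocycles cech_add_cocycles c)
      (simp add: snd_comb3 sc_add_left add_ac)
  moreover have "?l (z *s k) = cs_scale H1 z (?l k)" for z k
    unfolding l scale_class[OF comb3_cocycles[OF c]]
    by (intro equiv_class_eq[OF equiv_rel] rel_of_eq comb3_cocycles cech_scale_cocycles c)
      (simp add: snd_comb3 sc_add_right sc_mult)
  ultimately show ?thesis
    using c unfolding is_basis3_def bij_betw_def carrier by (auto intro: quotientI)
qed

end

section \<open>The deformation cocycles\<close>

context parabolic_data
begin

lemma zero_in_F: "openin P1 U \<Longrightarrow> (\<lambda>p. 0) \<in> F U"
  by (simp add: F_iff)

sublocale sh: presheaf P1 "sl_sheaf W line" mscale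
proof
  show "mscale z (v + w) = mscale z v + mscale z w" "mscale (z + z') v = mscale z v + mscale z' v"
    "mscale (z * z') v = mscale z (mscale z' v)" "mscale 1 v = v" for z z' v w
    by (simp_all add: mat2_eq_iff algebra_simps)
qed (rule F_subset zero_in_F F_lin; assumption)+

text \<open>Up to sign, the deformation cocycle is the coboundary of the constant matrices
  \<open>mat2 0 (jump i p) 0 0\<close>. The matrix at the index \<open>Some i\<close> preserves no
  line of finite slope over \<open>i\<close>, so this is not a cochain of the sheaf.\<close>

definition jump :: "complex \<Rightarrow> complex option \<Rightarrow> complex" where
  "jump i p = (if p = Some i then 1 else 0)"

lemma deformation_jump:
  "snd (deformation_cocycle i \<rho>) p q x = mat2 0 (jump i q - jump i p) 0 0"
  by (auto simp: deformation_cocycle_def jump_def mat2_eq_iff)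

lemma fst_deformation:
  "fst (deformation_cocycle i \<rho>) p = (if p = Some i then Some ` ball i \<rho> else - {Some i})"
  by (simp add: deformation_cocycle_def)

text \<open>Where the cocycle is nonzero, the overlap lies in the punctured disc around
  \<open>i\<close>. By \<open>small_radius\<close> this contains no marked point, so no line
  restricts the constant matrix.\<close>

lemma deformation_cocycles:
  assumes "small_radius r s t i \<rho>"
  shows "deformation_cocycle i \<rho> \<in> sh.cocycles"
proof -
  have "openin P1 (- {Some i})"
  proof -
    have "{x. Some x \<in> - {Some i}} = - {i}" by auto
    then show ?thesis unfolding openin_P1_iff
      using eventually_not_equal_at_infinity[of i] by (simp add: open_Compl)
  qed
  then have op: "openin P1 (fst (deformation_cocycle i \<rho>) p)" for p
    by (simp add: fst_deformation)
  have mem: "p \<in> fst (deformation_cocycle i \<rho>) p" for p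
    using assms by (auto simp: fst_deformation small_radius_def)
  let ?U = "fst (deformation_cocycle i \<rho>)"
  have "snd (deformation_cocycle i \<rho>) p q \<in> F (?U p \<inter> ?U q)" for p q
  proof (cases "jump i p = jump i q")
    case True
    then have "snd (deformation_cocycle i \<rho>) p q = (\<lambda>x. 0)"
      by (intro ext) (simp add: deformation_jump mat2_eq_iff)
    then show ?thesis using op by (auto intro: zero_in_F)
  next
    case False
    then have sub: "?U p \<inter> ?U q \<subseteq> Some ` (ball i \<rho> - {i})"
      by (auto simp: fst_deformation jump_def split: if_splits)
    then have "None \<notin> ?U p \<inter> ?U q" by auto
    moreover have "W \<inter> (?U p \<inter> ?U q) = {}"
      using sub assms by (fastforce simp: marked_def small_radius_def)
    ultimately show ?thesis
      using openin_Int[OF op[of p] op[of q]] by (auto simp: F_iff deformation_jump forall_2)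
  qed
  then show ?thesis
    unfolding sh.cocycles_iff using op mem
    by (auto simp: point_cover_def deformation_jump mat2_eq_iff)
qed


definition deformation_comb :: "real \<Rightarrow> real \<Rightarrow> real \<Rightarrow> complex^3 \<Rightarrow> (complex option, complex^2^2) cech" where
  "deformation_comb \<rho>\<^sub>r \<rho>\<^sub>s \<rho>\<^sub>t k =
     sh.comb3 (deformation_cocycle r \<rho>\<^sub>r) (deformation_cocycle s \<rho>\<^sub>s) (deformation_cocycle t \<rho>\<^sub>t) k"

text \<open>The cochain of constants behind a linear combination of the three cocycles, in the role
  that \<open>jump\<close> has for one.\<close>

definition weight :: "complex^3 \<Rightarrow> complex option \<Rightarrow> complex" where
  "weight k p = k$1 * jump r p + k$2 * jump s p + k$3 * jump t p"

lemma snd_deformation_comb: "snd (deformation_comb \<rho>\<^sub>r \<rho>\<^sub>s \<rho>\<^sub>t k) p q x = mat2 0 (weight k q - weight k p) 0 0"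
  by (simp add: deformation_comb_def sh.snd_comb3 deformation_jump mat2_eq_iff weight_def algebra_simps)

lemma fst_deformation_comb: "fst (deformation_comb \<rho>\<^sub>r \<rho>\<^sub>s \<rho>\<^sub>t k) p = fst (deformation_cocycle r \<rho>\<^sub>r) p \<inter>
    fst (deformation_cocycle s \<rho>\<^sub>s) p \<inter> fst (deformation_cocycle t \<rho>\<^sub>t) p"
  by (simp add: deformation_comb_def sh.comb3_def)

lemma deformation_comb_cocycles:
  assumes "small_radius r s t r \<rho>\<^sub>r" "small_radius r s t s \<rho>\<^sub>s" "small_radius r s t t \<rho>\<^sub>t"
  shows "deformation_comb \<rho>\<^sub>r \<rho>\<^sub>s \<rho>\<^sub>t k \<in> sh.cocycles"
  unfolding deformation_comb_def using assms by (intro sh.comb3_cocycles deformation_cocycles)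

text \<open>
  Split the entries of the cocycle in \<open>H\<^sup>1(\<P>\<^sup>1, \<O>) = 0\<close>. The two free constants in the diagonal and
  the upper right entry make the splitting preserve the lines over \<open>0\<close> and \<open>1\<close>. The defects at
  \<open>r, s, t\<close> are, up to sign, the coefficients of the deformation cocycles.
\<close>

lemma deformations_generate:
  assumes small: "small_radius r s t r \<rho>\<^sub>r" "small_radius r s t s \<rho>\<^sub>s" "small_radius r s t t \<rho>\<^sub>t"
    and \<omega>: "\<omega> \<in> sh.cocycles"
  shows "\<exists>k. (\<omega>, deformation_comb \<rho>\<^sub>r \<rho>\<^sub>s \<rho>\<^sub>t k) \<in> sh.rel"
proof -
  define U where "U = fst \<omega>"
  define \<phi> where "\<phi> p q x = snd \<omega> p q (Some x)" for p q x
  have U: "openin P1 (U p)" "p \<in> U p" for p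
    using \<omega> by (auto simp: sh.cocycles_iff point_cover_def U_def)
  have \<omega>F: "snd \<omega> p q \<in> F (U p \<inter> U q)" for p q
    using \<omega> by (auto simp: sh.cocycles_iff U_def)
  have coc: "\<phi> p q x + \<phi> q m x = \<phi> p m x" if "Some x \<in> U p \<inter> U q \<inter> U m" for p q m x
    using \<omega> that by (auto simp: sh.cocycles_iff U_def \<phi>_def)
  note ent = F_entries[OF openin_Int[OF U(1) U(1)] \<omega>F, folded \<phi>_def]
  have O: "O_cocycle U (\<lambda>p q x. \<phi> p q x $ i $ j)" if "\<And>p q. hol_P1 (\<lambda>x. \<phi> p q x $ i $ j) (U p \<inter> U q)" for i j
  proof
    fix p q m x assume "Some x \<in> U p \<inter> U q \<inter> U m"
    from coc[OF this] show "\<phi> p q x $ i $ j + \<phi> q m x $ i $ j = \<phi> p m x $ i $ j"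
      by (metis vector_add_component)
  qed (use U that in auto)
  obtain a where a: "\<And>p. hol_P1 (a p) (U p)"
    "\<And>p q x. Some x \<in> U p \<inter> U q \<Longrightarrow> \<phi> p q x $ 1 $ 1 = a p x - a q x"
    using O_cocycle.H1_O_vanishes[OF O[OF ent(1)]] by blast
  obtain b where b: "\<And>p. hol_P1 (b p) (U p)"
    "\<And>p q x. Some x \<in> U p \<inter> U q \<Longrightarrow> \<phi> p q x $ 1 $ 2 = b p x - b q x"
    using O_cocycle.H1_O_vanishes[OF O[OF ent(2)]] by blast
  obtain c0 where c0: "\<And>p. hol_P1 (c0 p) (U p)"
    "\<And>p q x. Some x \<in> U p \<inter> U q \<Longrightarrow> \<phi> p q x $ 2 $ 1 = c0 p x - c0 q x"
    using O_cocycle.H1_O_vanishes[OF O[OF ent(3)]] by blast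
  obtain l where l: "(c0 None \<longlongrightarrow> l) at_infinity" using c0(1)[of None] U(2) by (auto simp: hol_P1_def)
  \<comment> \<open>The splitting in O loses the zero at infinity. One constant restores it on every
    member that contains infinity, because the entry of the cocycle has that zero, and subtracting
    it leaves the coboundary unchanged.\<close>
  define c where "c p x = c0 p x - l" for p x
  have c: "\<And>p. hol_P1 (c p) (U p)"
    "\<And>p q x. Some x \<in> U p \<inter> U q \<Longrightarrow> \<phi> p q x $ 2 $ 1 = c p x - c q x"
    unfolding c_def using c0 by (auto intro: hol_P1_diff hol_P1_const)
  have c_lim: "(c p \<longlongrightarrow> 0) at_infinity" if p: "None \<in> U p" for p
  proof -
    have "((\<lambda>x. c None x + \<phi> p None x $ 2 $ 1) \<longlongrightarrow> (l - l) + 0) at_infinity"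
      unfolding c_def using p U(2) by (intro tendsto_intros l ent(4)) auto
    moreover have "\<forall>\<^sub>F x in at_infinity. Some x \<in> U p \<inter> U None"
      using openin_Int[OF U(1) U(1), of p None] p U(2) unfolding openin_P1_iff by auto
    then have "\<forall>\<^sub>F x in at_infinity. c None x + \<phi> p None x $ 2 $ 1 = c p x"
      by (rule eventually_mono) (simp add: c(2))
    ultimately show ?thesis using Lim_transform_eventually by fastforce
  qed
  \<comment> \<open>Slope 0 over the point 0 leaves \<open>C\<close> as the only unknown in the
    condition there. Over 1 the slope is 1, and the condition is then linear in
    \<open>\<kappa>\<close> with coefficient 2.\<close>
  define C where "C = - b (Some 0) 0"
  define \<kappa> where "\<kappa> = (c (Some 1) 1 - b (Some 1) 1 - C) / 2 - a (Some 1) 1"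
  define defect where "defect p x = b p x + C + 2 * slope (Some x) * (a p x + \<kappa>) - (slope (Some x))\<^sup>2 * c p x" for p x
  \<comment> \<open>The cocycle preserves the line over \<open>x\<close>, so the expressions for two
    members agree: the defect is a number attached to the marked point.\<close>
  have defect_eq: "defect p x = defect q x" if "Some x \<in> U p \<inter> U q" "Some x \<in> W" for p q x
  proof -
    have "\<phi> p q x $ 1 $ 2 + 2 * slope (Some x) * \<phi> p q x $ 1 $ 1 - (slope (Some x))\<^sup>2 * \<phi> p q x $ 2 $ 1 = 0"
      using \<omega>F[of p q, unfolded F_iff[OF openin_Int[OF U(1) U(1)]]] that by (auto simp: \<phi>_def)
    then show ?thesis unfolding defect_def a(2)[OF that(1)] b(2)[OF that(1)] c(2)[OF that(1)]
      by (simp add: algebra_simps)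
  qed
  have d0: "defect p 0 = 0" if "Some 0 \<in> U p" for p
    using defect_eq[of 0 p "Some 0"] that U(2)[of "Some 0"] by (simp add: marked_def) (simp add: defect_def C_def)
  have d1: "defect p 1 = 0" if "Some 1 \<in> U p" for p
    using defect_eq[of 1 p "Some 1"] that U(2)[of "Some 1"]
    by (simp add: marked_def) (simp add: defect_def \<kappa>_def field_simps)
  define k :: "complex^3" where "k = vector [- defect (Some r) r, - defect (Some s) s, - defect (Some t) t]"
  have wk: "weight k (Some r) = - defect (Some r) r" "weight k (Some s) = - defect (Some s) s"
    "weight k (Some t) = - defect (Some t) t"
    using points by (auto simp: weight_def k_def jump_def vector_3)
  have wk0: "weight k p = 0" if "p \<noteq> Some r" "p \<noteq> Some s" "p \<noteq> Some t" for p
    using that by (simp add: weight_def jump_def)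
  let ?\<eta> = "deformation_comb \<rho>\<^sub>r \<rho>\<^sub>s \<rho>\<^sub>t k"
  have \<eta>: "?\<eta> \<in> sh.cocycles" using small by (rule deformation_comb_cocycles)
  define V where "V p = U p \<inter> fst ?\<eta> p" for p
  have V: "point_cover P1 V" unfolding V_def U_def
    using \<omega> \<eta> by (intro point_cover_Int) (auto simp: sh.cocycles_iff)
  have oV: "openin P1 (V p)" for p using V by (simp add: point_cover_def)
  \<comment> \<open>Each of \<open>r\<close>, \<open>s\<close>, \<open>t\<close> lies only in the
    member with its own index, so \<open>weight\<close> can cancel each defect separately. The
    smallness of the radii keeps \<open>weight\<close> at 0 on members that contain 0 or 1.\<close>
  have Vpt: "p = Some w" if "Some w \<in> V p" "w \<in> {r, s, t}" for p w
    using that by (auto simp: V_def fst_deformation_comb fst_deformation split: if_splits)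
  have V01: "weight k p = 0" if "Some w \<in> V p" "w \<in> {0, 1}" for p w
  proof (rule wk0)
    show "p \<noteq> Some r" "p \<noteq> Some s" "p \<noteq> Some t"
      using that points small
      by (auto simp: V_def fst_deformation_comb fst_deformation small_radius_def simp del: mem_ball)
  qed
  have "\<exists>g. g \<in> F (V p) \<and> (\<forall>x. g (Some x) = mat2 (a p x + \<kappa>) (b p x + C + weight k p) (c p x) (- (a p x + \<kappa>)))" for p
  proof (rule F_of_entries[OF oV])
    show "hol_P1 (\<lambda>x. a p x + \<kappa>) (V p)" "hol_P1 (\<lambda>x. b p x + C + weight k p) (V p)"
      by (intro hol_P1_add hol_P1_const; rule hol_P1_subset[OF a(1)] hol_P1_subset[OF b(1)]; simp add: V_def)+
    show "hol_P1 (c p) (V p)" by (rule hol_P1_subset[OF c(1)]) (simp add: V_def)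
    show "(c p \<longlongrightarrow> 0) at_infinity" if "None \<in> V p" using c_lim that by (simp add: V_def)
    fix x assume x: "Some x \<in> W \<inter> V p"
    have "weight k p = - defect p x"
    proof (cases "x \<in> {0, 1}")
      case True
      then show ?thesis using x V01[of x p] d0[of p] d1[of p] by (auto simp: V_def)
    next
      case False
      then have "x \<in> {r, s, t}" using x by (auto simp: marked_def)
      moreover have "p = Some x" using Vpt x calculation by blast
      ultimately show ?thesis using wk by auto
    qed
    then show "b p x + C + weight k p + 2 * slope (Some x) * (a p x + \<kappa>) - (slope (Some x))\<^sup>2 * c p x = 0"
      by (simp add: defect_def)
  qed blast
  then obtain g where g: "\<And>p. g p \<in> F (V p)"
    "\<And>p x. g p (Some x) = mat2 (a p x + \<kappa>) (b p x + C + weight k p) (c p x) (- (a p x + \<kappa>))"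
    by metis
  have eq: "snd \<omega> p q x - snd ?\<eta> p q x = g p x - g q x" if x: "x \<in> V p" "x \<in> V q" for p q x
  proof -
    let ?V = "V p \<inter> V q"
    have oVV: "openin P1 ?V" using oV by auto
    have A: "(\<lambda>x. snd \<omega> p q x - snd ?\<eta> p q x) \<in> F ?V"
    proof (intro sh.diff_mem oVV)
      show "snd \<omega> p q \<in> F ?V" by (rule F_subset[OF \<omega>F]) (auto simp: V_def)
      have "snd ?\<eta> p q \<in> F (fst ?\<eta> p \<inter> fst ?\<eta> q)" using \<eta> by (simp add: sh.cocycles_iff)
      then show "snd ?\<eta> p q \<in> F ?V" by (rule F_subset) (auto simp: V_def)
    qed
    have B: "(\<lambda>x. g p x - g q x) \<in> F ?V"
      using g(1)[of p] g(1)[of q] by (intro sh.diff_mem oVV) (auto elim!: F_subset)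
    have fin: "snd \<omega> p q (Some y) - snd ?\<eta> p q (Some y) = g p (Some y) - g q (Some y)" if y: "Some y \<in> ?V" for y
    proof -
      have U': "Some y \<in> U p \<inter> U q" using y by (auto simp: V_def)
      have "\<phi> p q y $ 2 $ 2 = - \<phi> p q y $ 1 $ 1"
        using \<omega>F[of p q, unfolded F_iff[OF openin_Int[OF U(1) U(1)]]] U' by (auto simp: \<phi>_def)
      then show ?thesis
        using a(2)[OF U'] b(2)[OF U'] c(2)[OF U']
        by (simp add: mat2_eq_iff g(2) snd_deformation_comb \<phi>_def[symmetric])
    qed
    show ?thesis
    proof (cases x)
      case None
      then show ?thesis using F_eq_at_infinity[OF oVV A B _ fin] x by simp
    next
      case (Some y)
      then show ?thesis using fin x by simp
    qed
  qed
  have "(\<omega>, ?\<eta>) \<in> sh.rel"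
    by (rule sh.relI[OF \<omega> \<eta> V, where g = g]) (use g(1) eq in \<open>auto simp: V_def U_def\<close>)
  then show ?thesis ..
qed

end

section \<open>The residue theorem on the projective line\<close>

lemma inverse_circlepath:
  assumes "\<rho> > 0"
  shows "inverse \<circ> circlepath 0 \<rho> = reversepath (circlepath 0 (1 / \<rho>))"
proof
  fix t :: real
  have "exp (2 * of_real pi * \<i> * of_real (1 - t)) = exp (2 * of_real pi * \<i>) * exp (- (2 * of_real pi * \<i> * of_real t))"
    by (simp only: exp_add[symmetric]) (rule arg_cong[where f = exp], simp add: algebra_simps)
  then show "(inverse \<circ> circlepath 0 \<rho>) t = reversepath (circlepath 0 (1 / \<rho>)) t"
    using assms by (simp add: circlepath reversepath_def exp_minus divide_inverse)
qed

text \<open>Substitution \<open>x = inverse u\<close>; the sign arises because inversion reverses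
  the orientation of circles around 0.\<close>

lemma contour_integral_form_inf:
  assumes "\<rho> > 0"
  shows "contour_integral (circlepath 0 \<rho>) (form_inf h) = - contour_integral (circlepath 0 (1 / \<rho>)) h"
proof -
  have "- contour_integral (circlepath 0 (1 / \<rho>)) h = contour_integral (inverse \<circ> circlepath 0 \<rho>) h"
    by (simp add: inverse_circlepath[OF assms] contour_integral_reversepath)
  also have "\<dots> = contour_integral (circlepath 0 \<rho>) (\<lambda>w. deriv inverse w * h (inverse w))"
    by (rule contour_integral_comp_analyticW[of _ "- {0}"])
      (use assms in \<open>auto intro!: analytic_intros\<close>)
  also have "\<dots> = contour_integral (circlepath 0 \<rho>) (form_inf h)"
  proof (rule contour_integral_eq)
    fix w assume "w \<in> path_image (circlepath 0 \<rho>)"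
    then have "w \<noteq> 0" using assms by auto
    then have "deriv inverse w = - (1 / w\<^sup>2)"
      by (intro DERIV_imp_deriv) (auto intro!: derivative_eq_intros simp: power2_eq_square divide_inverse)
    then show "deriv inverse w * h (inverse w) = form_inf h w" by (simp add: form_inf_def)
  qed
  finally show ?thesis by simp
qed

text \<open>Away from 0 the transformation \<open>form_inf\<close> is an involution, so regularity
  can be read in either chart.\<close>

lemma analytic_at_of_form_inf:
  assumes x0: "x \<noteq> 0" and "form_inf h analytic_on {inverse x}"
  shows "h analytic_on {x}"
proof -
  have "form_inf h analytic_on inverse ` {x}" using assms by simp
  then have "(form_inf h \<circ> inverse) analytic_on {x}"
    using x0 by (intro analytic_on_compose analytic_intros) auto
  then have "(\<lambda>x. - form_inf h (inverse x) / x\<^sup>2) analytic_on {x}"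
    using x0 by (intro analytic_intros) (auto simp: o_def)
  moreover have "\<forall>\<^sub>F y in nhds x. - form_inf h (inverse y) / y\<^sup>2 = h y"
  proof -
    have "\<forall>\<^sub>F y in nhds x. y \<noteq> 0" using x0 by (rule t1_space_nhds)
    then show ?thesis by eventually_elim (simp add: form_inf_def field_simps)
  qed
  ultimately show ?thesis
    using analytic_at_cong[of "\<lambda>x. - form_inf h (inverse x) / x\<^sup>2" h x x] by simp
qed

theorem sum_residues_P1_eq_0:
  assumes h: "h meromorphic_on UNIV" and hinf: "form_inf h meromorphic_on {0}"
    and S: "finite S" "\<And>p. form_residue h p \<noteq> 0 \<Longrightarrow> p \<in> S"
  shows "(\<Sum>p\<in>S. form_residue h p) = 0"
proof -
  obtain e where e: "e > 0" "form_inf h analytic_on ball 0 e - {0}"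
    using hinf unfolding meromorphic_at_iff isolated_singularity_at_def by blast
  define sing where "sing = {z. \<not> h analytic_on {z}}"
  have out: "h analytic_on {x}" if x: "norm x > 1 / e" for x
  proof (rule analytic_at_of_form_inf)
    show x0: "x \<noteq> 0" using x e(1) by auto
    have "inverse (norm x) < e" using x x0 e(1) by (simp add: field_simps)
    then have "inverse x \<in> ball 0 e - {0}" using x0 by (simp add: norm_inverse)
    then show "form_inf h analytic_on {inverse x}" using e(2) by (auto intro: analytic_on_subset)
  qed
  have sub: "sing \<subseteq> cball 0 (1 / e)" using out by (force simp: sing_def not_less)
  have "sing sparse_in UNIV"
    unfolding sing_def using meromorphic_on_imp_sparse_singularities[OF h] by simp
  then have "finite (cball 0 (1 / e) \<inter> sing)"
    by (intro sparse_in_compact_finite) (auto intro: sparse_in_subset)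
  then have fin: "finite sing" using sub by (simp add: Int_absorb1)
  have hol: "h holomorphic_on - sing"
  proof -
    have "h analytic_on - sing" unfolding sing_def by (subst analytic_on_analytic_at) auto
    then show ?thesis by (rule analytic_imp_holomorphic)
  qed
  \<comment> \<open>All singularities have modulus at most \<open>1 / e\<close>, so a strictly
    larger radius keeps the circle off them and maps it into the punctured disc of radius
    \<open>e\<close> under inversion.\<close>
  define R where "R = 1 / e + 1"
  have R: "R > 0" "R > 1 / e" using e(1) by (auto simp: R_def intro: add_pos_pos)
  have norm_sing: "norm z < R" if "z \<in> sing" for z using that sub R(2) by auto
  have "contour_integral (circlepath 0 R) h = 2 * pi * \<i> * (\<Sum>p\<in>sing. winding_number (circlepath 0 R) p * residue h p)"
  proof (rule Residue_theorem[of UNIV])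
    show "path_image (circlepath 0 R) \<subseteq> UNIV - sing"
    proof
      fix z assume "z \<in> path_image (circlepath 0 R)"
      then have "\<not> norm z < R" using R(1) by simp
      then show "z \<in> UNIV - sing" using norm_sing by blast
    qed
    show "h holomorphic_on UNIV - sing" using hol by (simp only: Compl_eq_Diff_UNIV)
    show "\<forall>z. z \<notin> UNIV \<longrightarrow> winding_number (circlepath 0 R) z = 0" by simp
  qed (rule open_UNIV connected_UNIV fin valid_path_circlepath | simp)+
  also have "(\<Sum>p\<in>sing. winding_number (circlepath 0 R) p * residue h p) = (\<Sum>p\<in>sing. residue h p)"
    by (intro sum.cong refl) (simp add: winding_number_circlepath norm_sing)
  finally have 1: "contour_integral (circlepath 0 R) h = 2 * pi * \<i> * (\<Sum>p\<in>sing. residue h p)" .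
  have "(form_inf h has_contour_integral 2 * pi * \<i> * residue (form_inf h) 0) (circlepath 0 (1 / R))"
  proof (rule base_residue[of "ball 0 e"])
    have "1 < R * e" using R(2) unfolding pos_divide_less_eq[OF e(1)] .
    then have "1 / R < e" unfolding pos_divide_less_eq[OF R(1)] by (simp only: mult.commute)
    show "cball 0 (1 / R) \<subseteq> ball (0::complex) e"
    proof (rule subsetI)
      fix z :: complex assume "z \<in> cball 0 (1 / R)"
      then have "norm z \<le> 1 / R" unfolding mem_cball dist_0_norm .
      also note \<open>1 / R < e\<close>
      finally show "z \<in> ball 0 e" unfolding mem_ball dist_0_norm .
    qed
    show "form_inf h holomorphic_on ball 0 e - {0}" using e(2) by (rule analytic_imp_holomorphic)
  qed (use e(1) R(1) in simp_all)
  then have "2 * pi * \<i> * residue (form_inf h) 0 = contour_integral (circlepath 0 (1 / R)) (form_inf h)"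
    by (rule contour_integral_unique[symmetric])
  also have "\<dots> = - contour_integral (circlepath 0 (1 / (1 / R))) h"
    by (rule contour_integral_form_inf) (use R(1) in simp)
  also have "1 / (1 / R) = R" by simp
  finally have "2 * pi * \<i> * residue (form_inf h) 0 + 2 * pi * \<i> * (\<Sum>p\<in>sing. residue h p) = 0"
    unfolding 1 by (simp only: ab_left_minus)
  then have "2 * pi * \<i> * ((\<Sum>p\<in>sing. residue h p) + residue (form_inf h) 0) = 0"
    by (simp only: distrib_left add.commute)
  then have 2: "(\<Sum>p\<in>sing. residue h p) + residue (form_inf h) 0 = 0"
    unfolding mult_eq_0_iff by simp
  let ?T = "insert None (Some ` sing)"
  have "form_residue h p = 0" if "p \<notin> ?T" for p
  proof (cases p)
    case (Some x)
    then have "h analytic_on {x}" using that by (auto simp: sing_def)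
    then obtain A where "open A" "x \<in> A" "h holomorphic_on A" unfolding analytic_at by blast
    then have "residue h x = 0" by (rule residue_holo)
    then show ?thesis using Some by (simp add: form_residue_def)
  qed (use that in auto)
  note T = this
  have "(\<Sum>p\<in>S. form_residue h p) = (\<Sum>p\<in>S \<union> ?T. form_residue h p)"
    by (rule sum.mono_neutral_left) (use S fin in blast)+
  also have "\<dots> = (\<Sum>p\<in>?T. form_residue h p)"
    by (rule sum.mono_neutral_right) (use S(1) fin T in blast)+
  also have "\<dots> = residue (form_inf h) 0 + (\<Sum>p\<in>sing. residue h p)"
    using fin by (simp add: sum.reindex form_residue_def)
  also have "\<dots> = 0" using 2 by (simp only: add.commute)
  finally show ?thesis .
qed

section \<open>Meromorphic forms in the two charts\<close>

lemma residue_diff_meromorphic: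
  assumes "f meromorphic_on {z}" "g meromorphic_on {z}"
  shows "residue (\<lambda>x. f x - g x) z = residue f z - residue g z"
proof -
  obtain d where d: "d > 0" "f analytic_on ball z d - {z}"
    using assms(1) unfolding meromorphic_at_iff isolated_singularity_at_def by blast
  obtain e where e: "e > 0" "g analytic_on ball z e - {z}"
    using assms(2) unfolding meromorphic_at_iff isolated_singularity_at_def by blast
  have f: "f analytic_on ball z (min d e) - {z}" by (rule analytic_on_subset[OF d(2)]) auto
  have g: "g analytic_on ball z (min d e) - {z}" by (rule analytic_on_subset[OF e(2)]) auto
  show ?thesis
    by (rule residue_diff[OF open_ball _ analytic_imp_holomorphic[OF f] analytic_imp_holomorphic[OF g]])
      (simp add: d e)
qed

text \<open>The limit says that the pole is at most simple; the case \<open>c = 0\<close> is a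
  removable singularity.\<close>

lemma residue_eq_limit:
  assumes "f meromorphic_on {z}" "((\<lambda>x. (x - z) * f x) \<longlongrightarrow> c) (at z)"
  shows "residue f z = c"
proof -
  obtain d where d: "d > 0" "f analytic_on ball z d - {z}"
    using assms(1) unfolding meromorphic_at_iff isolated_singularity_at_def by blast
  have lim: "((\<lambda>x. f x * (x - z)) \<longlongrightarrow> c) (at z)" using assms(2) by (simp add: mult.commute)
  show ?thesis
    by (rule residue_simple'[OF open_ball _ analytic_imp_holomorphic[OF d(2)] lim]) (simp add: d)
qed

lemma meromorphic_on_at: "f meromorphic_on A \<Longrightarrow> z \<in> A \<Longrightarrow> f meromorphic_on {z}"
  by (erule meromorphic_on_subset) simp

lemma meromorphic_at_cong:
  assumes "\<forall>\<^sub>F x in at z. f x = g x" "f meromorphic_on {z}"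
  shows "g meromorphic_on {z}"
proof -
  have "f meromorphic_on {z} \<longleftrightarrow> g meromorphic_on {z}"
  proof (rule meromorphic_on_cong)
    show "\<forall>\<^sub>F x in at w. f x = g x" if "w \<in> {z}" for w using that assms(1) by simp
  qed (rule refl)
  with assms(2) show ?thesis by (rule iffD1[rotated])
qed

lemma meromorphic_form_onD:
  assumes "meromorphic_form_on f U"
  shows "Some x \<in> U \<Longrightarrow> f meromorphic_on {x}" "None \<in> U \<Longrightarrow> form_inf f meromorphic_on {0}"
  using assms meromorphic_on_at[of f "{x. Some x \<in> U}" x]
    meromorphic_on_at[of "form_inf f" "{u. chart_inf u \<in> U}" 0]
  by (simp_all add: meromorphic_form_on_def chart_inf_def)

lemma form_inf_meromorphic_at:
  assumes "f meromorphic_on {inverse u}" "u \<noteq> 0"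
  shows "form_inf f meromorphic_on {u}"
proof -
  have "(\<lambda>u. f (inverse u)) meromorphic_on {u}"
    by (rule meromorphic_on_compose[OF assms(1)]) (use assms(2) in \<open>auto intro!: analytic_intros\<close>)
  from meromorphic_on_divide[OF meromorphic_on_uminus[OF this] meromorphic_on_power[OF meromorphic_on_id]]
  show ?thesis unfolding form_inf_def .
qed

lemma meromorphic_form_onI:
  assumes "\<And>x. Some x \<in> U \<Longrightarrow> f meromorphic_on {x}" "None \<in> U \<Longrightarrow> form_inf f meromorphic_on {0}"
  shows "meromorphic_form_on f U"
  unfolding meromorphic_form_on_def
proof
  show "f meromorphic_on {x. Some x \<in> U}"
    by (subst meromorphic_on_meromorphic_at) (use assms in auto)
  have "form_inf f meromorphic_on {u}" if u: "chart_inf u \<in> U" for u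
  proof (cases "u = 0")
    case True
    then show ?thesis using u assms(2) by (simp add: chart_inf_def)
  next
    case False
    then show ?thesis using u assms(1) by (simp add: chart_inf_def form_inf_meromorphic_at)
  qed
  then show "form_inf f meromorphic_on {u. chart_inf u \<in> U}"
    by (subst meromorphic_on_meromorphic_at) auto
qed

lemma form_inf_diff: "form_inf (\<lambda>x. f x - g x) = (\<lambda>u. form_inf f u - form_inf g u)"
  by (auto simp: form_inf_def diff_divide_distrib)

lemma meromorphic_form_on_diff:
  "meromorphic_form_on f U \<Longrightarrow> meromorphic_form_on g U \<Longrightarrow> meromorphic_form_on (\<lambda>x. f x - g x) U"
  by (auto simp: meromorphic_form_on_def form_inf_diff intro: meromorphic_on_diff)

lemma meromorphic_form_on_subset: "meromorphic_form_on f V \<Longrightarrow> U \<subseteq> V \<Longrightarrow> meromorphic_form_on f U"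
  by (rule meromorphic_form_onI) (use meromorphic_form_onD[of f V] in blast)+

lemma form_residue_diff:
  assumes "meromorphic_form_on f U" "meromorphic_form_on g U" "p \<in> U"
  shows "form_residue (\<lambda>x. f x - g x) p = form_residue f p - form_residue g p"
proof (cases p)
  case None
  then show ?thesis
    using residue_diff_meromorphic[OF meromorphic_form_onD(2)[OF assms(1)] meromorphic_form_onD(2)[OF assms(2)]] assms(3)
    by (simp add: form_residue_def form_inf_diff)
next
  case (Some x)
  then show ?thesis
    using residue_diff_meromorphic[OF meromorphic_form_onD(1)[OF assms(1)] meromorphic_form_onD(1)[OF assms(2)]] assms(3)
    by (simp add: form_residue_def)
qed

text \<open>
  Removing the singularities normalises the values, so that local forms which agree up to a
  discrete set glue to a function on all of \<open>\<complex>\<close>.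
\<close>

lemma sum_residues_glued_eq_0:
  assumes V: "point_cover P1 V" and D: "\<And>p. meromorphic_form_on (D p) (V p)"
    and eq: "\<And>p q x. Some x \<in> V p \<inter> V q \<Longrightarrow> \<forall>\<^sub>F y in at x. D p y = D q y"
    and S: "finite S" "\<And>p. form_residue (D p) p \<noteq> 0 \<Longrightarrow> p \<in> S"
  shows "(\<Sum>p\<in>S. form_residue (D p) p) = 0"
proof -
  define h where "h y = remove_sings (D (Some y)) y" for y
  have V': "openin P1 (V p)" "p \<in> V p" for p using V by (auto simp: point_cover_def)
  note mero = meromorphic_form_onD[OF D]
  have h: "h y = remove_sings (D p) y" if "Some y \<in> V p" for p y
    unfolding h_def by (rule remove_sings_cong[OF eq refl]) (use that V'(2) in simp)
  have near: "\<forall>\<^sub>F w in at y. D (Some y) w = h w" for y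
  proof -
    have "\<forall>\<^sub>F w in nhds y. w \<in> {w. Some w \<in> V (Some y)}"
      using V'[of "Some y"] by (intro eventually_nhds_in_open) (auto simp: openin_P1_iff)
    then have "\<forall>\<^sub>F w in at y. Some w \<in> V (Some y)"
      unfolding eventually_at_filter by (rule eventually_mono) simp
    moreover have "\<forall>\<^sub>F w in at y. remove_sings (D (Some y)) w = D (Some y) w"
      using mero(1)[OF V'(2)] by (intro eventually_remove_sings_eq_at) (simp add: meromorphic_at_iff)
    ultimately show ?thesis by eventually_elim (simp add: h)
  qed
  \<comment> \<open>Close to infinity \<open>D None\<close> is analytic at every finite point, so
    removing singularities changes none of its values there.\<close>
  have near_inf: "\<forall>\<^sub>F u in at 0. form_inf (D None) u = form_inf h u"
  proof -
    have "\<forall>\<^sub>F x in at_infinity. Some x \<in> V None" using V'[of None] by (auto simp: openin_P1_iff)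
    then have "\<forall>\<^sub>F u in at 0. Some (inverse u) \<in> V None"
      by (simp add: at_to_infinity eventually_filtermap)
    moreover obtain e where e: "e > 0" "form_inf (D None) analytic_on ball 0 e - {0}"
      using mero(2)[OF V'(2)] unfolding meromorphic_at_iff isolated_singularity_at_def by blast
    have "\<forall>\<^sub>F u in at 0. u \<in> ball 0 e - {0}" using e(1) by (intro eventually_at_in_open) auto
    ultimately show ?thesis
    proof eventually_elim
      case (elim u)
      have "D None analytic_on {inverse u}"
        by (rule analytic_at_of_form_inf) (use elim in \<open>auto intro: analytic_on_subset[OF e(2)]\<close>)
      then show ?case using h[OF elim(1)] by (simp add: form_inf_def)
    qed
  qed
  have res: "form_residue (D p) p = form_residue h p" for p
  proof (cases p)
    case None
    then show ?thesis using residue_cong[OF near_inf refl] by (simp add: form_residue_def)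
  next
    case (Some y)
    then show ?thesis using residue_cong[OF near[of y] refl] by (simp add: form_residue_def)
  qed
  have "h meromorphic_on {y}" for y
    using meromorphic_at_cong[OF near mero(1)[OF V'(2)]] .
  then have "h meromorphic_on UNIV" by (subst meromorphic_on_meromorphic_at) auto
  moreover have "form_inf h meromorphic_on {0}"
    using meromorphic_at_cong[OF near_inf mero(2)[OF V'(2)]] .
  ultimately show ?thesis using S unfolding res by (rule sum_residues_P1_eq_0)
qed

section \<open>The Serre pairing\<close>

text \<open>The residue of a simple pole is the value at \<open>z\<close> of the analytic factor
  \<open>g\<close>, hence a limit. In this form residues pass through the sums and products of
  matrix entries.\<close>

lemma log_pole_at_limit:
  assumes "log_pole_at A z"
  shows "(\<lambda>x. A x $ i $ j) meromorphic_on {z}"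
    and "((\<lambda>x. (x - z) * A x $ i $ j) \<longlongrightarrow> residue_matrix A z $ i $ j) (at z)"
proof -
  obtain g where g: "g analytic_on {z}" "\<forall>\<^sub>F x in at z. (x - z) * A x $ i $ j = g x"
    using assms unfolding log_pole_at_def by blast
  have "(\<lambda>x. g x / (x - z)) meromorphic_on {z}"
    by (intro meromorphic_on_divide meromorphic_on_diff meromorphic_on_id meromorphic_on_const
        analytic_on_imp_meromorphic_on g)
  moreover have "\<forall>\<^sub>F x in at z. g x / (x - z) = A x $ i $ j"
    using g(2) eventually_neq_at_within[of z z UNIV] by eventually_elim (auto simp: field_simps)
  ultimately show mero: "(\<lambda>x. A x $ i $ j) meromorphic_on {z}" by (rule meromorphic_at_cong[rotated])
  have "(g \<longlongrightarrow> g z) (at z)" using analytic_at_imp_isCont[OF g(1)] by (rule isContD)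
  then have lim: "((\<lambda>x. (x - z) * A x $ i $ j) \<longlongrightarrow> g z) (at z)"
    by (rule Lim_transform_eventually) (use g(2) in \<open>auto elim: eventually_mono\<close>)
  then have "residue (\<lambda>x. A x $ i $ j) z = g z" by (rule residue_eq_limit[OF mero])
  with lim show "((\<lambda>x. (x - z) * A x $ i $ j) \<longlongrightarrow> residue_matrix A z $ i $ j) (at z)"
    by (simp add: residue_matrix_def)
qed

lemma trace_residue_matrix:
  assumes "log_pole_at A z" "\<forall>\<^sub>F x in at z. trace (A x) = 0"
  shows "trace (residue_matrix A z) = 0"
proof -
  note lim = tendsto_add[OF log_pole_at_limit(2)[OF assms(1), of 1 1] log_pole_at_limit(2)[OF assms(1), of 2 2]]
  have "\<forall>\<^sub>F x in at z. (x - z) * A x $ 1 $ 1 + (x - z) * A x $ 2 $ 2 = 0"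
    using assms(2) by eventually_elim (simp add: trace_2 flip: distrib_left)
  from Lim_transform_eventually[OF lim this] show ?thesis
    by (simp add: tendsto_const_iff trace_2)
qed

text \<open>The nilpotent matrices whose kernel contains the line of slope \<open>z\<close>.\<close>

definition nilp :: "complex \<Rightarrow> complex \<Rightarrow> complex^2^2" where
  "nilp z q = mat2 (- q * z) (q * z\<^sup>2) (- q) (q * z)"

lemma nilp_nth [simp]: "nilp z q $ 1 $ 1 = - q * z" "nilp z q $ 1 $ 2 = q * z\<^sup>2"
  "nilp z q $ 2 $ 1 = - q" "nilp z q $ 2 $ 2 = q * z"
  by (simp_all add: nilp_def)

text \<open>Being zero or conjugate to a fixed nilpotent matrix is not a linear condition. With
  trace 0 and a prescribed kernel line it becomes one: killing \<open>vector [z, 1]\<close> leaves a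
  single free parameter \<open>q\<close>, and \<open>q = 0\<close> is the zero matrix. This is why
  the apparent fields form a vector space.\<close>

lemma apparent_residue_line:
  assumes "trace N = 0"
  shows "apparent_residue N {v. v$1 = z * v$2} \<longleftrightarrow> (\<exists>q. N = nilp z q)"
proof
  assume ap: "apparent_residue N {v. v$1 = z * v$2}"
  show "\<exists>q. N = nilp z q"
  proof (cases "N = 0")
    case True
    then show ?thesis by (intro exI[of _ 0]) (simp add: mat2_eq_iff)
  next
    case False
    then have "{v. N *v v = 0} = {v. v$1 = z * v$2}" using ap by (simp add: apparent_residue_def)
    moreover have "vector [z, 1] \<in> {v :: complex^2. v$1 = z * v$2}" by simp
    ultimately have "N *v vector [z, 1] = 0" by blast
    then have 1: "N$1$1 * z + N$1$2 = 0" and 2: "N$2$1 * z + N$2$2 = 0"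
      by (simp_all add: vec_eq_iff forall_2 matrix_vector_mult_def sum_2)
    have "N$1$1 = - N$2$2" using assms by (simp add: trace_2 add_eq_0_iff)
    moreover have N22: "N$2$2 = - (N$2$1 * z)" using 2 by (simp add: add_eq_0_iff2)
    ultimately have N11: "N$1$1 = N$2$1 * z" by simp
    have "N$1$2 = - (N$1$1 * z)" using 1 by (simp add: add_eq_0_iff)
    with N11 N22 show ?thesis
      by (intro exI[of _ "- N$2$1"]) (simp add: mat2_eq_iff power2_eq_square)
  qed
next
  assume "\<exists>q. N = nilp z q"
  then obtain q where N: "N = nilp z q" ..
  show "apparent_residue N {v. v$1 = z * v$2}"
  proof (cases "q = 0")
    case True
    then have "N = 0" by (simp add: N mat2_eq_iff)
    then show ?thesis by (simp add: apparent_residue_def)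
  next
    case False
    \<comment> \<open>The columns of \<open>P\<close> are the first unit vector and its image under
      \<open>N\<close>, a basis in which \<open>N\<close> takes its normal form; \<open>Q\<close> is
      the inverse of \<open>P\<close>.\<close>
    define P Q where "P = mat2 1 (- q * z) 0 (- q)" and "Q = mat2 1 (- z) 0 (- 1 / q)"
    have PQ: "P ** Q = mat 1" "Q ** P = mat 1"
      using False by (simp_all add: P_def Q_def mat2_eq_iff matrix_mult_2_nth mat_def)
    then have "invertible P" unfolding invertible_def by blast
    moreover have "N = P ** mat2 0 0 1 0 ** matrix_inv P"
      unfolding matrix_inv_eqI[OF PQ]
      using False by (simp add: N P_def Q_def mat2_eq_iff matrix_mult_2_nth power2_eq_square)
    moreover have "N *v v = 0 \<longleftrightarrow> v$1 = z * v$2" for v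
    proof -
      have "N *v v = 0 \<longleftrightarrow> q * z * (v$1 - z * v$2) = 0 \<and> q * (v$1 - z * v$2) = 0"
        by (simp add: N vec_eq_iff forall_2 matrix_vector_mult_def sum_2 algebra_simps power2_eq_square) auto
      then show ?thesis using False by auto
    qed
    ultimately show ?thesis unfolding apparent_residue_def by blast
  qed
qed

lemma higgs_inf_eq:
  assumes "u \<noteq> 0"
  shows "higgs_inf \<Theta> u = (let B = \<Theta> (inverse u) in
    mscale (- 1 / u\<^sup>2) (mat2 (B$1$1) (u * B$1$2) (B$2$1 / u) (B$2$2)))"
  using assms by (simp add: higgs_inf_def conj_to_inf Let_def)

text \<open>Against a nilpotent residue along the line of slope \<open>Z\<close>, the trace of the
  product is \<open>- q\<close> times the expression that measures whether \<open>B z\<close> moves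
  this line.\<close>

lemma trace_mult_residue:
  assumes B: "\<And>i j. (\<lambda>x. B x $ i $ j) analytic_on {z}" and T: "log_pole_at T z"
    and res: "residue_matrix T z = nilp Z q" and B0: "B z $ 2 $ 2 = - B z $ 1 $ 1"
    "B z $ 1 $ 2 + 2 * Z * B z $ 1 $ 1 - Z\<^sup>2 * B z $ 2 $ 1 = 0"
    and f: "\<forall>\<^sub>F x in at z. trace (B x ** T x) = f x"
  shows "f meromorphic_on {z}" "residue f z = 0"
proof -
  have eq: "trace (B x ** T x) = B x $1$1 * T x $1$1 + B x $1$2 * T x $2$1
      + (B x $2$1 * T x $1$2 + B x $2$2 * T x $2$2)" for x
    by (simp add: trace_2 matrix_mult_2_nth)
  have mero: "(\<lambda>x. trace (B x ** T x)) meromorphic_on {z}"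
    unfolding eq
    by (intro meromorphic_on_add meromorphic_on_mult analytic_on_imp_meromorphic_on[OF B]
        log_pole_at_limit(1)[OF T])
  then show fm: "f meromorphic_on {z}" by (rule meromorphic_at_cong[OF f])
  have Blim: "((\<lambda>x. B x $ i $ j) \<longlongrightarrow> B z $ i $ j) (at z)" for i j
    using analytic_at_imp_isCont[OF B] by (rule isContD)
  note Tlim = log_pole_at_limit(2)[OF T, unfolded res]
  have "((\<lambda>x. B x $1$1 * ((x - z) * T x $1$1) + B x $1$2 * ((x - z) * T x $2$1)
      + (B x $2$1 * ((x - z) * T x $1$2) + B x $2$2 * ((x - z) * T x $2$2))) \<longlongrightarrow>
    B z $1$1 * nilp Z q $1$1 + B z $1$2 * nilp Z q $2$1
      + (B z $2$1 * nilp Z q $1$2 + B z $2$2 * nilp Z q $2$2)) (at z)"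
    by (intro tendsto_add tendsto_mult[OF Blim Tlim])
  moreover have "B z $1$1 * nilp Z q $1$1 + B z $1$2 * nilp Z q $2$1
      + (B z $2$1 * nilp Z q $1$2 + B z $2$2 * nilp Z q $2$2) =
      - q * (B z $ 1 $ 2 + 2 * Z * B z $ 1 $ 1 - Z\<^sup>2 * B z $ 2 $ 1)"
    by (simp add: B0(1) algebra_simps)
  moreover have "B x $1$1 * ((x - z) * T x $1$1) + B x $1$2 * ((x - z) * T x $2$1)
      + (B x $2$1 * ((x - z) * T x $1$2) + B x $2$2 * ((x - z) * T x $2$2)) = (x - z) * trace (B x ** T x)" for x
    unfolding eq by (simp add: algebra_simps)
  ultimately have "((\<lambda>x. (x - z) * trace (B x ** T x)) \<longlongrightarrow> 0) (at z)"
    unfolding B0(2) by simp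
  then have "residue (\<lambda>x. trace (B x ** T x)) z = 0" by (rule residue_eq_limit[OF mero])
  then show "residue f z = 0" using residue_cong[OF f refl] by simp
qed

lemma trace_diff_mult: "trace ((A - B) ** T) = trace (A ** T) - trace (B ** T)" for A B T :: "complex^2^2"
  by (simp add: trace_2 matrix_mult_2_nth algebra_simps)

section \<open>Apparent fields paired with sections and cocycles\<close>

context parabolic_data
begin

abbreviation "Higgs \<equiv> cs_carrier (H0_apparent r s t R S T)"

lemma Higgs_iff:
  "\<Theta> \<in> Higgs \<longleftrightarrow> \<Theta> \<in> log_higgs_fields W line \<and> (\<forall>w\<in>W. apparent_residue (higgs_residue \<Theta> w) (line w))"
  by (simp add: H0_apparent_def apparent_higgs_def)

lemma Some_notin_W: "Some x \<notin> W \<longleftrightarrow> x \<in> - {0, 1, r, s, t}"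
  by (auto simp: marked_def)

lemma open_unmarked: "open {x. Some x \<notin> W}"
  unfolding Some_notin_W Collect_mem_eq by (intro open_Compl finite_imp_closed) simp

lemma Higgs_trace: "\<Theta> \<in> Higgs \<Longrightarrow> trace (\<Theta> x) = 0"
  by (simp add: Higgs_iff log_higgs_fields_def)

lemma Higgs_log_pole:
  assumes "\<Theta> \<in> Higgs"
  shows "Some x \<in> W \<Longrightarrow> log_pole_at \<Theta> x" "log_pole_at (higgs_inf \<Theta>) 0"
  using assms by (simp_all add: Higgs_iff log_higgs_fields_def)

lemma trace_higgs_inf: "u \<noteq> 0 \<Longrightarrow> trace (\<Theta> (inverse u)) = 0 \<Longrightarrow> trace (higgs_inf \<Theta> u) = 0"
  by (auto simp: higgs_inf_eq Let_def trace_2 add_eq_0_iff)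

lemma trace_higgs_residue:
  assumes \<Theta>: "\<And>x. trace (\<Theta> x) = 0" "\<And>x. Some x \<in> W \<Longrightarrow> log_pole_at \<Theta> x" "log_pole_at (higgs_inf \<Theta>) 0"
    and "w \<in> W"
  shows "trace (higgs_residue \<Theta> w) = 0"
proof (cases w)
  case None
  have "\<forall>\<^sub>F u in at 0. trace (higgs_inf \<Theta> u) = 0"
    using eventually_neq_at_within[of 0 0 UNIV] by eventually_elim (simp add: trace_higgs_inf \<Theta>(1))
  then show ?thesis using trace_residue_matrix[OF \<Theta>(3)] None by (simp add: higgs_residue_def)
next
  case (Some x)
  then show ?thesis
    using trace_residue_matrix[OF \<Theta>(2)] assms(4) by (simp add: higgs_residue_def \<Theta>(1))
qed

lemma Higgs_residue:
  assumes \<Theta>: "\<Theta> \<in> Higgs" and "w \<in> W"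
  obtains q where "higgs_residue \<Theta> w = nilp (slope w) q"
proof -
  have tr: "trace (higgs_residue \<Theta> w) = 0"
    by (rule trace_higgs_residue[OF Higgs_trace[OF \<Theta>] Higgs_log_pole[OF \<Theta>] assms(2)])
  have "apparent_residue (higgs_residue \<Theta> w) (line w)" using assms by (simp add: Higgs_iff)
  then have "\<exists>q. higgs_residue \<Theta> w = nilp (slope w) q"
    unfolding line_eq apparent_residue_line[OF tr] .
  then show thesis using that by blast
qed

lemma Higgs_analytic:
  assumes "\<Theta> \<in> Higgs" "Some x \<notin> W"
  shows "(\<lambda>x. \<Theta> x $ i $ j) analytic_on {x}"
proof -
  have "(\<lambda>x. \<Theta> x $ i $ j) holomorphic_on {x. Some x \<notin> W}"
    using assms(1) by (simp add: Higgs_iff log_higgs_fields_def holomorphic_matrix_on_def)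
  then show ?thesis using assms(2) open_unmarked by (auto simp: analytic_at)
qed

lemma Higgs_meromorphic:
  assumes "\<Theta> \<in> Higgs" shows "(\<lambda>x. \<Theta> x $ i $ j) meromorphic_on {x}"
proof (cases "Some x \<in> W")
  case True
  then show ?thesis by (rule log_pole_at_limit(1)[OF Higgs_log_pole(1)[OF assms]])
next
  case False
  then show ?thesis by (rule analytic_on_imp_meromorphic_on[OF Higgs_analytic[OF assms]])
qed

lemma F_analytic:
  assumes "openin P1 V" "g \<in> F V"
  shows "Some x \<in> V \<Longrightarrow> (\<lambda>x. g (Some x) $ i $ j) analytic_on {x}"
    and "None \<in> V \<Longrightarrow> (\<lambda>u. endo_inf g u $ i $ j) analytic_on {0}"
proof -
  have "open {x. Some x \<in> V}" using assms(1) by (simp add: openin_P1_iff)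
  moreover have "(\<lambda>x. g (Some x) $ i $ j) holomorphic_on {x. Some x \<in> V}"
    using assms(2) by (simp add: sl_sheaf_def holomorphic_endo_on_def holomorphic_matrix_on_def)
  ultimately show "(\<lambda>x. g (Some x) $ i $ j) analytic_on {x}" if "Some x \<in> V"
    using that unfolding analytic_at by blast
  have "(\<lambda>x. endo_inf g x $ i $ j) holomorphic_on {u. chart_inf u \<in> V}"
    using assms(2) by (simp add: sl_sheaf_def holomorphic_endo_on_def holomorphic_matrix_on_def)
  then show "(\<lambda>u. endo_inf g u $ i $ j) analytic_on {0}" if "None \<in> V"
    using that open_chart_inf[OF assms(1)] unfolding analytic_at by (auto simp: chart_inf_def)
qed

text \<open>This makes coboundaries pair to 0. The trace is invariant under the change of frame, so
  over infinity the argument applies to \<open>endo_inf g\<close> and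
  \<open>higgs_inf \<Theta>\<close>.\<close>

lemma trace_form:
  assumes \<Theta>: "\<Theta> \<in> Higgs" and V: "openin P1 V" and g: "g \<in> F V"
  defines "f \<equiv> \<lambda>y. trace (g (Some y) ** \<Theta> y)"
  shows "meromorphic_form_on f V" and "p \<in> V \<Longrightarrow> form_residue f p = 0"
proof -
  note g' = g[unfolded F_iff[OF V]]
  have tr: "g p $ 2 $ 2 = - g p $ 1 $ 1" if "p \<in> V" for p using g' that by blast
  have pl: "g w $ 1 $ 2 + 2 * slope w * g w $ 1 $ 1 - (slope w)\<^sup>2 * g w $ 2 $ 1 = 0"
    if "w \<in> W" "w \<in> V" for w using g' that by blast
  have fin: "f meromorphic_on {x} \<and> residue f x = 0" if x: "Some x \<in> V" for x
  proof (cases "Some x \<in> W")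
    case True
    obtain q where "higgs_residue \<Theta> (Some x) = nilp (slope (Some x)) q" by (rule Higgs_residue[OF \<Theta> True])
    then have q: "residue_matrix \<Theta> x = nilp (slope (Some x)) q" by (simp add: higgs_residue_def)
    have ev: "\<forall>\<^sub>F y in at x. trace (g (Some y) ** \<Theta> y) = f y" by (simp add: f_def)
    from trace_mult_residue[OF F_analytic(1)[OF V g x] Higgs_log_pole(1)[OF \<Theta> True] q tr[OF x] pl[OF True x] ev]
    show ?thesis ..
  next
    case False
    have "f analytic_on {x}"
      unfolding f_def trace_2 matrix_mult_2_nth
      by (intro analytic_on_add analytic_on_mult F_analytic(1)[OF V g x] Higgs_analytic[OF \<Theta> False])
    moreover from this obtain A where "open A" "x \<in> A" "f holomorphic_on A" unfolding analytic_at by blast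
    then have "residue f x = 0" by (rule residue_holo)
    ultimately show ?thesis by (simp add: analytic_on_imp_meromorphic_on)
  qed
  have inf: "form_inf f meromorphic_on {0} \<and> residue (form_inf f) 0 = 0" if n: "None \<in> V"
  proof -
    have nW: "None \<in> W" by (simp add: marked_def)
    obtain q where "higgs_residue \<Theta> None = nilp (slope None) q" by (rule Higgs_residue[OF \<Theta> nW])
    then have q: "residue_matrix (higgs_inf \<Theta>) 0 = nilp (slope None) q" by (simp add: higgs_residue_def)
    have "\<forall>\<^sub>F u in at 0. trace (endo_inf g u ** higgs_inf \<Theta> u) = form_inf f u"
      using eventually_neq_at_within[of 0 0 UNIV]
    proof eventually_elim
      case (elim u)
      then show ?case
        by (simp add: endo_inf_eq higgs_inf_eq Let_def trace_2 matrix_mult_2_nth form_inf_def f_def)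
          (simp add: divide_simps)
    qed
    from trace_mult_residue[OF F_analytic(2)[OF V g n] Higgs_log_pole(2)[OF \<Theta>] q, unfolded endo_inf_0,
        OF tr[OF n] pl[OF nW n] this]
    show ?thesis ..
  qed
  show "meromorphic_form_on f V" using fin inf by (rule_tac meromorphic_form_onI) blast+
  show "form_residue f p = 0" if "p \<in> V" using that fin inf by (cases p) (simp_all add: form_residue_def)
qed

text \<open>From the difference of the two distributions subtract the trace of the comparing cochain
  against \<open>\<Theta>\<close>. The resulting local forms agree on overlaps, and the correction
  has no residue at the index point, so the residue theorem equates the two sums.\<close>

lemma pairing_unique:
  assumes \<Theta>: "\<Theta> \<in> Higgs" and rel: "(\<xi>, \<xi>') \<in> sh.rel"
    and ml: "mittag_leffler \<xi> \<Theta> \<mu>" "mittag_leffler \<xi>' \<Theta> \<mu>'"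
    and fin: "finite {p. form_residue (\<mu> p) p \<noteq> 0}" "finite {p. form_residue (\<mu>' p) p \<noteq> 0}"
  shows "(\<Sum>p | form_residue (\<mu> p) p \<noteq> 0. form_residue (\<mu> p) p) =
    (\<Sum>p | form_residue (\<mu>' p) p \<noteq> 0. form_residue (\<mu>' p) p)"
proof -
  obtain V g where V: "point_cover P1 V" and sub: "\<And>p. V p \<subseteq> fst \<xi> p \<inter> fst \<xi>' p"
    and gF: "\<And>p. g p \<in> F (V p)"
    and g: "\<And>p q x. x \<in> V p \<Longrightarrow> x \<in> V q \<Longrightarrow> snd \<xi> p q x - snd \<xi>' p q x = g p x - g q x"
    using rel by (rule sh.relE[unfolded topspace_P1, OF _ that]) simp_all
  have V': "openin P1 (V p)" "p \<in> V p" for p using V by (auto simp: point_cover_def)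
  define \<tau> where "\<tau> p y = trace (g p (Some y) ** \<Theta> y)" for p y
  define D where "D p y = (\<mu> p y - \<mu>' p y) - \<tau> p y" for p y
  note ml' = ml[unfolded mittag_leffler_def]
  have sub': "V p \<subseteq> fst \<xi> p" "V p \<subseteq> fst \<xi>' p" for p using sub[of p] by simp_all
  have \<mu>: "meromorphic_form_on (\<mu> p) (V p)" "meromorphic_form_on (\<mu>' p) (V p)" for p
    by (rule meromorphic_form_on_subset[OF spec[OF conjunct1[OF ml'(1)]] sub'(1)],
      rule meromorphic_form_on_subset[OF spec[OF conjunct1[OF ml'(2)]] sub'(2)])
  have \<tau>: "meromorphic_form_on (\<tau> p) (V p)" "form_residue (\<tau> p) p = 0" for p
    unfolding \<tau>_def by (rule trace_form(1)[OF \<Theta> V'(1) gF], rule trace_form(2)[OF \<Theta> V'(1) gF V'(2)])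
  have D: "meromorphic_form_on (D p) (V p)" for p
    unfolding D_def by (rule meromorphic_form_on_diff[OF meromorphic_form_on_diff[OF \<mu>] \<tau>(1)])
  have res: "form_residue (D p) p = form_residue (\<mu> p) p - form_residue (\<mu>' p) p" for p
    unfolding D_def
    using form_residue_diff[OF meromorphic_form_on_diff[OF \<mu>] \<tau>(1) V'(2)] form_residue_diff[OF \<mu> V'(2)]
    by (simp add: \<tau>(2))
  have eq: "\<forall>\<^sub>F y in at x. D p y = D q y" if x: "Some x \<in> V p \<inter> V q" for p q x
  proof -
    have "openin P1 (V p \<inter> V q)" using V' by auto
    then have "open {y. Some y \<in> V p \<inter> V q}" by (simp add: openin_P1_iff)
    then have "\<forall>\<^sub>F y in nhds x. y \<in> {y. Some y \<in> V p \<inter> V q}"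
      using x by (intro eventually_nhds_in_open) auto
    then have "\<forall>\<^sub>F y in at x. Some y \<in> V p \<inter> V q"
      unfolding eventually_at_filter by (rule eventually_mono) simp
    moreover have "\<forall>\<^sub>F y in at x. \<mu> p y - \<mu> q y = trace (snd \<xi> p q (Some y) ** \<Theta> y)"
      by (rule conjunct2[OF ml'(1), rule_format]) (use x sub' in blast)
    moreover have "\<forall>\<^sub>F y in at x. \<mu>' p y - \<mu>' q y = trace (snd \<xi>' p q (Some y) ** \<Theta> y)"
      by (rule conjunct2[OF ml'(2), rule_format]) (use x sub' in blast)
    ultimately show ?thesis
    proof eventually_elim
      case (elim y)
      have "trace ((snd \<xi> p q (Some y) - snd \<xi>' p q (Some y)) ** \<Theta> y) = trace ((g p (Some y) - g q (Some y)) ** \<Theta> y)"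
        using g[of "Some y" p q] elim(1) by simp
      then have "(\<mu> p y - \<mu> q y) - (\<mu>' p y - \<mu>' q y) = \<tau> p y - \<tau> q y"
        unfolding trace_diff_mult elim(2)[symmetric] elim(3)[symmetric] \<tau>_def .
      then show ?case unfolding D_def by (simp add: algebra_simps)
    qed
  qed
  let ?A = "{p. form_residue (\<mu> p) p \<noteq> 0}" and ?B = "{p. form_residue (\<mu>' p) p \<noteq> 0}"
  have "(\<Sum>p\<in>?A \<union> ?B. form_residue (D p) p) = 0"
    by (rule sum_residues_glued_eq_0[OF V D eq]) (use fin res in auto)
  then have "(\<Sum>p\<in>?A \<union> ?B. form_residue (\<mu> p) p) = (\<Sum>p\<in>?A \<union> ?B. form_residue (\<mu>' p) p)"
    by (simp add: res sum_subtractf)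
  moreover have "(\<Sum>p\<in>?A. form_residue (\<mu> p) p) = (\<Sum>p\<in>?A \<union> ?B. form_residue (\<mu> p) p)"
    by (rule sum.mono_neutral_left) (use fin in auto)
  moreover have "(\<Sum>p\<in>?B. form_residue (\<mu>' p) p) = (\<Sum>p\<in>?A \<union> ?B. form_residue (\<mu>' p) p)"
    by (rule sum.mono_neutral_left) (use fin in auto)
  ultimately show ?thesis by simp
qed

text \<open>Turns the definite description in \<open>serre_pairing\<close> into a computation with
  one convenient representative and one distribution.\<close>

lemma serre_pairing_eq:
  assumes "\<Theta> \<in> Higgs" "\<xi> \<in> sh.cocycles" "mittag_leffler \<xi> \<Theta> \<mu>"
    "finite {p. form_residue (\<mu> p) p \<noteq> 0}"
  shows "serre_pairing (sh.rel `` {\<xi>}) \<Theta> = (\<Sum>p | form_residue (\<mu> p) p \<noteq> 0. form_residue (\<mu> p) p)"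
  unfolding serre_pairing_def
proof (rule the_equality)
  have "\<xi> \<in> sh.rel `` {\<xi>}" using sh.rel_of_eq[OF assms(2,2)] by simp
  then show "\<exists>\<xi>'\<in>sh.rel `` {\<xi>}. \<exists>\<mu>'. mittag_leffler \<xi>' \<Theta> \<mu>' \<and> finite {p. form_residue (\<mu>' p) p \<noteq> 0} \<and>
     (\<Sum>p | form_residue (\<mu> p) p \<noteq> 0. form_residue (\<mu> p) p) =
     (\<Sum>p | form_residue (\<mu>' p) p \<noteq> 0. form_residue (\<mu>' p) p)"
    by (intro bexI[of _ \<xi>] exI[of _ \<mu>] conjI assms refl)
next
  fix z assume "\<exists>\<xi>'\<in>sh.rel `` {\<xi>}. \<exists>\<mu>'. mittag_leffler \<xi>' \<Theta> \<mu>' \<and> finite {p. form_residue (\<mu>' p) p \<noteq> 0} \<and>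
     z = (\<Sum>p | form_residue (\<mu>' p) p \<noteq> 0. form_residue (\<mu>' p) p)"
  then obtain \<xi>' \<mu>' where *: "(\<xi>, \<xi>') \<in> sh.rel" "mittag_leffler \<xi>' \<Theta> \<mu>'"
    "finite {p. form_residue (\<mu>' p) p \<noteq> 0}" "z = (\<Sum>p | form_residue (\<mu>' p) p \<noteq> 0. form_residue (\<mu>' p) p)"
    by blast
  show "z = (\<Sum>p | form_residue (\<mu> p) p \<noteq> 0. form_residue (\<mu> p) p)"
    unfolding *(4) by (rule pairing_unique[OF assms(1) *(1) assms(3) *(2) assms(4) *(3), symmetric])
qed

text \<open>The trace against the upper right unit matrix picks out the lower left entry of
  \<open>\<Theta>\<close>. Since the cocycle is a coboundary of constants, constant multiples of
  that entry form a Mittag-Leffler distribution.\<close>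

lemma serre_pairing_deformation_comb:
  assumes \<Theta>: "\<Theta> \<in> Higgs"
    and small: "small_radius r s t r \<rho>\<^sub>r" "small_radius r s t s \<rho>\<^sub>s" "small_radius r s t t \<rho>\<^sub>t"
  shows "serre_pairing (sh.rel `` {deformation_comb \<rho>\<^sub>r \<rho>\<^sub>s \<rho>\<^sub>t k}) \<Theta> =
    - (k$1 * residue (\<lambda>x. \<Theta> x $ 2 $ 1) r + k$2 * residue (\<lambda>x. \<Theta> x $ 2 $ 1) s + k$3 * residue (\<lambda>x. \<Theta> x $ 2 $ 1) t)"
proof -
  define c where "c x = \<Theta> x $ 2 $ 1" for x
  have c: "c meromorphic_on {x}" for x unfolding c_def by (rule Higgs_meromorphic[OF \<Theta>])
  have cinf: "form_inf c meromorphic_on {0}"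
  proof (rule meromorphic_at_cong)
    show "\<forall>\<^sub>F u in at 0. u * higgs_inf \<Theta> u $ 2 $ 1 = form_inf c u"
      using eventually_neq_at_within[of 0 0 UNIV]
      by eventually_elim (simp add: higgs_inf_eq Let_def form_inf_def c_def)
    show "(\<lambda>u. u * higgs_inf \<Theta> u $ 2 $ 1) meromorphic_on {0}"
      by (intro meromorphic_on_mult meromorphic_on_id log_pole_at_limit(1) Higgs_log_pole(2)[OF \<Theta>])
  qed
  \<comment> \<open>The sign matches \<open>\<mu> p - \<mu> q\<close> with the difference
    \<open>weight k q - weight k p\<close> in the cocycle.\<close>
  define \<mu> where "\<mu> p y = - weight k p * c y" for p y
  have form_inf_\<mu>: "form_inf (\<mu> p) = (\<lambda>u. - weight k p * form_inf c u)" for p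
    by (auto simp: \<mu>_def form_inf_def)
  have ml: "mittag_leffler (deformation_comb \<rho>\<^sub>r \<rho>\<^sub>s \<rho>\<^sub>t k) \<Theta> \<mu>"
    unfolding mittag_leffler_def
  proof (intro conjI allI impI)
    fix p
    show "meromorphic_form_on (\<mu> p) (fst (deformation_comb \<rho>\<^sub>r \<rho>\<^sub>s \<rho>\<^sub>t k) p)"
    proof (rule meromorphic_form_onI)
      show "\<mu> p meromorphic_on {x}" for x
        unfolding \<mu>_def by (intro meromorphic_on_mult meromorphic_on_const c)
      show "form_inf (\<mu> p) meromorphic_on {0}"
        unfolding form_inf_\<mu> by (intro meromorphic_on_mult meromorphic_on_const cinf)
    qed
  next
    fix p q x
    show "\<forall>\<^sub>F y in at x. \<mu> p y - \<mu> q y = trace (snd (deformation_comb \<rho>\<^sub>r \<rho>\<^sub>s \<rho>\<^sub>t k) p q (Some y) ** \<Theta> y)"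
      by (simp add: snd_deformation_comb trace_2 matrix_mult_2_nth \<mu>_def c_def algebra_simps)
  qed
  have res: "form_residue (\<mu> p) p = (case p of None \<Rightarrow> 0 | Some x \<Rightarrow> - weight k p * residue c x)" for p
  proof (cases p)
    case None
    then have "weight k p = 0" by (simp add: weight_def jump_def)
    then show ?thesis using None form_inf_\<mu>[of p] by (simp add: form_residue_def residue_const)
  next
    case (Some x)
    obtain d where d: "d > 0" "c analytic_on ball x d - {x}"
      using c[of x] unfolding meromorphic_at_iff isolated_singularity_at_def by blast
    have "residue (\<mu> p) x = - weight k p * residue c x"
      unfolding \<mu>_def by (rule residue_lmul[OF open_ball _ analytic_imp_holomorphic[OF d(2)]]) (simp add: d(1))
    then show ?thesis using Some by (simp add: form_residue_def)
  qed
  have sub: "{p. form_residue (\<mu> p) p \<noteq> 0} \<subseteq> {Some r, Some s, Some t}"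
  proof (rule subsetI, rule ccontr)
    fix p assume "p \<in> {p. form_residue (\<mu> p) p \<noteq> 0}" "p \<notin> {Some r, Some s, Some t}"
    then have "weight k p = 0" by (simp add: weight_def jump_def)
    then have "form_residue (\<mu> p) p = 0" unfolding res by (cases p) simp_all
    with \<open>p \<in> _\<close> show False by simp
  qed
  have "finite {p. form_residue (\<mu> p) p \<noteq> 0}" by (rule finite_subset[OF sub]) simp
  then have "serre_pairing (sh.rel `` {deformation_comb \<rho>\<^sub>r \<rho>\<^sub>s \<rho>\<^sub>t k}) \<Theta> =
      (\<Sum>p | form_residue (\<mu> p) p \<noteq> 0. form_residue (\<mu> p) p)"
    by (rule serre_pairing_eq[OF \<Theta> deformation_comb_cocycles[OF small] ml])
  also have "\<dots> = (\<Sum>p\<in>{Some r, Some s, Some t}. form_residue (\<mu> p) p)"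
    by (rule sum.mono_neutral_left) (use sub in blast | simp)+
  also have "\<dots> = - (k$1 * residue c r + k$2 * residue c s + k$3 * residue c t)"
    using points by (simp add: res weight_def jump_def)
  finally show ?thesis unfolding c_def .
qed

end

section \<open>Apparent Higgs fields\<close>

text \<open>Riemann's extension theorem at the points of \<open>P\<close>, then Liouville for the
  resulting entire function.\<close>

lemma eq_0_of_removable_singularities:
  assumes P: "finite P" and f: "f holomorphic_on - P"
    and lim: "\<And>z. z \<in> P \<Longrightarrow> ((\<lambda>x. (x - z) * f x) \<longlongrightarrow> 0) (at z)"
    and inf: "(f \<longlongrightarrow> 0) at_infinity" and x: "x \<notin> P"
  shows "f x = 0"
proof -
  have an: "f analytic_on {z}" if "z \<notin> P" for z
    using f that finite_imp_closed[OF P] unfolding analytic_at by (metis ComplI open_Compl)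
  have "remove_sings f analytic_on {z}" for z
  proof (cases "z \<in> P")
    case False
    then show ?thesis by (rule remove_sings_analytic_on[OF an])
  next
    case True
    define A where "A = - (P - {z})"
    have "open A" unfolding A_def by (intro open_Compl finite_imp_closed finite_Diff P)
    moreover have "z \<in> A" by (simp add: A_def)
    ultimately have A: "open A" "z \<in> A" .
    have fA: "f holomorphic_on A - {z}" by (rule holomorphic_on_subset[OF f]) (auto simp: A_def)
    have "z \<in> interior A" using A by (simp add: interior_open)
    from holomorphic_on_extend_lim[OF fA this] lim[OF True]
    obtain g where g: "g holomorphic_on A" "\<forall>w\<in>A - {z}. g w = f w" by blast
    have "isCont g z" using g(1) A holomorphic_on_imp_continuous_on continuous_on_eq_continuous_at by blast
    then have "(g \<longlongrightarrow> g z) (at z)" by (rule isContD)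
    moreover have "\<forall>\<^sub>F w in at z. g w = f w"
      using eventually_at_in_open[OF A] by eventually_elim (use g(2) in simp)
    ultimately have "(f \<longlongrightarrow> g z) (at z)" by (rule Lim_transform_eventually)
    then show ?thesis
      by (rule remove_sings_analytic_at[OF isolated_singularity_at_holomorphic[OF fA A]])
  qed
  then have "remove_sings f holomorphic_on UNIV"
    by (intro analytic_imp_holomorphic) (subst analytic_on_analytic_at, blast)
  moreover have "(remove_sings f \<longlongrightarrow> 0) at_infinity"
  proof (rule Lim_transform_eventually[OF inf])
    obtain b where "\<And>z. z \<in> P \<Longrightarrow> norm z \<le> b"
      using finite_imp_bounded[OF P] unfolding bounded_iff by blast
    then have "\<forall>z. b + 1 \<le> norm z \<longrightarrow> z \<notin> P" by force
    then have "\<forall>\<^sub>F z in at_infinity. z \<notin> P" unfolding eventually_at_infinity by blast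
    then show "\<forall>\<^sub>F z in at_infinity. f z = remove_sings f z"
      by eventually_elim (simp add: an)
  qed
  ultimately have "remove_sings f x = 0" by (rule Liouville_weak_0)
  then show ?thesis using an[OF x] by simp
qed

lemma tendsto_inverse_shift_at_infinity: "((\<lambda>x. c / (x - w)) \<longlongrightarrow> 0) at_infinity" for c w :: complex
proof -
  have "filterlim (\<lambda>x. - w + x) at_infinity at_infinity"
    by (rule tendsto_add_filterlim_at_infinity[OF tendsto_const filterlim_ident])
  from tendsto_divide_0[OF tendsto_const this] show ?thesis by simp
qed

lemma tendsto_mult_inverse_shift_at_infinity: "((\<lambda>x. x * (c / (x - w))) \<longlongrightarrow> c) at_infinity" for c w :: complex
proof -
  have "((\<lambda>x. c + (c * w) / (x - w)) \<longlongrightarrow> c + 0) at_infinity"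
    by (intro tendsto_add tendsto_const tendsto_inverse_shift_at_infinity)
  moreover have "\<forall>\<^sub>F x in at_infinity. c + (c * w) / (x - w) = x * (c / (x - w))"
    using eventually_not_equal_at_infinity[of w] by eventually_elim (simp add: field_simps)
  ultimately show ?thesis by (simp add: Lim_transform_eventually)
qed

lemma log_poleI:
  assumes "\<And>i j. g i j analytic_on {z}" "\<And>i j. \<forall>\<^sub>F x in at z. (x - z) * A x $ i $ j = g i j x"
  shows "log_pole_at A z" "residue_matrix A z $ i $ j = g i j z"
proof -
  show lp: "log_pole_at A z" unfolding log_pole_at_def using assms by blast
  have "(g i j \<longlongrightarrow> g i j z) (at z)" using analytic_at_imp_isCont[OF assms(1)] by (rule isContD)
  moreover have "\<forall>\<^sub>F x in at z. g i j x = (x - z) * A x $ i $ j" using assms(2)[of i j] by eventually_elim simp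
  ultimately have "((\<lambda>x. (x - z) * A x $ i $ j) \<longlongrightarrow> g i j z) (at z)" by (rule Lim_transform_eventually)
  with log_pole_at_limit(2)[OF lp] show "residue_matrix A z $ i $ j = g i j z"
    by (rule tendsto_unique[OF at_neq_bot])
qed

lemma nilp_preserves_line: "preserves_line (nilp z q) {v. v$1 = z * v$2}"
  by (simp add: preserves_line_slope power2_eq_square algebra_simps)

lemma trace_nilp: "trace (nilp z q) = 0"
  by (simp add: trace_2)

lemma eq_nilpI: "A $ 1 $ 1 = - q * z \<Longrightarrow> A $ 1 $ 2 = q * z\<^sup>2 \<Longrightarrow> A $ 2 $ 1 = - q \<Longrightarrow> A $ 2 $ 2 = q * z \<Longrightarrow> A = nilp z q"
  by (simp add: mat2_eq_iff)

section \<open>Fields with prescribed principal parts\<close>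

context parabolic_data
begin

definition finite_pts :: "complex set" where "finite_pts = {0, 1, r, s, t}"

lemma finite_pts [simp]: "finite finite_pts" by (simp add: finite_pts_def)

lemma Some_in_W [simp]: "Some x \<in> W \<longleftrightarrow> x \<in> finite_pts"
  by (auto simp: marked_def finite_pts_def)

definition zslope :: "complex \<Rightarrow> complex" where "zslope w = slope (Some w)"

text \<open>Partial fractions whose residue at \<open>w\<close> is the nilpotent matrix with
  parameter \<open>q w\<close>; these parameters serve as coordinates for the apparent fields. The
  value 0 at marked points follows the normalisation in \<open>log_higgs_fields\<close>.\<close>

definition field_of :: "(complex \<Rightarrow> complex) \<Rightarrow> complex \<Rightarrow> complex^2^2" where
  "field_of q x = (if x \<in> finite_pts then 0
     else \<Sum>w\<in>finite_pts. mscale (1 / (x - w)) (nilp (zslope w) (q w)))"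

lemma field_of_nth:
  "x \<notin> finite_pts \<Longrightarrow> field_of q x $ i $ j = (\<Sum>w\<in>finite_pts. nilp (zslope w) (q w) $ i $ j / (x - w))"
  by (simp add: field_of_def)

lemma field_of_log_pole:
  assumes z: "z \<in> finite_pts"
  shows "log_pole_at (field_of q) z" "residue_matrix (field_of q) z = nilp (zslope z) (q z)"
proof -
  define g where "g i j x = nilp (zslope z) (q z) $ i $ j +
      (x - z) * (\<Sum>w\<in>finite_pts - {z}. nilp (zslope w) (q w) $ i $ j / (x - w))" for i j x
  have g: "g i j analytic_on {z}" for i j
    unfolding g_def by (intro analytic_intros) auto
  have "open (- (finite_pts - {z}))" by (intro open_Compl finite_imp_closed finite_Diff finite_pts)
  then have ev: "\<forall>\<^sub>F x in at z. x \<in> - (finite_pts - {z}) - {z}" by (rule eventually_at_in_open) simp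
  have eq: "\<forall>\<^sub>F x in at z. (x - z) * field_of q x $ i $ j = g i j x" for i j
    using ev
  proof eventually_elim
    case (elim x)
    then have x: "x \<notin> finite_pts" "x \<noteq> z" by auto
    have "(x - z) * field_of q x $ i $ j = (x - z) * (nilp (zslope z) (q z) $ i $ j / (x - z) +
        (\<Sum>w\<in>finite_pts - {z}. nilp (zslope w) (q w) $ i $ j / (x - w)))"
      unfolding field_of_nth[OF x(1)] by (subst sum.remove[OF finite_pts z]) simp
    then show ?case using x(2) by (simp add: g_def distrib_left)
  qed
  show "log_pole_at (field_of q) z" by (rule log_poleI(1)[OF g eq])
  show "residue_matrix (field_of q) z = nilp (zslope z) (q z)"
    using log_poleI(2)[OF g eq] by (simp add: mat2_eq_iff g_def)
qed

text \<open>In the frame at infinity the lower left entry gains a factor \<open>1 / u\<close>, so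
  its residues have to cancel for the pole to stay simple: this is the first condition. The second
  removes the residue of the diagonal, as the line of slope 0 demands. The upper right entry gains a
  factor \<open>u\<close> and stays holomorphic.\<close>

lemma field_of_inf:
  assumes q: "(\<Sum>w\<in>finite_pts. q w) = 0" "(\<Sum>w\<in>finite_pts. q w * zslope w) = 0"
  shows "log_pole_at (higgs_inf (field_of q)) 0" "\<exists>p. residue_matrix (higgs_inf (field_of q)) 0 = nilp 0 p"
proof -
  define c where "c w i j = nilp (zslope w) (q w) $ i $ j" for w i j
  define h where "h i j u = (\<Sum>w\<in>finite_pts. c w i j / (1 - w * u))" for i j u
  define g where "g i j u = (if i = 1 then (if j = 1 then - h 1 1 u else - u * h 1 2 u)
     else (if j = 1 then - (\<Sum>w\<in>finite_pts. c w 2 1 * w / (1 - w * u)) else - h 2 2 u))" for i j :: 2 and u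
  have h_an: "h i j analytic_on {0}" for i j
    unfolding h_def by (intro analytic_intros) auto
  have "(\<lambda>u. \<Sum>w\<in>finite_pts. c w 2 1 * w / (1 - w * u)) analytic_on {0}"
    by (intro analytic_intros) auto
  then have g: "g i j analytic_on {0}" for i j
    unfolding g_def using exhaust_2[of i] exhaust_2[of j] h_an
    by (auto intro!: analytic_on_neg analytic_on_mult analytic_on_ident)
  have c0: "(\<Sum>w\<in>finite_pts. c w 1 1) = 0" "(\<Sum>w\<in>finite_pts. c w 2 1) = 0" "(\<Sum>w\<in>finite_pts. c w 2 2) = 0"
    using q by (simp_all add: c_def sum_negf)
  have "open (- (inverse ` (finite_pts - {0})))" by (intro open_Compl finite_imp_closed) simp
  then have "\<forall>\<^sub>F u in at 0. u \<in> - (inverse ` (finite_pts - {0})) - {0}"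
    by (rule eventually_at_in_open) auto
  then have ev: "\<forall>\<^sub>F u in at 0. u \<noteq> 0 \<and> inverse u \<notin> finite_pts"
  proof eventually_elim
    case (elim u)
    then have "u \<noteq> 0" by simp
    moreover have "inverse u \<notin> finite_pts"
    proof
      assume "inverse u \<in> finite_pts"
      with \<open>u \<noteq> 0\<close> have "inverse (inverse u) \<in> inverse ` (finite_pts - {0})" by (intro imageI) simp
      with elim show False by simp
    qed
    ultimately show ?case ..
  qed
  have eq: "\<forall>\<^sub>F u in at 0. (u - 0) * higgs_inf (field_of q) u $ i $ j = g i j u" for i j
    using ev
  proof eventually_elim
    case (elim u)
    then have u: "u \<noteq> 0" "inverse u \<notin> finite_pts" by auto
    have nz: "1 - w * u \<noteq> 0" if "w \<in> finite_pts" for w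
      using u that by (metis eq_iff_diff_eq_0 inverse_unique mult.commute)
    have f: "field_of q (inverse u) $ i $ j = u * h i j u" for i j
      unfolding field_of_nth[OF u(2)] h_def sum_distrib_left c_def[symmetric]
    proof (rule sum.cong[OF refl])
      fix w assume "w \<in> finite_pts"
      then show "c w i j / (inverse u - w) = u * (c w i j / (1 - w * u))"
        using u(1) nz by (simp add: field_simps)
    qed
    \<comment> \<open>From \<open>1 / (1 - w * u) = 1 + w * u / (1 - w * u)\<close>, the constant
      terms adding up to 0.\<close>
    have h21: "h 2 1 u = u * (\<Sum>w\<in>finite_pts. c w 2 1 * w / (1 - w * u))"
    proof -
      have "h 2 1 u = (\<Sum>w\<in>finite_pts. c w 2 1 + u * (c w 2 1 * w / (1 - w * u)))"
        unfolding h_def by (rule sum.cong[OF refl]) (use nz in \<open>simp add: field_simps\<close>)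
      then show ?thesis by (simp add: sum.distrib c0 sum_distrib_left)
    qed
    show ?case
      using u(1) exhaust_2[of i] exhaust_2[of j]
      by (auto simp: higgs_inf_eq Let_def f g_def h21 power2_eq_square)
  qed
  show "log_pole_at (higgs_inf (field_of q)) 0" by (rule log_poleI(1)[OF g eq])
  note res = log_poleI(2)[OF g eq]
  have "residue_matrix (higgs_inf (field_of q)) 0 = nilp 0 (\<Sum>w\<in>finite_pts. c w 2 1 * w)"
    by (rule eq_nilpI) (simp_all add: res g_def h_def c0)
  then show "\<exists>p. residue_matrix (higgs_inf (field_of q)) 0 = nilp 0 p" ..
qed

lemma field_of_Higgs:
  assumes q: "(\<Sum>w\<in>finite_pts. q w) = 0" "(\<Sum>w\<in>finite_pts. q w * zslope w) = 0"
  shows "field_of q \<in> Higgs"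
proof -
  have res: "\<exists>p. higgs_residue (field_of q) w = nilp (slope w) p" if "w \<in> W" for w
  proof (cases w)
    case None
    then show ?thesis using field_of_inf(2)[OF q] by (simp add: higgs_residue_def)
  next
    case (Some x)
    then have "x \<in> finite_pts" using that by simp
    from field_of_log_pole(2)[OF this] show ?thesis
      unfolding higgs_residue_def Some zslope_def by auto
  qed
  have "holomorphic_matrix_on (field_of q) (- finite_pts)"
    unfolding holomorphic_matrix_on_def
  proof (intro allI)
    fix i j
    have "(\<lambda>x. \<Sum>w\<in>finite_pts. nilp (zslope w) (q w) $ i $ j / (x - w)) holomorphic_on - finite_pts"
      by (intro holomorphic_intros) auto
    then show "(\<lambda>x. field_of q x $ i $ j) holomorphic_on - finite_pts"
      by (rule holomorphic_transform) (simp add: field_of_nth)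
  qed
  moreover have "trace (field_of q x) = 0" for x
    by (cases "x \<in> finite_pts") (simp_all add: field_of_nth trace_2 sum.distrib[symmetric] field_of_def[of q x])
  moreover have "preserves_line (higgs_residue (field_of q) w) (line w)" if w: "w \<in> W" for w
    using res[OF w] nilp_preserves_line unfolding line_eq by auto
  moreover have "apparent_residue (higgs_residue (field_of q) w) (line w)" if w: "w \<in> W" for w
    using res[OF w] apparent_residue_line trace_nilp unfolding line_eq by metis
  moreover have "{x. x \<notin> finite_pts} = - finite_pts" by auto
  ultimately show ?thesis
    unfolding Higgs_iff log_higgs_fields_def
    using field_of_log_pole(1) field_of_inf(1)[OF q] by (simp add: field_of_def)
qed

text \<open>The residue at infinity is a multiple of the lower left unit matrix, which bounds the
  growth of every entry. Subtracting the principal parts leaves removable singularities and a limit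
  0 at infinity. The coefficients of \<open>1 / x\<close> at infinity then yield the two linear
  conditions.\<close>

lemma Higgs_eq_field_of:
  assumes \<Theta>: "\<Theta> \<in> Higgs"
  obtains q where "(\<Sum>w\<in>finite_pts. q w) = 0" "(\<Sum>w\<in>finite_pts. q w * zslope w) = 0" "\<Theta> = field_of q"
proof -
  have "\<exists>p. residue_matrix \<Theta> w = nilp (zslope w) p" if w: "w \<in> finite_pts" for w
  proof -
    obtain p where "higgs_residue \<Theta> (Some w) = nilp (slope (Some w)) p"
      by (rule Higgs_residue[OF \<Theta>, of "Some w"]) (use w in auto)
    then show ?thesis by (auto simp: higgs_residue_def zslope_def)
  qed
  then obtain q where q: "\<And>w. w \<in> finite_pts \<Longrightarrow> residue_matrix \<Theta> w = nilp (zslope w) (q w)" by metis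
  have nW: "None \<in> W" by (simp add: marked_def)
  obtain p where "higgs_residue \<Theta> None = nilp (slope None) p" by (rule Higgs_residue[OF \<Theta> nW])
  then have p: "residue_matrix (higgs_inf \<Theta>) 0 = nilp 0 p" by (simp add: higgs_residue_def)
  note lim = log_pole_at_limit(2)[OF Higgs_log_pole(2)[OF \<Theta>], unfolded p]
  have lim': "((\<lambda>x. inverse x * higgs_inf \<Theta> (inverse x) $ i $ j) \<longlongrightarrow> nilp 0 p $ i $ j) at_infinity" for i j
    unfolding lim_at_infinity_0 o_def using lim[of i j] by simp
  have ne: "\<forall>\<^sub>F x in at_infinity. x \<noteq> (0::complex)" by (rule eventually_not_equal_at_infinity)
  have "\<forall>\<^sub>F x in at_infinity. - (inverse x * higgs_inf \<Theta> (inverse x) $ 1 $ 1) = x * \<Theta> x $ 1 $ 1"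
    using ne by eventually_elim (simp add: higgs_inf_eq Let_def power2_eq_square field_simps)
  from Lim_transform_eventually[OF tendsto_minus[OF lim'] this]
  have inf11: "((\<lambda>x. x * \<Theta> x $ 1 $ 1) \<longlongrightarrow> 0) at_infinity" by simp
  have "\<forall>\<^sub>F x in at_infinity. - (inverse x * higgs_inf \<Theta> (inverse x) $ 1 $ 2) = \<Theta> x $ 1 $ 2"
    using ne by eventually_elim (simp add: higgs_inf_eq Let_def power2_eq_square field_simps)
  from Lim_transform_eventually[OF tendsto_minus[OF lim'] this]
  have inf12: "((\<lambda>x. \<Theta> x $ 1 $ 2) \<longlongrightarrow> 0) at_infinity" by simp
  \<comment> \<open>For this entry it is \<open>x\<^sup>2 * \<Theta> x $ 2 $ 1\<close> that has a
    finite limit, possibly nonzero; the factor \<open>inverse x\<close> brings it down to 0.\<close>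
  have "\<forall>\<^sub>F x in at_infinity. inverse x * (- (inverse x * higgs_inf \<Theta> (inverse x) $ 2 $ 1)) = x * \<Theta> x $ 2 $ 1"
    using ne by eventually_elim (simp add: higgs_inf_eq Let_def power2_eq_square field_simps)
  from Lim_transform_eventually[OF tendsto_mult[OF tendsto_inverse_0 tendsto_minus[OF lim']] this]
  have inf21: "((\<lambda>x. x * \<Theta> x $ 2 $ 1) \<longlongrightarrow> 0) at_infinity" by simp
  have drop: "(f \<longlongrightarrow> 0) at_infinity" if "((\<lambda>x. x * f x) \<longlongrightarrow> 0) at_infinity" for f :: "complex \<Rightarrow> complex"
  proof -
    have "((\<lambda>x. inverse x * (x * f x)) \<longlongrightarrow> 0 * 0) at_infinity" by (intro tendsto_mult tendsto_inverse_0 that)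
    moreover have "\<forall>\<^sub>F x in at_infinity. inverse x * (x * f x) = f x" using ne by eventually_elim simp
    ultimately show ?thesis by (simp add: Lim_transform_eventually)
  qed
  define E where "E i j x = \<Theta> x $ i $ j - (\<Sum>w\<in>finite_pts. nilp (zslope w) (q w) $ i $ j / (x - w))" for i j x
  have E0: "E i j x = 0" if inf: "((\<lambda>x. \<Theta> x $ i $ j) \<longlongrightarrow> 0) at_infinity" and x: "x \<notin> finite_pts" for i j x
  proof (rule eq_0_of_removable_singularities[OF finite_pts _ _ _ x])
    have "(\<lambda>x. \<Theta> x $ i $ j) holomorphic_on {x. Some x \<notin> W}"
      using \<Theta> unfolding Higgs_iff log_higgs_fields_def holomorphic_matrix_on_def by blast
    then have "(\<lambda>x. \<Theta> x $ i $ j) holomorphic_on - finite_pts"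
      by (rule holomorphic_on_subset) auto
    then show "E i j holomorphic_on - finite_pts"
      unfolding E_def by (intro holomorphic_intros) auto
    have "((\<lambda>x. \<Theta> x $ i $ j - (\<Sum>w\<in>finite_pts. nilp (zslope w) (q w) $ i $ j / (x - w))) \<longlongrightarrow>
        0 - (\<Sum>w\<in>finite_pts. 0)) at_infinity"
      by (intro tendsto_diff tendsto_sum tendsto_inverse_shift_at_infinity inf)
    then show "(E i j \<longlongrightarrow> 0) at_infinity" unfolding E_def by simp
  next
    fix z assume z: "z \<in> finite_pts"
    have 1: "((\<lambda>x. (x - z) * \<Theta> x $ i $ j) \<longlongrightarrow> nilp (zslope z) (q z) $ i $ j) (at z)"
      using log_pole_at_limit(2)[OF Higgs_log_pole(1)[OF \<Theta>], of z i j] z by (simp add: q)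
    have 2: "((\<lambda>x. (x - z) * field_of q x $ i $ j) \<longlongrightarrow> nilp (zslope z) (q z) $ i $ j) (at z)"
      using log_pole_at_limit(2)[OF field_of_log_pole(1)[OF z], of q i j] by (simp add: field_of_log_pole(2)[OF z])
    from tendsto_diff[OF 1 2]
    have lim: "((\<lambda>x. (x - z) * \<Theta> x $ i $ j - (x - z) * field_of q x $ i $ j) \<longlongrightarrow> 0) (at z)" by simp
    have "open (- (finite_pts - {z}))" by (intro open_Compl finite_imp_closed finite_Diff finite_pts)
    then have "\<forall>\<^sub>F x in at z. x \<in> - (finite_pts - {z}) - {z}" by (rule eventually_at_in_open) simp
    then have "\<forall>\<^sub>F x in at z. (x - z) * \<Theta> x $ i $ j - (x - z) * field_of q x $ i $ j = (x - z) * E i j x"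
      by eventually_elim (simp add: E_def field_of_nth right_diff_distrib)
    from Lim_transform_eventually[OF lim this]
    show "((\<lambda>x. (x - z) * E i j x) \<longlongrightarrow> 0) (at z)" .
  qed
  have ev_fin: "\<forall>\<^sub>F x in at_infinity. x \<notin> finite_pts"
  proof -
    have "\<forall>\<^sub>F x in at_infinity. \<forall>w\<in>finite_pts. x \<noteq> w"
      by (rule eventually_ball_finite) (auto intro: eventually_not_equal_at_infinity)
    then show ?thesis by eventually_elim auto
  qed
  have \<Theta>nth: "\<Theta> x $ i $ j = field_of q x $ i $ j"
    if "((\<lambda>x. \<Theta> x $ i $ j) \<longlongrightarrow> 0) at_infinity" "x \<notin> finite_pts" for i j x
    using E0[OF that] by (simp add: E_def field_of_nth[OF that(2)])
  have sum0: "(\<Sum>w\<in>finite_pts. nilp (zslope w) (q w) $ i $ j) = 0"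
    if l: "((\<lambda>x. x * \<Theta> x $ i $ j) \<longlongrightarrow> 0) at_infinity" for i j
  proof -
    have "((\<lambda>x. \<Sum>w\<in>finite_pts. x * (nilp (zslope w) (q w) $ i $ j / (x - w))) \<longlongrightarrow>
        (\<Sum>w\<in>finite_pts. nilp (zslope w) (q w) $ i $ j)) at_infinity"
      by (intro tendsto_sum tendsto_mult_inverse_shift_at_infinity)
    moreover have "\<forall>\<^sub>F x in at_infinity. (\<Sum>w\<in>finite_pts. x * (nilp (zslope w) (q w) $ i $ j / (x - w))) = x * \<Theta> x $ i $ j"
      using ev_fin
    proof eventually_elim
      case (elim x)
      show ?case unfolding \<Theta>nth[OF drop[OF l] elim] field_of_nth[OF elim] by (rule sum_distrib_left[symmetric])
    qed
    ultimately have "((\<lambda>x. x * \<Theta> x $ i $ j) \<longlongrightarrow> (\<Sum>w\<in>finite_pts. nilp (zslope w) (q w) $ i $ j)) at_infinity"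
      by (rule Lim_transform_eventually)
    then show ?thesis using l by (rule tendsto_unique[OF trivial_limit_at_infinity])
  qed
  show thesis
  proof (rule that)
    show "(\<Sum>w\<in>finite_pts. q w) = 0" using sum0[OF inf21] by (simp add: sum_negf)
    show "(\<Sum>w\<in>finite_pts. q w * zslope w) = 0" using sum0[OF inf11] by (simp add: sum_negf)
    show "\<Theta> = field_of q"
    proof
      fix x
      show "\<Theta> x = field_of q x"
      proof (cases "x \<in> finite_pts")
        case True
        then show ?thesis using \<Theta> by (simp add: Higgs_iff log_higgs_fields_def field_of_def)
      next
        case False
        note eqs = \<Theta>nth[OF drop[OF inf11] False] \<Theta>nth[OF inf12 False] \<Theta>nth[OF drop[OF inf21] False]
        have "\<Theta> x $ 2 $ 2 = - \<Theta> x $ 1 $ 1" using Higgs_trace[OF \<Theta>, of x] by (simp add: trace_2 add_eq_0_iff)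
        moreover have "field_of q x $ 2 $ 2 = - field_of q x $ 1 $ 1"
          by (simp add: field_of_nth[OF False] sum_negf)
        ultimately show ?thesis unfolding mat2_eq_iff using eqs by simp
      qed
    qed
  qed
qed

end

section \<open>Dual bases\<close>

lemma vector3_eta: "m = (m$1) *s axis 1 1 + (m$2) *s axis 2 1 + (m$3) *s axis 3 (1::complex)" for m :: "complex^3"
  by (simp add: vec_eq_iff forall_3 axis_def)

text \<open>The vector whose coordinates are the values of \<open>l\<close> on the second basis
  represents \<open>l\<close>, and evaluation on that basis gives uniqueness. Perfectness uses this
  twice, with the two spaces exchanged.\<close>

lemma dual_bases_represent:
  assumes V: "is_basis3 V a b c" and W: "is_basis3 W a' b' c'"
    and P: "\<And>k m. P (lin_comb3 V a b c k) (lin_comb3 W a' b' c' m) = k$1 * m$1 + k$2 * m$2 + k$3 * m$3"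
  shows "\<forall>v\<in>cs_carrier V. linear_form W (P v)"
    and "\<forall>l. linear_form W l \<longrightarrow> (\<exists>!v. v \<in> cs_carrier V \<and> (\<forall>w\<in>cs_carrier W. P v w = l w))"
proof -
  let ?V = "lin_comb3 V a b c" and ?W = "lin_comb3 W a' b' c'"
  have carV: "cs_carrier V = range ?V" and injV: "inj ?V"
    using V by (auto simp: is_basis3_def bij_betw_def)
  have carW: "cs_carrier W = range ?W" using W by (auto simp: is_basis3_def bij_betw_def)
  have addW: "cs_add W (?W m) (?W m') = ?W (m + m')" and scW: "cs_scale W z (?W m) = ?W (z *s m)" for m m' z
    using W by (simp_all add: is_basis3_def)
  show "\<forall>v\<in>cs_carrier V. linear_form W (P v)"
    unfolding carV linear_form_def carW by (auto simp: addW scW P algebra_simps)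
  show "\<forall>l. linear_form W l \<longrightarrow> (\<exists>!v. v \<in> cs_carrier V \<and> (\<forall>w\<in>cs_carrier W. P v w = l w))"
  proof (intro allI impI)
    fix l assume l: "linear_form W l"
    define f where "f m = l (?W m)" for m
    have f_add: "f (m + m') = f m + f m'" and f_sc: "f (z *s m) = z * f m" for m m' z
      using l unfolding f_def linear_form_def carW addW[symmetric] scW[symmetric] by auto
    define k :: "complex^3" where "k = vector [f (axis 1 1), f (axis 2 1), f (axis 3 1)]"
    have fm: "f m = k$1 * m$1 + k$2 * m$2 + k$3 * m$3" for m
    proof -
      have "f m = f ((m$1) *s axis 1 1 + (m$2) *s axis 2 1 + (m$3) *s axis 3 1)"
        by (rule arg_cong[OF vector3_eta])
      then show ?thesis unfolding f_add f_sc k_def vector_3 by (simp add: mult.commute)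
    qed
    show "\<exists>!v. v \<in> cs_carrier V \<and> (\<forall>w\<in>cs_carrier W. P v w = l w)"
    proof (rule ex1I[of _ "?V k"])
      show "?V k \<in> cs_carrier V \<and> (\<forall>w\<in>cs_carrier W. P (?V k) w = l w)"
        unfolding carV carW using fm by (auto simp: P f_def)
      fix v assume v: "v \<in> cs_carrier V \<and> (\<forall>w\<in>cs_carrier W. P v w = l w)"
      then obtain k' where k': "v = ?V k'" unfolding carV by blast
      have "k'$1 * m$1 + k'$2 * m$2 + k'$3 * m$3 = k$1 * m$1 + k$2 * m$2 + k$3 * m$3" for m :: "complex^3"
        using v unfolding carW k' by (auto simp: P fm[symmetric] f_def)
      from this[of "axis 1 1"] this[of "axis 2 1"] this[of "axis 3 1"]
      have "k' = k" by (simp add: vec_eq_iff forall_3 axis_def)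
      then show "v = ?V k" by (simp add: k')
    qed
  qed
qed

lemma perfect_pairing_of_dual_bases:
  assumes V: "is_basis3 V a b c" and W: "is_basis3 W a' b' c'"
    and P: "\<And>k m. P (lin_comb3 V a b c k) (lin_comb3 W a' b' c' m) = k$1 * m$1 + k$2 * m$2 + k$3 * m$3"
  shows "perfect_pairing V W P"
proof -
  have P': "P (lin_comb3 V a b c k) (lin_comb3 W a' b' c' m) = m$1 * k$1 + m$2 * k$2 + m$3 * k$3" for k m
    unfolding P by (simp add: mult.commute)
  show ?thesis
    unfolding perfect_pairing_def
    by (intro conjI dual_bases_represent[OF V W P] dual_bases_represent[where P = "\<lambda>w v. P v w", OF W V P'])
qed

section \<open>The explicit fields as a basis\<close>

context parabolic_data
begin

abbreviation "H0 \<equiv> H0_apparent r s t R S T"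
abbreviation "theta_comb \<equiv> lin_comb3 H0 (theta r s t r R) (theta r s t s S) (theta r s t t T)"

lemma cs_add_H0: "cs_add H0 = (\<lambda>\<Theta> \<Psi> x. \<Theta> x + \<Psi> x)" and cs_scale_H0: "cs_scale H0 = (\<lambda>z \<Theta> x. mscale z (\<Theta> x))"
  by (simp_all add: H0_apparent_def apparent_higgs_def)

lemma theta_comb_eq: "theta_comb k x =
    mscale (k$1) (theta r s t r R x) + mscale (k$2) (theta r s t s S x) + mscale (k$3) (theta r s t t T x)"
  by (simp add: lin_comb3_def cs_add_H0 cs_scale_H0)

text \<open>Once the parameters at \<open>r\<close>, \<open>s\<close>, \<open>t\<close> are chosen,
  the two linear conditions determine those at 1 and 0. This is the origin of the coefficients
  \<open>Z\<close> and \<open>1 - Z\<close> in \<open>theta\<close>.\<close>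

definition coeffs :: "complex^3 \<Rightarrow> complex \<Rightarrow> complex" where
  "coeffs k w = (if w = r then k$1 else if w = s then k$2 else if w = t then k$3
     else if w = 0 then - (k$1 * (1 - R) + k$2 * (1 - S) + k$3 * (1 - T))
     else - (k$1 * R + k$2 * S + k$3 * T))"

lemma sum_finite_pts: "(\<Sum>w\<in>finite_pts. h w) = h 0 + h 1 + h r + h s + h t" for h :: "complex \<Rightarrow> complex"
proof -
  have "0 \<notin> {1, r, s, t}" "1 \<notin> {r, s, t}" "r \<notin> {s, t}" "s \<notin> {t}"
    using points by auto
  then show ?thesis unfolding finite_pts_def by (simp add: add.assoc)
qed

lemma coeffs_simps [simp]: "coeffs k r = k$1" "coeffs k s = k$2" "coeffs k t = k$3"
  "coeffs k 0 = - (k$1 * (1 - R) + k$2 * (1 - S) + k$3 * (1 - T))"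
  "coeffs k 1 = - (k$1 * R + k$2 * S + k$3 * T)"
  using points by (auto simp: coeffs_def)

lemma zslope_simps [simp]: "zslope 0 = 0" "zslope 1 = 1" "zslope r = R" "zslope s = S" "zslope t = T"
  by (simp_all add: zslope_def)

lemma theta_comb_field: "theta_comb k = field_of (coeffs k)"
proof
  fix x
  show "theta_comb k x = field_of (coeffs k) x"
  proof (cases "x \<in> finite_pts")
    case True
    then show ?thesis by (simp add: theta_comb_eq theta_def field_of_def mat2_eq_iff)
  next
    case False
    \<comment> \<open>Named reciprocals make the identity linear in \<open>A\<close> to
      \<open>E\<close>, with no denominators to clear.\<close>
    define A B C D E where "A = 1 / x" and "B = 1 / (x - 1)" and "C = 1 / (x - r)"
      and "D = 1 / (x - s)" and "E = 1 / (x - t)"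
    have d: "y / x = y * A" "y / (x - 1) = y * B" "y / (x - r) = y * C" "y / (x - s) = y * D" "y / (x - t) = y * E" for y
      by (simp_all add: A_def B_def C_def D_def E_def)
    show ?thesis
      unfolding mat2_eq_iff field_of_nth[OF False] sum_finite_pts using False
      by (simp add: theta_comb_eq theta_def d) (simp add: algebra_simps)
  qed
qed

lemma theta_comb_Higgs: "theta_comb k \<in> Higgs"
  unfolding theta_comb_field
  by (rule field_of_Higgs) (simp_all add: sum_finite_pts algebra_simps)

lemma residue_theta_comb: "residue (\<lambda>x. theta_comb k x $ 2 $ 1) r = - k$1"
  "residue (\<lambda>x. theta_comb k x $ 2 $ 1) s = - k$2" "residue (\<lambda>x. theta_comb k x $ 2 $ 1) t = - k$3"
proof -
  have "residue (\<lambda>x. theta_comb k x $ 2 $ 1) w = - coeffs k w" if "w \<in> finite_pts" for w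
    using arg_cong[OF field_of_log_pole(2)[OF that, of "coeffs k"], of "\<lambda>A. A $ 2 $ 1"]
    by (simp add: residue_matrix_def theta_comb_field)
  from this[of r] this[of s] this[of t]
  show "residue (\<lambda>x. theta_comb k x $ 2 $ 1) r = - k$1"
    "residue (\<lambda>x. theta_comb k x $ 2 $ 1) s = - k$2" "residue (\<lambda>x. theta_comb k x $ 2 $ 1) t = - k$3"
    by (simp_all add: finite_pts_def)
qed

lemma theta_comb_axis: "theta_comb (axis 1 1) = theta r s t r R" "theta_comb (axis 2 1) = theta r s t s S"
  "theta_comb (axis 3 1) = theta r s t t T"
  by (simp_all add: fun_eq_iff theta_comb_eq axis_def)

text \<open>Of the five parameters of an apparent field, two are eliminated by the linear conditions
  and those at \<open>r\<close>, \<open>s\<close>, \<open>t\<close> stay free. The residues at these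
  points recover the coordinates, which gives injectivity.\<close>

lemma is_basis3_theta: "is_basis3 H0 (theta r s t r R) (theta r s t s S) (theta r s t t T)"
proof -
  have "inj theta_comb"
  proof (rule injI)
    fix k l assume eq: "theta_comb k = theta_comb l"
    have "residue (\<lambda>x. theta_comb k x $ 2 $ 1) w = residue (\<lambda>x. theta_comb l x $ 2 $ 1) w" for w
      by (simp only: eq)
    from this[of r] this[of s] this[of t]
    show "k = l" by (simp only: residue_theta_comb neg_equal_iff_equal vec_eq_iff forall_3)
  qed
  moreover have "range theta_comb = Higgs"
  proof
    show "range theta_comb \<subseteq> Higgs" using theta_comb_Higgs by blast
    show "Higgs \<subseteq> range theta_comb"
    proof
      fix \<Theta> assume "\<Theta> \<in> Higgs"
      then obtain q where q: "(\<Sum>w\<in>finite_pts. q w) = 0" "(\<Sum>w\<in>finite_pts. q w * zslope w) = 0" "\<Theta> = field_of q"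
        by (rule Higgs_eq_field_of)
      define k :: "complex^3" where "k = vector [q r, q s, q t]"
      have k: "k$1 = q r" "k$2 = q s" "k$3 = q t" by (simp_all add: k_def vector_3)
      \<comment> \<open>The slopes 0 and 1 make the system triangular: this equation gives
        \<open>q 1\<close>, the other one then \<open>q 0\<close>.\<close>
      have "q 0 * 0 + q 1 * 1 + q r * R + q s * S + q t * T = 0"
        using q(2) unfolding sum_finite_pts zslope_simps .
      then have q1: "q 1 = - (q r * R + q s * S + q t * T)" by algebra
      have "q 0 + q 1 + q r + q s + q t = 0" using q(1) unfolding sum_finite_pts .
      then have q0: "q 0 = - (q r * (1 - R) + q s * (1 - S) + q t * (1 - T))"
        unfolding q1 by algebra
      have "coeffs k w = q w" if "w \<in> finite_pts" for w
      proof -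
        have "w = 0 \<or> w = 1 \<or> w = r \<or> w = s \<or> w = t" using that by (simp add: finite_pts_def)
        then show ?thesis by (elim disjE) (simp_all only: coeffs_simps k q0 q1)
      qed
      then have "(\<Sum>w\<in>finite_pts. mscale (1 / (x - w)) (nilp (zslope w) (coeffs k w))) =
          (\<Sum>w\<in>finite_pts. mscale (1 / (x - w)) (nilp (zslope w) (q w)))" for x
        by (intro sum.cong refl) (simp only:)
      then have "field_of (coeffs k) = field_of q" unfolding fun_eq_iff field_of_def by (simp only: simp_thms)
      then have "theta_comb k = \<Theta>" unfolding q(3) theta_comb_field .
      then show "\<Theta> \<in> range theta_comb" by blast
    qed
  qed
  moreover have "theta_comb (k + l) = cs_add H0 (theta_comb k) (theta_comb l)" for k l
    by (rule ext) (simp add: cs_add_H0 theta_comb_eq sh.sc_add_left add_ac)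
  moreover have "theta_comb (z *s k) = cs_scale H0 z (theta_comb k)" for z k
    by (rule ext) (simp add: cs_scale_H0 theta_comb_eq sh.sc_add_right sh.sc_mult)
  moreover have "theta r s t r R \<in> Higgs" "theta r s t s S \<in> Higgs" "theta r s t t T \<in> Higgs"
    using theta_comb_Higgs[of "axis 1 1"] theta_comb_Higgs[of "axis 2 1"] theta_comb_Higgs[of "axis 3 1"]
    unfolding theta_comb_axis .
  ultimately show ?thesis unfolding is_basis3_def bij_betw_def by (intro conjI allI)
qed

section \<open>Duality of the two families\<close>

context
  fixes \<rho>\<^sub>r \<rho>\<^sub>s \<rho>\<^sub>t :: real
  assumes small: "small_radius r s t r \<rho>\<^sub>r" "small_radius r s t s \<rho>\<^sub>s" "small_radius r s t t \<rho>\<^sub>t"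
begin

text \<open>Two minus signs cancel, one from the distribution and one from the residues of the lower
  left entries.\<close>

lemma serre_pairing_classes:
  "serre_pairing (sh.rel `` {deformation_comb \<rho>\<^sub>r \<rho>\<^sub>s \<rho>\<^sub>t k}) (theta_comb m) = k$1 * m$1 + k$2 * m$2 + k$3 * m$3"
  unfolding serre_pairing_deformation_comb[OF theta_comb_Higgs small] residue_theta_comb by simp

lemma H1_sl_eq: "H1_sl r s t R S T = sh.H1"
  by (simp add: H1_sl_def)

lemma lin_comb3_tangent_vectors:
  "lin_comb3 (H1_sl r s t R S T) (tangent_vector r s t R S T r \<rho>\<^sub>r) (tangent_vector r s t R S T s \<rho>\<^sub>s)
     (tangent_vector r s t R S T t \<rho>\<^sub>t) k = sh.rel `` {deformation_comb \<rho>\<^sub>r \<rho>\<^sub>s \<rho>\<^sub>t k}"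
  unfolding H1_sl_eq tangent_vector_def deformation_comb_def
  by (rule sh.lin_comb3_class; rule deformation_cocycles; rule small)

lemma is_basis3_tangent_vectors:
  "is_basis3 (H1_sl r s t R S T) (tangent_vector r s t R S T r \<rho>\<^sub>r) (tangent_vector r s t R S T s \<rho>\<^sub>s)
     (tangent_vector r s t R S T t \<rho>\<^sub>t)"
  unfolding H1_sl_eq tangent_vector_def
proof (rule sh.is_basis3_H1I)
  show "\<exists>k. (\<omega>, sh.comb3 (deformation_cocycle r \<rho>\<^sub>r) (deformation_cocycle s \<rho>\<^sub>s) (deformation_cocycle t \<rho>\<^sub>t) k) \<in> sh.rel"
    if "\<omega> \<in> sh.cocycles" for \<omega>
    using deformations_generate[OF small that] unfolding deformation_comb_def .
next
  fix k l
  assume "(sh.comb3 (deformation_cocycle r \<rho>\<^sub>r) (deformation_cocycle s \<rho>\<^sub>s) (deformation_cocycle t \<rho>\<^sub>t) k,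
    sh.comb3 (deformation_cocycle r \<rho>\<^sub>r) (deformation_cocycle s \<rho>\<^sub>s) (deformation_cocycle t \<rho>\<^sub>t) l) \<in> sh.rel"
  then have "sh.rel `` {deformation_comb \<rho>\<^sub>r \<rho>\<^sub>s \<rho>\<^sub>t k} = sh.rel `` {deformation_comb \<rho>\<^sub>r \<rho>\<^sub>s \<rho>\<^sub>t l}"
    unfolding deformation_comb_def by (rule equiv_class_eq[OF sh.equiv_rel])
  then have "k$1 * m$1 + k$2 * m$2 + k$3 * m$3 = l$1 * m$1 + l$2 * m$2 + l$3 * m$3" for m :: "complex^3"
    unfolding serre_pairing_classes[symmetric] by simp
  from this[of "axis 1 1"] this[of "axis 2 1"] this[of "axis 3 1"]
  show "k = l" by (simp add: vec_eq_iff forall_3 axis_def)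
qed (rule deformation_cocycles; rule small)+

text \<open>A unit combination is carried by a finer covering but has the same functions as the
  single deformation cocycle, hence lies in the same class.\<close>

lemma tangent_vectors_axis:
  "tangent_vector r s t R S T r \<rho>\<^sub>r = sh.rel `` {deformation_comb \<rho>\<^sub>r \<rho>\<^sub>s \<rho>\<^sub>t (axis 1 1)}"
  "tangent_vector r s t R S T s \<rho>\<^sub>s = sh.rel `` {deformation_comb \<rho>\<^sub>r \<rho>\<^sub>s \<rho>\<^sub>t (axis 2 1)}"
  "tangent_vector r s t R S T t \<rho>\<^sub>t = sh.rel `` {deformation_comb \<rho>\<^sub>r \<rho>\<^sub>s \<rho>\<^sub>t (axis 3 1)}"
proof -
  have *: "tangent_vector r s t R S T i \<rho> = sh.rel `` {deformation_comb \<rho>\<^sub>r \<rho>\<^sub>s \<rho>\<^sub>t k}"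
    if "small_radius r s t i \<rho>" "weight k = jump i" for i \<rho> k
    unfolding tangent_vector_def
    by (intro equiv_class_eq[OF sh.equiv_rel] sh.rel_of_eq deformation_cocycles deformation_comb_cocycles small that(1) ext)
      (simp add: snd_deformation_comb deformation_jump that(2))
  show "tangent_vector r s t R S T r \<rho>\<^sub>r = sh.rel `` {deformation_comb \<rho>\<^sub>r \<rho>\<^sub>s \<rho>\<^sub>t (axis 1 1)}"
    "tangent_vector r s t R S T s \<rho>\<^sub>s = sh.rel `` {deformation_comb \<rho>\<^sub>r \<rho>\<^sub>s \<rho>\<^sub>t (axis 2 1)}"
    "tangent_vector r s t R S T t \<rho>\<^sub>t = sh.rel `` {deformation_comb \<rho>\<^sub>r \<rho>\<^sub>s \<rho>\<^sub>t (axis 3 1)}"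
    by (rule *[OF small(1)] *[OF small(2)] *[OF small(3)]; simp add: fun_eq_iff weight_def axis_def)+
qed

lemma perfect_serre_pairing: "perfect_pairing (H1_sl r s t R S T) H0 serre_pairing"
  by (rule perfect_pairing_of_dual_bases[OF is_basis3_tangent_vectors is_basis3_theta])
    (simp only: lin_comb3_tangent_vectors serre_pairing_classes)

lemma serre_pairing_dual_basis:
  "\<forall>(i, \<rho>) \<in> {(r, \<rho>\<^sub>r), (s, \<rho>\<^sub>s), (t, \<rho>\<^sub>t)}. \<forall>(j, Z) \<in> {(r, R), (s, S), (t, T)}.
     serre_pairing (tangent_vector r s t R S T i \<rho>) (theta r s t j Z) = (if i = j then 1 else 0)"
proof -
  have pairing: "serre_pairing (sh.rel `` {deformation_comb \<rho>\<^sub>r \<rho>\<^sub>s \<rho>\<^sub>t k}) (theta r s t r R) = k$1"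
    "serre_pairing (sh.rel `` {deformation_comb \<rho>\<^sub>r \<rho>\<^sub>s \<rho>\<^sub>t k}) (theta r s t s S) = k$2"
    "serre_pairing (sh.rel `` {deformation_comb \<rho>\<^sub>r \<rho>\<^sub>s \<rho>\<^sub>t k}) (theta r s t t T) = k$3" for k
    using serre_pairing_classes[of k "axis 1 1"] serre_pairing_classes[of k "axis 2 1"]
      serre_pairing_classes[of k "axis 3 1"]
    unfolding theta_comb_axis by (simp_all only: axis_def vec_lambda_beta) simp_all
  have "s \<noteq> r" "t \<noteq> r" "t \<noteq> s" using points by auto
  then show ?thesis
    using points(4-6) by (simp add: tangent_vectors_axis pairing) (simp add: axis_def)
qed

end

end

theorem mainTheorem3:
  fixes r s t R S T :: complex and \<rho>\<^sub>r \<rho>\<^sub>s \<rho>\<^sub>t :: real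
  assumes "r \<notin> {0, 1}" "s \<notin> {0, 1}" "t \<notin> {0, 1}" "r \<noteq> s" "r \<noteq> t" "s \<noteq> t"
    and "small_radius r s t r \<rho>\<^sub>r" "small_radius r s t s \<rho>\<^sub>s" "small_radius r s t t \<rho>\<^sub>t"
  shows "perfect_pairing (H1_sl r s t R S T) (H0_apparent r s t R S T) serre_pairing \<and>
    is_basis3 (H1_sl r s t R S T)
      (tangent_vector r s t R S T r \<rho>\<^sub>r)
      (tangent_vector r s t R S T s \<rho>\<^sub>s)
      (tangent_vector r s t R S T t \<rho>\<^sub>t) \<and>
    is_basis3 (H0_apparent r s t R S T)
      (theta r s t r R) (theta r s t s S) (theta r s t t T) \<and>
    (\<forall>(i, \<rho>) \<in> {(r, \<rho>\<^sub>r), (s, \<rho>\<^sub>s), (t, \<rho>\<^sub>t)}. \<forall>(j, Z) \<in> {(r, R), (s, S), (t, T)}.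
       serre_pairing (tangent_vector r s t R S T i \<rho>) (theta r s t j Z) = (if i = j then 1 else 0))"
proof -
  interpret parabolic_data r s t R S T
    using assms(1-6) by unfold_locales
  show ?thesis
    by (intro conjI perfect_serre_pairing[OF assms(7-9)] is_basis3_tangent_vectors[OF assms(7-9)]
        is_basis3_theta serre_pairing_dual_basis[OF assms(7-9)])
qed

end
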